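(* Let $n\ge1$, $1<p<\infty$, let $\Theta\subset\mathbf{R}^{n+1}$ be a bounded open set and let $\xi_0=(0,0)\in\partial\Theta$. If there exist $\theta>1$, $r>0$ and a unit vector $v\in\mathbf{R}^n$ such that $$C:=\{(x,t)\in\mathbf{R}^{n+1}:|(x,t)|<\theta\,x\cdot v,\ t\le0\text{ and }|x|<r\}\subset\mathbf{R}^{n+1}\setminus\Theta,$$ then $\xi_0$ is regular with respect to $\Theta$.
   Context: Points of $\mathbf{R}^{n+1}$ are written $(x,t)$ with $x\in\mathbf{R}^n$, $t\in\mathbf{R}$; $|(x,t)|$ is the Euclidean norm in $\mathbf{R}^{n+1}$; $\nabla$ and $\operatorname{div}$ are taken with respect to $x$ only. The equation considered is $\partial_t u=\Delta_p u:=\operatorname{div}(|\nabla u|^{p-2}\nabla u)$. For an open set $U\subset\mathbf{R}^n$ and $t_1<t_2$ let $U_{t_1,t_2}=U\times(t_1,t_2)$; $D'\Subset D$ means that $\overline{D'}$ is a compact subset of $D$. A function $u$ on $\Theta$ is \emph{$p$-parabolic} if it is a continuous weak solution, i.e. $u$ is continuous and, whenever $U_{t_1,t_2}\Subset\Theta$, one has $u\in L^p(t_1,t_2;W^{1,p}(U))$, $t\mapsto\int_U|u(x,t)|^2\,dx$ is continuous on $[t_1,t_2]$, and $\int_{t_1}^{t_2}\int_U|\nabla u|^{p-2}\nabla u\cdot\nabla\varphi\,dx\,dt-\int_{t_1}^{t_2}\int_U u\,\partial_t\varphi\,dx\,dt=0$ for all $\varphi\in C_0^\infty(U_{t_1,t_2})$.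 A space-time box is $Q_{t_1,t_2}$ with $Q=(a_1,b_1)\times\cdots\times(a_n,b_n)$; its parabolic boundary is $\partial_pQ_{t_1,t_2}=(\overline{Q}\times\{t_1\})\cup(\partial Q\times(t_1,t_2])$. A function $u:\Theta\to(-\infty,\infty]$ is \emph{$p$-superparabolic} if (i) $u$ is lower semicontinuous; (ii) $u$ is finite in a dense subset of $\Theta$; (iii) for each space-time box $Q_{t_1,t_2}\Subset\Theta$: if $h$ is $p$-parabolic in $Q_{t_1,t_2}$, continuous on $\overline{Q}_{t_1,t_2}$ and $h\le u$ on $\partial_pQ_{t_1,t_2}$, then $h\le u$ in $Q_{t_1,t_2}$. For a bounded function $f:\partial\Theta\to\mathbf{R}$, the upper class $\mathcal{U}_f$ is the set of all $p$-superparabolic functions $u$ on $\Theta$ which are bounded below and satisfy $\liminf_{\Theta\ni\eta\to\xi}u(\eta)\ge f(\xi)$ for all $\xi\in\partial\Theta$. The upper Perron solution is $\overline{H}f(\xi)=\inf_{u\in\mathcal{U}_f}u(\xi)$, $\xi\in\Theta$. A point $\xi_0\in\partial\Theta$ is \emph{regular} with respect to $\Theta$ if $\lim_{\Theta\ni\xi\to\xi_0}\overline{H}f(\xi)=f(\xi_0)$ for every continuous $f:\partial\Theta\to\mathbf{R}$. *)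

theory Defs
  imports "HOL-Analysis.Analysis"
begin

section \<open>Smooth functions, test functions and weak gradients\<close>

fun Ck_smooth :: "nat \<Rightarrow> ('a::real_normed_vector \<Rightarrow> real) \<Rightarrow> bool" where
  "Ck_smooth 0 f \<longleftrightarrow> continuous_on UNIV f"
| "Ck_smooth (Suc k) f \<longleftrightarrow>
     (\<forall>x. f differentiable (at x)) \<and> (\<forall>v. Ck_smooth k (\<lambda>x. frechet_derivative f (at x) v))"

definition test_function :: "'a::euclidean_space set \<Rightarrow> ('a \<Rightarrow> real) \<Rightarrow> bool" where
  "test_function U \<phi> \<longleftrightarrow>
     (\<forall>k. Ck_smooth k \<phi>) \<and> compact (closure {x. \<phi> x \<noteq> 0}) \<and> closure {x. \<phi> x \<noteq> 0} \<subseteq> U"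

definition Lp_on :: "real \<Rightarrow> 'a::euclidean_space set \<Rightarrow> ('a \<Rightarrow> 'b::euclidean_space) \<Rightarrow> bool" where
  "Lp_on p U f \<longleftrightarrow>
     set_borel_measurable lborel U f \<and> set_integrable lborel U (\<lambda>x. norm (f x) powr p)"

definition has_weak_gradient :: "'a::euclidean_space set \<Rightarrow> ('a \<Rightarrow> real) \<Rightarrow> ('a \<Rightarrow> 'a) \<Rightarrow> bool" where
  "has_weak_gradient U w g \<longleftrightarrow>
     (\<forall>\<phi>. test_function U \<phi> \<longrightarrow>
       (\<forall>e\<in>Basis. (LINT x:U|lborel. w x * frechet_derivative \<phi> (at x) e)
                 = - (LINT x:U|lborel. (g x \<bullet> e) * \<phi> x)))"

text \<open>\<open>w\<close> belongs to \<open>W\<^sup>1\<^sup>,\<^sup>p(U)\<close> and \<open>g\<close> is its weak gradient.\<close>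

definition W1p_with_gradient ::
    "real \<Rightarrow> 'a::euclidean_space set \<Rightarrow> ('a \<Rightarrow> real) \<Rightarrow> ('a \<Rightarrow> 'a) \<Rightarrow> bool" where
  "W1p_with_gradient p U w g \<longleftrightarrow> Lp_on p U w \<and> Lp_on p U g \<and> has_weak_gradient U w g"

section \<open>\<open>p\<close>-parabolic functions\<close>

definition cylinder :: "'a set \<Rightarrow> real \<Rightarrow> real \<Rightarrow> ('a \<times> real) set" where
  "cylinder U t1 t2 = U \<times> {t1<..<t2}"

definition compactly_inside :: "'a::topological_space set \<Rightarrow> 'a set \<Rightarrow> bool" where
  "compactly_inside D' D \<longleftrightarrow> compact (closure D') \<and> closure D' \<subseteq> D"

definition space_gradient ::
    "('a::euclidean_space \<times> real \<Rightarrow> real) \<Rightarrow> 'a \<times> real \<Rightarrow> 'a" where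
  "space_gradient \<phi> z = (\<Sum>e\<in>Basis. frechet_derivative \<phi> (at z) (e, 0) *\<^sub>R e)"

definition time_derivative ::
    "('a::euclidean_space \<times> real \<Rightarrow> real) \<Rightarrow> 'a \<times> real \<Rightarrow> real" where
  "time_derivative \<phi> z = frechet_derivative \<phi> (at z) (0, 1)"

text \<open>\<open>u\<close> belongs to the parabolic space \<open>L\<^sup>p(t1,t2;W\<^sup>1\<^sup>,\<^sup>p(U))\<close>, and \<open>g\<close> is a jointly measurable
  choice of the weak gradients of the time slices of \<open>u\<close>.\<close>

definition LpW1p_with_gradient ::
    "real \<Rightarrow> 'a::euclidean_space set \<Rightarrow> real \<Rightarrow> real \<Rightarrow>
     ('a \<times> real \<Rightarrow> real) \<Rightarrow> ('a \<times> real \<Rightarrow> 'a) \<Rightarrow> bool" where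
  "LpW1p_with_gradient p U t1 t2 u g \<longleftrightarrow>
     Lp_on p (cylinder U t1 t2) u \<and> Lp_on p (cylinder U t1 t2) g \<and>
     (AE t in lborel. t \<in> {t1<..<t2} \<longrightarrow>
        W1p_with_gradient p U (\<lambda>x. u (x, t)) (\<lambda>x. g (x, t)))"

text \<open>Where \<open>\<nabla>u = 0\<close> the term \<open>|\<nabla>u|\<^sup>p\<^sup>-\<^sup>2\<nabla>u\<close> is read as \<open>0\<close>, also for \<open>p < 2\<close>.\<close>

definition p_parabolic ::
    "real \<Rightarrow> ((real^'n) \<times> real) set \<Rightarrow> ((real^'n) \<times> real \<Rightarrow> real) \<Rightarrow> bool" where
  "p_parabolic p \<Theta> u \<longleftrightarrow>
     continuous_on \<Theta> u \<and>
     (\<forall>U t1 t2. open U \<and> t1 < t2 \<and> compactly_inside (cylinder U t1 t2) \<Theta> \<longrightarrow>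
        continuous_on {t1..t2} (\<lambda>t. LINT x:U|lborel. \<bar>u (x, t)\<bar>\<^sup>2) \<and>
        (\<exists>g. LpW1p_with_gradient p U t1 t2 u g \<and>
          (\<forall>\<phi>. test_function (cylinder U t1 t2) \<phi> \<longrightarrow>
             (LINT t:{t1<..<t2}|lborel. LINT x:U|lborel.
                (norm (g (x, t)) powr (p - 2) *\<^sub>R g (x, t)) \<bullet> space_gradient \<phi> (x, t))
           - (LINT t:{t1<..<t2}|lborel. LINT x:U|lborel. u (x, t) * time_derivative \<phi> (x, t))
           = 0)))"

section \<open>\<open>p\<close>-superparabolic functions\<close>

definition parabolic_boundary ::
    "'a::topological_space set \<Rightarrow> real \<Rightarrow> real \<Rightarrow> ('a \<times> real) set" where
  "parabolic_boundary Q t1 t2 = closure Q \<times> {t1} \<union> frontier Q \<times> {t1<..t2}"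

definition lower_semicontinuous_on :: "'a::topological_space set \<Rightarrow> ('a \<Rightarrow> ereal) \<Rightarrow> bool" where
  "lower_semicontinuous_on S u \<longleftrightarrow> (\<forall>z\<in>S. u z \<le> Liminf (at z within S) u)"

definition p_superparabolic ::
    "real \<Rightarrow> ((real^'n) \<times> real) set \<Rightarrow> ((real^'n) \<times> real \<Rightarrow> ereal) \<Rightarrow> bool" where
  "p_superparabolic p \<Theta> u \<longleftrightarrow>
     (\<forall>z\<in>\<Theta>. u z \<noteq> -\<infinity>) \<and>
     lower_semicontinuous_on \<Theta> u \<and>
     \<Theta> \<subseteq> closure {z\<in>\<Theta>. u z \<noteq> \<infinity>} \<and>
     (\<forall>a b t1 t2 h. (\<forall>i. a $ i < b $ i) \<and> t1 < t2 \<and>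
        compactly_inside (cylinder (box a b) t1 t2) \<Theta> \<and>
        p_parabolic p (cylinder (box a b) t1 t2) h \<and>
        continuous_on (closure (cylinder (box a b) t1 t2)) h \<and>
        (\<forall>z\<in>parabolic_boundary (box a b) t1 t2. ereal (h z) \<le> u z) \<longrightarrow>
        (\<forall>z\<in>cylinder (box a b) t1 t2. ereal (h z) \<le> u z))"

section \<open>Perron solutions and regular boundary points\<close>

definition upper_class ::
    "real \<Rightarrow> ((real^'n) \<times> real) set \<Rightarrow> ((real^'n) \<times> real \<Rightarrow> real) \<Rightarrow>
     ((real^'n) \<times> real \<Rightarrow> ereal) set" where
  "upper_class p \<Theta> f =
     {u. p_superparabolic p \<Theta> u \<and> (\<exists>m::real. \<forall>z\<in>\<Theta>. ereal m \<le> u z) \<and>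
         (\<forall>\<xi>\<in>frontier \<Theta>. ereal (f \<xi>) \<le> Liminf (at \<xi> within \<Theta>) u)}"

definition upper_Perron ::
    "real \<Rightarrow> ((real^'n) \<times> real) set \<Rightarrow> ((real^'n) \<times> real \<Rightarrow> real) \<Rightarrow>
     (real^'n) \<times> real \<Rightarrow> ereal" where
  "upper_Perron p \<Theta> f \<xi> = (INF u\<in>upper_class p \<Theta> f. u \<xi>)"

text \<open>For bounded \<open>\<Theta>\<close>, continuous functions on the compact set \<open>frontier \<Theta>\<close> are bounded.\<close>

definition regular_point ::
    "real \<Rightarrow> ((real^'n) \<times> real) set \<Rightarrow> (real^'n) \<times> real \<Rightarrow> bool" where
  "regular_point p \<Theta> \<xi>\<^sub>0 \<longleftrightarrow> \<xi>\<^sub>0 \<in> frontier \<Theta> \<and>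
     (\<forall>f. continuous_on (frontier \<Theta>) f \<longrightarrow>
        (upper_Perron p \<Theta> f \<longlongrightarrow> ereal (f \<xi>\<^sub>0)) (at \<xi>\<^sub>0 within \<Theta>))"

end

theory Submission
  imports Defs
begin

text \<open>
  The barrier and its negative are both compared through exact solutions \<open>\<eta>(x) + c t\<close> that are radial
  in \<open>x\<close>. A function that is touched strictly from above, in the past, by such a solution at every
  point is superparabolic, because a weak solution cannot touch a classical one strictly from below in
  the past. The latter is a comparison principle, obtained by mollifying the difference of the two
  solutions; the flux terms pass to the limit since translations are continuous in \<open>L\<^sup>q\<close>, and the
  limit has a sign by monotonicity of \<open>\<xi> \<mapsto> |\<xi>|\<^sup>p\<^sup>-\<^sup>2\<xi>\<close>. Conversely the negated exact solutions are
  admissible in the defining comparison of a superparabolic \<open>u\<close>, so \<open>u\<close> lies above the negated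
  barrier without any existence theory for the Dirichlet problem.

  For \<open>t \<le> 0\<close> the barrier is built by iteration. At scale \<open>s\<close> the cone contains a ball of radius
  proportional to \<open>s\<close> around \<open>s v\<close> during a time proportional to \<open>s\<close>, and the minimum with a power
  of the distance to \<open>s v\<close> reduces the value at the tip by a fixed factor. For \<open>t > 0\<close> the barrier may
  jump upwards, so the complement of \<open>\<Theta>\<close> is not needed there and an explicit solution growing in
  \<open>|x|\<close> and \<open>t\<close> takes over.
\<close>

section \<open>Smooth bump functions\<close>

text \<open>For p \<noteq> 2 a multiple of a supersolution need not be a supersolution, so a single
  barrier cannot be scaled up to dominate the boundary data. Hence \<open>barrier_exists\<close>
  yields a separate barrier for each height M, radius \<rho> and accuracy \<epsilon>: at least M
  outside the ball of radius \<rho>, and below \<epsilon> near the tip. The factor \<open>q\<close>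
  gained in one iteration step depends on p, the dimension and the opening of the cone, but neither
  on the current height m nor on the scale s. Its powers therefore tend to 0, although the
  admissible scales do depend on m.

  The touching functions are exact solutions and not merely strict classical supersolutions, because
  the definition of a superparabolic function admits only solutions as competitors; one notion of
  barrier then serves both directions.

  A weak solution is not assumed to have a time derivative, so it cannot be tested with itself.
  Mollification does not commute with the nonlinear flux either; flux difference and gradient
  difference are mollified as two separate functions, for which the equation is linear.\<close>

lemma Ck_smooth_SucI:
  assumes "\<And>x. (f has_derivative f' x) (at x)" "\<And>v. Ck_smooth k (\<lambda>x. f' x v)"
  shows "Ck_smooth (Suc k) f"
proof -
  have "frechet_derivative f (at x) = f' x" for x
    using frechet_derivative_at[OF assms(1)] by simp
  then show ?thesis using assms by (auto simp: differentiable_def)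
qed

lemma Ck_smooth_Suc_has_derivative:
  "Ck_smooth (Suc k) f \<Longrightarrow> (f has_derivative frechet_derivative f (at x)) (at x)"
  by (simp add: frechet_derivative_works)

lemma Ck_smooth_SucD: "Ck_smooth (Suc k) f \<Longrightarrow> Ck_smooth k f"
proof (induction k arbitrary: f)
  case 0
  then show ?case
    by (auto simp: continuous_on_eq_continuous_at differentiable_imp_continuous_within)
qed simp

lemma Ck_smooth_const: "Ck_smooth k (\<lambda>x. c)"
proof (induction k arbitrary: c)
  case (Suc k)
  show ?case by (rule Ck_smooth_SucI[where f'="\<lambda>x v. 0"]) (auto intro: Suc)
qed simp

lemma Ck_smooth_add: "Ck_smooth k f \<Longrightarrow> Ck_smooth k g \<Longrightarrow> Ck_smooth k (\<lambda>x. f x + g x)"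
proof (induction k arbitrary: f g)
  case (Suc k)
  show ?case
    by (rule Ck_smooth_SucI
          [where f'="\<lambda>x v. frechet_derivative f (at x) v + frechet_derivative g (at x) v"])
       (use Suc in \<open>auto intro!: has_derivative_add simp: frechet_derivative_works\<close>)
qed (auto intro: continuous_intros)

lemma Ck_smooth_mult: "Ck_smooth k f \<Longrightarrow> Ck_smooth k g \<Longrightarrow> Ck_smooth k (\<lambda>x. f x * g x)"
proof (induction k arbitrary: f g)
  case (Suc k)
  note * = Ck_smooth_SucD[OF Suc.prems(1)] Ck_smooth_SucD[OF Suc.prems(2)]
  show ?case
    by (rule Ck_smooth_SucI[where f'="\<lambda>x v. f x * frechet_derivative g (at x) v
              + frechet_derivative f (at x) v * g x"])
       (use Suc * in \<open>auto intro!: has_derivative_mult Ck_smooth_add simp: frechet_derivative_works\<close>)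
qed (auto intro: continuous_intros)

lemma Ck_smooth_compose_affine:
  assumes L: "bounded_linear L"
  shows "Ck_smooth k f \<Longrightarrow> Ck_smooth k (\<lambda>x. f (L x + c))"
proof (induction k arbitrary: f)
  case 0
  have "continuous_on UNIV (\<lambda>x. L x + c)"
    by (intro continuous_intros linear_continuous_on L)
  then show ?case using 0 continuous_on_compose2[of UNIV f UNIV "\<lambda>x. L x + c"] by simp
next
  case (Suc k)
  have aff: "((\<lambda>x. L x + c) has_derivative L) (at x)" for x
    by (auto intro!: derivative_eq_intros bounded_linear_imp_has_derivative[OF L])
  show ?case
  proof (rule Ck_smooth_SucI[where f'="\<lambda>x v. frechet_derivative f (at (L x + c)) (L v)"])
    show "((\<lambda>x. f (L x + c)) has_derivative (\<lambda>v. frechet_derivative f (at (L x + c)) (L v))) (at x)" for x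
      using has_derivative_compose[OF aff Ck_smooth_Suc_has_derivative[OF Suc.prems]] by simp
    show "Ck_smooth k (\<lambda>x. frechet_derivative f (at (L x + c)) (L v))" for v
      using Suc.IH[of "\<lambda>y. frechet_derivative f (at y) (L v)"] Suc.prems by simp
  qed
qed

text \<open>The induction on k applies the statement to the derivative of the outer function, so the
  outer functions come as a family that differentiation maps into itself through
  \<open>D\<close>.\<close>

lemma Ck_smooth_compose_real:
  fixes F :: "'i \<Rightarrow> real \<Rightarrow> real"
  assumes F: "\<And>j x. (F j has_real_derivative F (D j) x) (at x)"
    and psi: "\<And>k. Ck_smooth k \<psi>"
  shows "Ck_smooth k (\<lambda>x. F j (\<psi> x))"
proof (induction k arbitrary: j)
  case 0
  have "continuous_on UNIV (F j)"
    using F by (meson DERIV_isCont continuous_at_imp_continuous_on)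
  then show ?case using psi[of 0] continuous_on_compose2[of UNIV "F j" UNIV \<psi>] by simp
next
  case (Suc k)
  show ?case
  proof (rule Ck_smooth_SucI[where f'="\<lambda>x v. frechet_derivative \<psi> (at x) v * F (D j) (\<psi> x)"])
    fix x
    have "(F j has_derivative (\<lambda>y. y * F (D j) (\<psi> x))) (at (\<psi> x))"
      using F[of j "\<psi> x"] by (simp add: has_field_derivative_def mult_commute_abs)
    from has_derivative_compose[OF Ck_smooth_Suc_has_derivative[OF psi] this]
    show "((\<lambda>x. F j (\<psi> x)) has_derivative (\<lambda>v. frechet_derivative \<psi> (at x) v * F (D j) (\<psi> x))) (at x)"
      by simp
    show "Ck_smooth k (\<lambda>x. frechet_derivative \<psi> (at x) v * F (D j) (\<psi> x))" for v
      using psi[of "Suc k"] by (intro Ck_smooth_mult Suc) auto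
  qed
qed

lemma Ck_smooth_inner_left: "Ck_smooth k (\<lambda>x. x \<bullet> b)"
proof (cases k)
  case (Suc j)
  show ?thesis unfolding Suc
    by (rule Ck_smooth_SucI[where f'="\<lambda>x v. v \<bullet> b"])
       (auto intro!: derivative_eq_intros Ck_smooth_const)
qed (auto intro!: continuous_intros)

lemma Ck_smooth_inner_self: "Ck_smooth k (\<lambda>x. x \<bullet> x)"
proof (cases k)
  case (Suc j)
  have *: "Ck_smooth j (\<lambda>x. 2 * (v \<bullet> x))" for v :: 'a
    using Ck_smooth_mult[OF Ck_smooth_const[of j 2] Ck_smooth_inner_left[of j v]] by (simp add: inner_commute)
  show ?thesis unfolding Suc
    by (rule Ck_smooth_SucI[where f'="\<lambda>x v. 2 * (x \<bullet> v)"])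
       (auto intro!: derivative_eq_intros * simp: inner_commute)
qed (auto intro!: continuous_intros)

text \<open>Repeated differentiation of exp(-1/x) produces polynomial factors in 1/x. Carrying the
  polynomial as a parameter makes the family closed under derivatives, as
  \<open>Ck_smooth_compose_real\<close> demands.\<close>

definition flat_exp :: "real poly \<Rightarrow> real \<Rightarrow> real" where
  "flat_exp q x = (if 0 < x then poly q (1 / x) * exp (- (1 / x)) else 0)"

lemma poly_times_exp_tendsto_0: "((\<lambda>y::real. poly q y * exp (- y)) \<longlongrightarrow> 0) at_top"
proof -
  have "((\<lambda>y::real. \<Sum>i\<le>degree q. coeff q i * (y ^ i / exp y)) \<longlongrightarrow> (\<Sum>i\<le>degree q. coeff q i * 0)) at_top"
    by (intro tendsto_sum tendsto_mult tendsto_const tendsto_power_div_exp_0)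
  then show ?thesis
    by (simp add: poly_altdef sum_distrib_right exp_minus field_simps sum_divide_distrib)
qed

text \<open>With y = 1/x one has dy/dx = -y^2, so q(y) exp(-y) has derivative y^2 (q(y) - q'(y))
  exp(-y); \<open>[:0, 0, 1:]\<close> is the factor y^2. At 0 the exponential decay beats every
  polynomial in y.\<close>

lemma flat_exp_has_derivative:
  "(flat_exp q has_real_derivative flat_exp ([:0, 0, 1:] * (q - pderiv q)) x) (at x)"
proof (cases x "0::real" rule: linorder_cases)
  case less
  have "(flat_exp q has_real_derivative 0) (at x)"
    by (rule DERIV_cong_ev[THEN iffD2, OF refl _ refl, of _ "\<lambda>_. 0"])
       (use less eventually_nhds_in_open[of "{..<0}" x] in
         \<open>auto simp: flat_exp_def elim!: eventually_mono\<close>)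
  then show ?thesis using less by (simp add: flat_exp_def)
next
  case greater
  have "((\<lambda>x. poly q (1 / x) * exp (- (1 / x))) has_real_derivative
       poly ([:0, 0, 1:] * (q - pderiv q)) (1 / x) * exp (- (1 / x))) (at x)"
    using greater by (auto intro!: derivative_eq_intros
       poly_DERIV[THEN DERIV_chain2] simp: field_simps power2_eq_square)
  then have "(flat_exp q has_real_derivative
       poly ([:0, 0, 1:] * (q - pderiv q)) (1 / x) * exp (- (1 / x))) (at x)"
    by (rule DERIV_cong_ev[THEN iffD1, OF refl _ refl, rotated])
       (use greater eventually_nhds_in_open[of "{0<..}" x] in
         \<open>auto simp: flat_exp_def elim!: eventually_mono\<close>)
  then show ?thesis using greater by (simp add: flat_exp_def)
next
  case equal
  \<comment> \<open>Division by x multiplies q(y) by y = 1/x, and y q(y) is the value of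
    \<open>pCons 0 q\<close> at y.\<close>
  have lim: "((\<lambda>x. poly (pCons 0 q) (inverse x) * exp (- inverse x)) \<longlongrightarrow> 0) (at_right (0::real))"
    using poly_times_exp_tendsto_0 filterlim_inverse_at_top_right by (rule filterlim_compose)
  have "((\<lambda>x. flat_exp q x / x) \<longlongrightarrow> 0) (at_right 0)"
    by (rule Lim_transform_eventually[OF lim])
       (auto simp: flat_exp_def eventually_at_filter inverse_eq_divide)
  moreover have "((\<lambda>x. flat_exp q x / x) \<longlongrightarrow> 0) (at_left 0)"
    by (rule Lim_transform_eventually[OF tendsto_const])
       (auto simp: flat_exp_def eventually_at_filter)
  ultimately have "((\<lambda>x. flat_exp q x / x) \<longlongrightarrow> 0) (at 0)"
    by (simp add: filterlim_split_at)
  then show ?thesis using equal by (simp add: flat_exp_def has_field_derivative_iff)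
qed

definition bump :: "'a::euclidean_space \<Rightarrow> real" where
  "bump z = flat_exp 1 (1 - z \<bullet> z)"

lemma Ck_smooth_bump: "Ck_smooth k bump"
proof -
  have "Ck_smooth k (\<lambda>z::'a. 1 + (-1) * (z \<bullet> z))" for k
    by (intro Ck_smooth_add Ck_smooth_mult Ck_smooth_const Ck_smooth_inner_self)
  then have "Ck_smooth k (\<lambda>z::'a. 1 - z \<bullet> z)" for k by simp
  from Ck_smooth_compose_real[where F=flat_exp and D="\<lambda>q. [:0, 0, 1:] * (q - pderiv q)",
      OF flat_exp_has_derivative this]
  show ?thesis unfolding bump_def by blast
qed

lemma bump_nonneg: "0 \<le> bump z" by (simp add: bump_def flat_exp_def)

lemma bump_pos_iff: "0 < bump z \<longleftrightarrow> norm z < 1"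
proof -
  have "norm z < 1 \<longleftrightarrow> z \<bullet> z < 1"
    by (simp add: norm_eq_sqrt_inner)
  then show ?thesis by (simp add: bump_def flat_exp_def)
qed

section \<open>Integration by parts and convolution\<close>

lemma distr_lborel_reflect:
  fixes z :: "'a::euclidean_space"
  shows "distr lborel borel (\<lambda>x. z - x) = lborel"
  using lborel_affine[of "-1" z] by (simp add: density_1)

lemma integral_lborel_reflect:
  fixes z :: "'a::euclidean_space" and f :: "'a \<Rightarrow> real"
  assumes [measurable]: "f \<in> borel_measurable borel"
  shows "(LINT x|lborel. f (z - x)) = (LINT x|lborel. f x)"
  by (subst (2) distr_lborel_reflect[of z, symmetric], subst integral_distr) auto

lemma integrable_lborel_reflect:
  fixes z :: "'a::euclidean_space" and f :: "'a \<Rightarrow> real"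
  assumes "integrable lborel f"
  shows "integrable lborel (\<lambda>x. f (z - x))"
  using integrable_distr[of "\<lambda>x. z - x" lborel borel f] assms
  by (simp add: distr_lborel_reflect)

lemma nn_integral_lborel_translate:
  fixes a :: "'a::euclidean_space"
  assumes [measurable]: "f \<in> borel_measurable borel"
  shows "(\<integral>\<^sup>+x. f (x - a) \<partial>lborel) = (\<integral>\<^sup>+x. f x \<partial>lborel)"
  by (subst (2) lborel_distr_plus[of "-a", symmetric], subst nn_integral_distr) auto

lemma integral_lborel_translate:
  fixes a :: "'a::euclidean_space" and f :: "'a \<Rightarrow> real"
  assumes [measurable]: "f \<in> borel_measurable borel"
  shows "(LINT x|lborel. f (x + a)) = (LINT x|lborel. f x)"
  by (subst (2) lborel_distr_plus[of a, symmetric], subst integral_distr) (auto simp: add.commute)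

lemma integrable_lborel_translate:
  fixes a :: "'a::euclidean_space" and f :: "'a \<Rightarrow> real"
  assumes "integrable lborel f"
  shows "integrable lborel (\<lambda>x. f (x + a))"
  using integrable_distr[of "(+) a" lborel borel f] assms
  by (simp add: lborel_distr_plus add.commute)

lemma integrable_continuous_compact_support:
  fixes F :: "'a::euclidean_space \<Rightarrow> real"
  assumes "continuous_on UNIV F" "compact S" "\<And>z. z \<notin> S \<Longrightarrow> F z = 0"
  shows "integrable lborel F"
proof -
  have "integrable lborel (\<lambda>x. indicator S x *\<^sub>R F x)"
    by (intro borel_integrable_compact assms continuous_on_subset[OF assms(1)]) auto
  also have "(\<lambda>x. indicator S x *\<^sub>R F x) = F"
    using assms(3) by (fastforce simp: indicator_def)
  finally show ?thesis .
qed

lemma directional_derivative_shift: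
  fixes F :: "'a::real_normed_vector \<Rightarrow> real"
  assumes "\<And>z. ((\<lambda>s. F (z + s *\<^sub>R e)) has_real_derivative F' z) (at 0)"
  shows "((\<lambda>s. F (z + s *\<^sub>R e)) has_real_derivative F' (z + s0 *\<^sub>R e)) (at s0)"
proof -
  have "((\<lambda>s. F (z + (s + s0) *\<^sub>R e)) has_real_derivative F' (z + s0 *\<^sub>R e)) (at 0)"
    using assms[of "z + s0 *\<^sub>R e"] by (simp add: algebra_simps)
  then show ?thesis
    using DERIV_shift[of "\<lambda>s. F (z + s *\<^sub>R e)" "F' (z + s0 *\<^sub>R e)" 0 s0] by simp
qed

lemma directional_derivative_diff_quotient_le:
  fixes F :: "'a::real_normed_vector \<Rightarrow> real"
  assumes D: "\<And>z. ((\<lambda>s. F (z + s *\<^sub>R e)) has_real_derivative F' z) (at 0)"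
    and C: "\<And>z. \<bar>F' z\<bar> \<le> C"
  shows "\<bar>(F (z + h *\<^sub>R e) - F z) / h\<bar> \<le> C"
proof (cases "h = 0")
  case False
  have "\<bar>F (z + h *\<^sub>R e) - F (z + 0 *\<^sub>R e)\<bar> \<le> C * \<bar>h - 0\<bar>"
    using field_differentiable_bound[of UNIV "\<lambda>s. F (z + s *\<^sub>R e)" "\<lambda>s. F' (z + s *\<^sub>R e)" C h 0]
      directional_derivative_shift[OF D] C by auto
  with False show ?thesis by (simp add: abs_divide divide_le_eq)
qed (use C[of z] in auto)

text \<open>Every difference quotient of F integrates to 0, because Lebesgue measure is translation
  invariant, and the quotients converge to F' under a common majorant. This is the divergence
  theorem for compactly supported fields, one component at a time.\<close>

lemma integral_directional_derivative_eq_0: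
  fixes F :: "'a::euclidean_space \<Rightarrow> real"
  assumes D: "\<And>z. ((\<lambda>s. F (z + s *\<^sub>R e)) has_real_derivative F' z) (at 0)"
    and cF: "continuous_on UNIV F" and cF': "continuous_on UNIV F'"
    and S: "compact S" and F0: "\<And>z. z \<notin> S \<Longrightarrow> F z = 0"
  shows "integrable lborel F'" "(LINT z|lborel. F' z) = 0"
proof -
  have F'0: "F' z = 0" if "z \<notin> S" for z
  proof -
    have "open ((\<lambda>s. z + s *\<^sub>R e) -` (- S))"
      using S by (intro open_vimage continuous_intros) (auto simp: compact_imp_closed)
    then have "\<forall>\<^sub>F s in nhds 0. s \<in> (\<lambda>s. z + s *\<^sub>R e) -` (- S)"
      using that by (intro eventually_nhds_in_open) auto
    then have "\<forall>\<^sub>F s in nhds 0. F (z + s *\<^sub>R e) = 0"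
      by (rule eventually_mono) (auto simp: F0)
    from DERIV_cong_ev[OF refl this refl]
    have "((\<lambda>s. F (z + s *\<^sub>R e)) has_real_derivative 0) (at 0)" by simp
    from DERIV_unique[OF D this] show ?thesis .
  qed
  have "bounded (F' ` S)"
    by (intro compact_imp_bounded compact_continuous_image S continuous_on_subset[OF cF']) auto
  then obtain C0 where C0: "\<And>z. z \<in> S \<Longrightarrow> \<bar>F' z\<bar> \<le> C0"
    by (auto simp: bounded_iff)
  define C where "C = max C0 0"
  have C: "\<bar>F' z\<bar> \<le> C" for z
    using C0[of z] F'0[of z] by (cases "z \<in> S") (auto simp: C_def)
  obtain R where R: "\<And>z. z \<in> S \<Longrightarrow> norm z \<le> R"
    using S compact_imp_bounded by (metis bounded_iff)
  \<comment> \<open>The increments are at most 1, so all difference quotients vanish outside the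
    support enlarged by \<open>norm e\<close>.\<close>
  define B where "B = cball (0::'a) (R + norm e)"
  define h where "h i = 1 / real (Suc i)" for i
  define q where "q i z = (F (z + h i *\<^sub>R e) - F z) / h i" for i z
  have [measurable]: "F \<in> borel_measurable borel" "F' \<in> borel_measurable borel"
    using cF cF' by (auto intro: borel_measurable_continuous_onI)
  have h: "h \<longlonglongrightarrow> 0" "\<And>i. h i > 0" "\<And>i. h i \<le> 1"
    unfolding h_def using LIMSEQ_Suc[OF lim_1_over_n] by (auto simp: field_simps)
  have lim: "(\<lambda>i. q i z) \<longlonglongrightarrow> F' z" for z
  proof -
    have "((\<lambda>s. (F (z + s *\<^sub>R e) - F (z + 0 *\<^sub>R e)) / (s - 0)) \<longlongrightarrow> F' z) (at 0)"
      using D[of z] unfolding has_field_derivative_iff .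
    moreover have "\<forall>i. h i \<in> UNIV - {0}" using h(2) by (simp add: less_imp_neq[THEN not_sym])
    ultimately show ?thesis
      using h(1) unfolding tendsto_at_iff_sequentially comp_def q_def by simp
  qed
  have bd: "norm (q i z) \<le> C * indicator B z" for i z
  proof (cases "z \<in> B")
    case True
    then show ?thesis using directional_derivative_diff_quotient_le[OF D C, of z "h i"]
      by (simp add: q_def)
  next
    case False
    then have z: "norm z > R + norm e" by (auto simp: B_def)
    have "norm (h i *\<^sub>R e) \<le> norm e"
      using h(2,3)[of i] by (auto intro: mult_left_le_one_le)
    then have "norm (z + h i *\<^sub>R e) > R"
      using z norm_diff_ineq[of z "h i *\<^sub>R e"] by linarith
    moreover have "norm z > R" using z norm_ge_zero[of e] by linarith
    ultimately have "F (z + h i *\<^sub>R e) = 0" "F z = 0"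
      using R F0 by (meson not_less)+
    then show ?thesis using False by (simp add: q_def)
  qed
  have w: "integrable lborel (\<lambda>z. C * indicator B z :: real)"
    using emeasure_lborel_cball_finite[of "0::'a" "R + norm e"] unfolding B_def
    by (intro integrable_mult_right integrable_real_indicator) auto
  have qm: "q i \<in> borel_measurable lborel" for i
    unfolding q_def[abs_def] by measurable
  show "integrable lborel F'"
    by (rule integrable_dominated_convergence[OF _ _ w, of F' q])
       (use lim bd qm in auto)
  have "(\<lambda>i. LINT z|lborel. q i z) \<longlonglongrightarrow> (LINT z|lborel. F' z)"
    by (rule integral_dominated_convergence[OF _ _ w])
       (use lim bd qm in auto)
  moreover have "(LINT z|lborel. q i z) = 0" for i
  proof -
    have iF: "integrable lborel F"
      by (rule integrable_continuous_compact_support[OF cF S F0])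
    show ?thesis unfolding q_def
      by (simp add: iF integrable_lborel_translate integral_lborel_translate)
  qed
  ultimately have "(\<lambda>i. 0) \<longlonglongrightarrow> (LINT z|lborel. F' z)" by simp
  then show "(LINT z|lborel. F' z) = 0" by (simp add: LIMSEQ_const_iff)
qed

section \<open>Convolution with bounded continuous kernels\<close>

definition conv :: "('a::euclidean_space \<Rightarrow> real) \<Rightarrow> ('a \<Rightarrow> real) \<Rightarrow> 'a \<Rightarrow> real" where
  "conv k f z = (LINT \<zeta>|lborel. k (z - \<zeta>) * f \<zeta>)"

lemma integrable_conv:
  fixes k f :: "'a::euclidean_space \<Rightarrow> real"
  assumes "continuous_on UNIV k" "\<And>z. \<bar>k z\<bar> \<le> C" "integrable lborel f"
  shows "integrable lborel (\<lambda>\<zeta>. k (z - \<zeta>) * f \<zeta>)"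
proof (rule Bochner_Integration.integrable_bound)
  show "integrable lborel (\<lambda>\<zeta>. C * f \<zeta>)" using assms by simp
  have [measurable]: "k \<in> borel_measurable borel" "f \<in> borel_measurable borel"
    using assms by (auto intro: borel_measurable_continuous_onI)
  show "(\<lambda>\<zeta>. k (z - \<zeta>) * f \<zeta>) \<in> borel_measurable lborel" by measurable
  show "AE \<zeta> in lborel. norm (k (z - \<zeta>) * f \<zeta>) \<le> norm (C * f \<zeta>)"
    using assms(2) by (auto simp: abs_mult intro!: mult_right_mono order_trans[OF assms(2)])
qed

lemma conv_reflect:
  assumes "continuous_on UNIV k" "integrable lborel f"
  shows "conv k f z = (LINT a|lborel. k a * f (z - a))"
proof -
  have [measurable]: "k \<in> borel_measurable borel" "f \<in> borel_measurable borel"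
    using assms by (auto intro: borel_measurable_continuous_onI)
  show ?thesis
    using integral_lborel_reflect[of "\<lambda>a. k a * f (z - a)" z] by (simp add: conv_def)
qed

lemma continuous_on_conv:
  assumes k: "continuous_on UNIV k" "\<And>z. \<bar>k z\<bar> \<le> C" and f: "integrable lborel f"
  shows "continuous_on UNIV (conv k f)"
  unfolding continuous_on_eq_continuous_at[OF open_UNIV] continuous_at_sequentially
proof (intro ballI allI impI)
  fix z :: 'a and X assume X: "X \<longlonglongrightarrow> z"
  have [measurable]: "k \<in> borel_measurable borel" "f \<in> borel_measurable borel"
    using assms by (auto intro: borel_measurable_continuous_onI)
  have "(\<lambda>i. LINT \<zeta>|lborel. k (X i - \<zeta>) * f \<zeta>) \<longlonglongrightarrow> (LINT \<zeta>|lborel. k (z - \<zeta>) * f \<zeta>)"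
  proof (rule integral_dominated_convergence)
    show "integrable lborel (\<lambda>\<zeta>. C * \<bar>f \<zeta>\<bar>)" using f by simp
    show "AE \<zeta> in lborel. (\<lambda>i. k (X i - \<zeta>) * f \<zeta>) \<longlonglongrightarrow> k (z - \<zeta>) * f \<zeta>"
      by (intro AE_I2 tendsto_intros X continuous_on_tendsto_compose[OF k(1)]) auto
    show "AE \<zeta> in lborel. norm (k (X i - \<zeta>) * f \<zeta>) \<le> C * \<bar>f \<zeta>\<bar>" for i
      by (auto simp: abs_mult intro!: AE_I2 mult_right_mono k)
  qed measurable
  then show "(conv k f \<circ> X) \<longlonglongrightarrow> conv k f z"
    by (simp add: conv_def[abs_def] comp_def)
qed

text \<open>The difference quotient falls on the kernel and is bounded there by \<open>C'\<close>,
  so C' |f| is an integrable majorant.\<close>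

lemma conv_directional_derivative:
  assumes D: "\<And>z. ((\<lambda>s. k (z + s *\<^sub>R e)) has_real_derivative k' z) (at 0)"
    and k: "continuous_on UNIV k" "\<And>z. \<bar>k z\<bar> \<le> C"
    and k': "continuous_on UNIV k'" "\<And>z. \<bar>k' z\<bar> \<le> C'"
    and f: "integrable lborel f"
  shows "((\<lambda>s. conv k f (z + s *\<^sub>R e)) has_real_derivative conv k' f z) (at 0)"
  unfolding has_field_derivative_iff tendsto_at_iff_sequentially
proof (intro allI impI)
  fix X :: "nat \<Rightarrow> real" assume X0: "\<forall>i. X i \<in> UNIV - {0}" and X: "X \<longlonglongrightarrow> 0"
  have [measurable]: "k \<in> borel_measurable borel" "k' \<in> borel_measurable borel"
      "f \<in> borel_measurable borel"
    using assms by (auto intro: borel_measurable_continuous_onI)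
  let ?q = "\<lambda>i \<zeta>. (k (z - \<zeta> + X i *\<^sub>R e) - k (z - \<zeta>)) / X i"
  have "(\<lambda>i. LINT \<zeta>|lborel. ?q i \<zeta> * f \<zeta>) \<longlonglongrightarrow> (LINT \<zeta>|lborel. k' (z - \<zeta>) * f \<zeta>)"
  proof (rule integral_dominated_convergence)
    show "integrable lborel (\<lambda>\<zeta>. C' * \<bar>f \<zeta>\<bar>)" using f by simp
    have "(\<lambda>i. ?q i \<zeta>) \<longlonglongrightarrow> k' (z - \<zeta>)" for \<zeta>
    proof -
      have "((\<lambda>s. (k (z - \<zeta> + s *\<^sub>R e) - k (z - \<zeta>)) / s) \<longlongrightarrow> k' (z - \<zeta>)) (at 0)"
        using D[of "z - \<zeta>"] unfolding has_field_derivative_iff by simp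
      then show ?thesis using X0 X unfolding tendsto_at_iff_sequentially comp_def by auto
    qed
    then show "AE \<zeta> in lborel. (\<lambda>i. ?q i \<zeta> * f \<zeta>) \<longlonglongrightarrow> k' (z - \<zeta>) * f \<zeta>"
      by (intro AE_I2 tendsto_intros)
    show "AE \<zeta> in lborel. norm (?q i \<zeta> * f \<zeta>) \<le> C' * \<bar>f \<zeta>\<bar>" for i
      by (intro AE_I2) (simp only: real_norm_def abs_mult,
        intro mult_right_mono directional_derivative_diff_quotient_le[OF D k'(2)] abs_ge_zero)
  qed measurable
  moreover have *: "(LINT \<zeta>|lborel. ?q i \<zeta> * f \<zeta>)
      = (conv k f (z + X i *\<^sub>R e) - conv k f (z + 0 *\<^sub>R e)) / (X i - 0)" for i
  proof -
    have "(LINT \<zeta>|lborel. ?q i \<zeta> * f \<zeta>) = (LINT \<zeta>|lborel.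
         (k (z + X i *\<^sub>R e - \<zeta>) * f \<zeta> - k (z - \<zeta>) * f \<zeta>) / X i)"
      by (intro Bochner_Integration.integral_cong) (auto simp: field_simps)
    then show ?thesis
      by (simp add: conv_def integrable_conv[OF k f])
  qed
  ultimately show "((\<lambda>y. (conv k f (z + y *\<^sub>R e) - conv k f (z + 0 *\<^sub>R e)) / (y - 0)) \<circ> X)
      \<longlonglongrightarrow> conv k' f z"
    unfolding comp_def * by (simp only: conv_def)
qed

text \<open>As k has mass 1 and lives in the ball of radius \<delta>, the difference is an average
  of f(\<zeta>) - f(z) over |z - \<zeta>| < \<delta>.\<close>

lemma conv_close:
  assumes k: "continuous_on UNIV k" "\<And>z. 0 \<le> k z" "\<And>z. \<delta> \<le> norm z \<Longrightarrow> k z = 0"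
     "integrable lborel k" "(LINT z|lborel. k z) = 1"
    and f: "integrable lborel f"
    and close: "\<And>\<zeta>. norm (z - \<zeta>) < \<delta> \<Longrightarrow> \<bar>f \<zeta> - f z\<bar> \<le> \<epsilon>"
    and bd: "\<And>z. \<bar>k z\<bar> \<le> C"
  shows "\<bar>conv k f z - f z\<bar> \<le> \<epsilon>"
proof -
  have i: "integrable lborel (\<lambda>\<zeta>. k (z - \<zeta>))" "(LINT \<zeta>|lborel. k (z - \<zeta>)) = 1"
    using integrable_lborel_reflect[OF k(4)] integral_lborel_reflect[of k z] k
    by (auto intro: borel_measurable_continuous_onI)
  have ic: "integrable lborel (\<lambda>\<zeta>. k (z - \<zeta>) * f \<zeta>)" by (rule integrable_conv[OF k(1) bd f])
  have "conv k f z - f z = (LINT \<zeta>|lborel. k (z - \<zeta>) * f \<zeta> - k (z - \<zeta>) * f z)"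
    using i ic by (simp add: conv_def)
  also have "\<bar>\<dots>\<bar> \<le> (LINT \<zeta>|lborel. k (z - \<zeta>) * \<epsilon>)"
  proof (rule integral_abs_bound_integral)
    show "\<bar>k (z - \<zeta>) * f \<zeta> - k (z - \<zeta>) * f z\<bar> \<le> k (z - \<zeta>) * \<epsilon>" for \<zeta>
    proof (cases "norm (z - \<zeta>) < \<delta>")
      case True
      have "\<bar>k (z - \<zeta>) * f \<zeta> - k (z - \<zeta>) * f z\<bar> = k (z - \<zeta>) * \<bar>f \<zeta> - f z\<bar>"
        using k(2)[of "z - \<zeta>"] by (simp add: abs_mult flip: right_diff_distrib)
      then show ?thesis using close[OF True] k(2) by (simp add: mult_left_mono)
    qed (use k(3) in auto)
  qed (use i ic in auto)
  finally show ?thesis using i by simp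
qed

section \<open>Density and translation in Lebesgue spaces\<close>

lemma powr_abs_add_le:
  fixes a b q :: real
  assumes "q > 0"
  shows "\<bar>a + b\<bar> powr q \<le> 2 powr q * (\<bar>a\<bar> powr q + \<bar>b\<bar> powr q)"
proof -
  define m where "m = max \<bar>a\<bar> \<bar>b\<bar>"
  have "\<bar>a + b\<bar> powr q \<le> (2 * m) powr q"
    using assms by (intro powr_mono2) (auto simp: m_def)
  also have "\<dots> = 2 powr q * m powr q" by (simp add: powr_mult m_def)
  also have "m powr q \<le> \<bar>a\<bar> powr q + \<bar>b\<bar> powr q" by (simp add: m_def max_def)
  finally show ?thesis by (simp add: mult_left_mono)
qed

lemma Youngs_inequality_scaled:
  fixes p q \<eta> :: real
  assumes "p > 1" "q > 1" "1 / p + 1 / q = 1" "\<eta> > 0"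
  obtains C where "C \<ge> 0" "\<And>x y. x \<ge> 0 \<Longrightarrow> y \<ge> 0 \<Longrightarrow> x * y \<le> C * x powr p + \<eta> * y powr q"
proof
  \<comment> \<open>Young's inequality is applied to x / l and l y; this l makes the coefficient
    \<open>l powr q / q\<close> of the second term equal to \<eta>.\<close>
  define l where "l = (\<eta> * q) powr (1 / q)"
  have l: "l > 0" "l powr q = \<eta> * q" using assms by (auto simp: l_def powr_powr)
  show "0 \<le> 1 / (p * l powr p)" using assms by simp
  fix x y :: real assume xy: "x \<ge> 0" "y \<ge> 0"
  have "x * y = (x / l) * (l * y)" using l by simp
  also have "\<dots> \<le> (x / l) powr p / p + (l * y) powr q / q"
    using l xy assms by (intro Youngs_inequality) auto
  also have "(x / l) powr p / p = 1 / (p * l powr p) * x powr p"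
    using l xy by (simp add: powr_divide)
  also have "(l * y) powr q / q = \<eta> * y powr q"
    using l xy assms by (simp add: powr_mult)
  finally show "x * y \<le> 1 / (p * l powr p) * x powr p + \<eta> * y powr q" .
qed

lemma AE_lborel_negligible:
  assumes "negligible N" "\<And>x. x \<notin> N \<Longrightarrow> P x"
  shows "AE x in lborel. P x"
proof -
  have "N \<in> null_sets lebesgue" using assms(1) by (simp add: negligible_iff_null_sets)
  then have "AE x in lebesgue. P x"
    using assms(2) by (auto intro: AE_I'[of N])
  then show ?thesis by (simp add: AE_completion_iff)
qed

text \<open>A Lebesgue measurable f is the limit, off a negligible set, of continuous functions g n.
  Clamping them to [-M, M] and multiplying by the cutoff \<kappa>, which is 1 up to radius R and 0
  beyond R + 1, creates a common majorant without changing the limit.\<close>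

lemma Lq_dense_bounded:
  fixes f :: "'a::euclidean_space \<Rightarrow> real"
  assumes q: "q > 0" and [measurable]: "f \<in> borel_measurable borel"
    and f0: "\<And>z. R < norm z \<Longrightarrow> f z = 0" and bd: "\<And>z. \<bar>f z\<bar> \<le> M"
    and \<eta>: "\<eta> > 0"
  obtains c where "continuous_on UNIV c" "\<And>z. R + 1 < norm z \<Longrightarrow> c z = 0"
    "(\<integral>\<^sup>+z. ennreal (\<bar>f z - c z\<bar> powr q) \<partial>lborel) < ennreal \<eta>"
proof -
  have "f \<in> borel_measurable lebesgue"
    using assms(2) by (intro measurable_completion) simp
  then have "f measurable_on UNIV"
    by (simp add: measurable_on_iff_borel_measurable lebesgue_on_UNIV_eq)
  then obtain N g where N: "negligible N" and g: "\<And>n. continuous_on UNIV (g n)"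
    and lim: "\<And>x. x \<notin> N \<Longrightarrow> (\<lambda>n. g n x) \<longlonglongrightarrow> f x"
    by (auto simp: measurable_on_def)
  define \<kappa> where "\<kappa> z = max 0 (min 1 (R + 1 - norm z))" for z :: 'a
  define c where "c n z = \<kappa> z * max (- M) (min M (g n z))" for n z
  have M: "M \<ge> 0" using bd[of 0] by linarith
  have cc: "continuous_on UNIV (c n)" for n
    unfolding c_def \<kappa>_def by (intro continuous_intros g)
  have c0: "c n z = 0" if "R + 1 < norm z" for n z
    using that by (simp add: c_def \<kappa>_def)
  have cb: "\<bar>c n z\<bar> \<le> M" for n z
  proof -
    have "\<bar>\<kappa> z\<bar> \<le> 1" by (auto simp: \<kappa>_def)
    moreover have "\<bar>max (- M) (min M (g n z))\<bar> \<le> M" using M by auto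
    ultimately show ?thesis unfolding c_def abs_mult
      using mult_mono[of "\<bar>\<kappa> z\<bar>" 1 _ M] by fastforce
  qed
  have climit: "(\<lambda>n. c n z) \<longlonglongrightarrow> f z" if "z \<notin> N" for z
  proof -
    have "(\<lambda>n. c n z) \<longlonglongrightarrow> \<kappa> z * max (- M) (min M (f z))"
      unfolding c_def by (intro tendsto_intros lim that)
    also have "\<kappa> z * max (- M) (min M (f z)) = f z"
    proof (cases "R < norm z")
      case False
      then have "\<kappa> z = 1" by (simp add: \<kappa>_def)
      then show ?thesis using bd[of z] by (auto simp: max_def min_def)
    next
      case True then show ?thesis using f0[of z] M by (simp add: min_def max_def)
    qed
    finally show ?thesis .
  qed
  have [measurable]: "c n \<in> borel_measurable borel" for n
    using cc by (rule borel_measurable_continuous_onI)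
  let ?B = "cball (0::'a) (R + 1)"
  have m1: "(\<lambda>z. ennreal (\<bar>f z - c n z\<bar> powr q)) \<in> borel_measurable lborel" for n
    by measurable
  have m2: "(\<lambda>z. ennreal ((2 * M) powr q) * indicator ?B z) \<in> borel_measurable lborel"
    by (intro borel_measurable_times_ennreal borel_measurable_const borel_measurable_indicator) simp
  have "(\<lambda>n. \<integral>\<^sup>+z. ennreal (\<bar>f z - c n z\<bar> powr q) \<partial>lborel) \<longlonglongrightarrow> (\<integral>\<^sup>+(z::'a). 0 \<partial>lborel)"
  proof (rule nn_integral_dominated_convergence)
    show "(\<integral>\<^sup>+z. ennreal ((2 * M) powr q) * indicator ?B z \<partial>lborel) < \<infinity>"
      using emeasure_lborel_cball_finite[of "0::'a" "R + 1"]
      by (simp add: nn_integral_cmult_indicator ennreal_mult_less_top)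
    show "AE z in lborel. ennreal (\<bar>f z - c n z\<bar> powr q) \<le> ennreal ((2 * M) powr q) * indicator ?B z" for n
    proof (rule AE_I2)
      fix z
      show "ennreal (\<bar>f z - c n z\<bar> powr q) \<le> ennreal ((2 * M) powr q) * indicator ?B z"
      proof (cases "z \<in> ?B")
        case True
        have "\<bar>f z - c n z\<bar> \<le> 2 * M" using bd[of z] cb[of n z] by linarith
        then show ?thesis using True q by (auto intro!: ennreal_leI powr_mono2)
      next
        case False then show ?thesis using f0[of z] c0[of z n] by auto
      qed
    qed
    show "AE z in lborel. (\<lambda>n. ennreal (\<bar>f z - c n z\<bar> powr q)) \<longlonglongrightarrow> 0"
    proof (rule AE_lborel_negligible[OF N])
      fix z assume "z \<notin> N"
      have "(\<lambda>n. \<bar>f z - c n z\<bar>) \<longlonglongrightarrow> \<bar>f z - f z\<bar>"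
        using \<open>z \<notin> N\<close> by (rule tendsto_rabs[OF tendsto_diff[OF tendsto_const climit]])
      then have "(\<lambda>n. \<bar>f z - c n z\<bar> powr q) \<longlonglongrightarrow> \<bar>f z - f z\<bar> powr q"
        by (rule tendsto_powr') (auto intro: q)
      from tendsto_ennrealI[OF this]
      show "(\<lambda>n. ennreal (\<bar>f z - c n z\<bar> powr q)) \<longlonglongrightarrow> 0" by simp
    qed
  qed (rule m1 m2 borel_measurable_const)+
  from order_tendstoD(2)[OF this, of "ennreal \<eta>"]
  have "\<forall>\<^sub>F n in sequentially. (\<integral>\<^sup>+z. ennreal (\<bar>f z - c n z\<bar> powr q) \<partial>lborel) < ennreal \<eta>"
    using \<eta> by simp
  then obtain n where "(\<integral>\<^sup>+z. ennreal (\<bar>f z - c n z\<bar> powr q) \<partial>lborel) < ennreal \<eta>"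
    by (auto simp: eventually_sequentially)
  then show ?thesis using cc[of n] c0[of _ n] that by blast
qed

text \<open>A quasi-triangle inequality for the q-th power of the norm: the factor
  \<open>2 powr q\<close> replaces the q-th roots of Minkowski's inequality.\<close>

lemma nn_integral_abs_powr_add_le:
  fixes f g :: "'a::euclidean_space \<Rightarrow> real"
  assumes q: "q > 0" and [measurable]: "f \<in> borel_measurable borel" "g \<in> borel_measurable borel"
  shows "(\<integral>\<^sup>+z. ennreal (\<bar>f z + g z\<bar> powr q) \<partial>lborel) \<le> ennreal (2 powr q) *
    ((\<integral>\<^sup>+z. ennreal (\<bar>f z\<bar> powr q) \<partial>lborel) + (\<integral>\<^sup>+z. ennreal (\<bar>g z\<bar> powr q) \<partial>lborel))"
proof -
  have "ennreal (\<bar>f z + g z\<bar> powr q)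
      \<le> ennreal (2 powr q) * (ennreal (\<bar>f z\<bar> powr q) + ennreal (\<bar>g z\<bar> powr q))" for z
    using ennreal_leI[OF powr_abs_add_le[OF q, of "f z" "g z"]] by (simp add: ennreal_mult')
  then have "(\<integral>\<^sup>+z. ennreal (\<bar>f z + g z\<bar> powr q) \<partial>lborel)
      \<le> (\<integral>\<^sup>+z. ennreal (2 powr q) * (ennreal (\<bar>f z\<bar> powr q) + ennreal (\<bar>g z\<bar> powr q)) \<partial>lborel)"
    by (intro nn_integral_mono)
  also have "\<dots> = ennreal (2 powr q) *
    ((\<integral>\<^sup>+z. ennreal (\<bar>f z\<bar> powr q) \<partial>lborel) + (\<integral>\<^sup>+z. ennreal (\<bar>g z\<bar> powr q) \<partial>lborel))"
    by (simp add: nn_integral_cmult nn_integral_add)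
  finally show ?thesis .
qed

text \<open>Truncation at height n reduces to bounded f. The truncation error is dominated by |f|
  itself and vanishes pointwise once n exceeds |f z|.\<close>

lemma Lq_dense:
  fixes f :: "'a::euclidean_space \<Rightarrow> real"
  assumes q: "q > 0" and [measurable]: "f \<in> borel_measurable borel"
    and f0: "\<And>z. R < norm z \<Longrightarrow> f z = 0"
    and fin: "(\<integral>\<^sup>+z. ennreal (\<bar>f z\<bar> powr q) \<partial>lborel) < \<infinity>"
    and \<eta>: "\<eta> > 0"
  obtains c where "continuous_on UNIV c" "\<And>z. R + 1 < norm z \<Longrightarrow> c z = 0"
    "(\<integral>\<^sup>+z. ennreal (\<bar>f z - c z\<bar> powr q) \<partial>lborel) \<le> ennreal \<eta>"
proof -
  define T where "T n z = max (- real n) (min (real n) (f z))" for n z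
  define \<epsilon> where "\<epsilon> = \<eta> / (2 powr q * 2)"
  have \<epsilon>: "\<epsilon> > 0" using \<eta> by (simp add: \<epsilon>_def)
  have [measurable]: "T n \<in> borel_measurable borel" for n
    unfolding T_def by measurable
  have "(\<lambda>n. \<integral>\<^sup>+z. ennreal (\<bar>f z - T n z\<bar> powr q) \<partial>lborel) \<longlonglongrightarrow> (\<integral>\<^sup>+(z::'a). 0 \<partial>lborel)"
  proof (rule nn_integral_dominated_convergence)
    show "(\<integral>\<^sup>+z. ennreal (\<bar>f z\<bar> powr q) \<partial>lborel) < \<infinity>" by (rule fin)
    show "AE z in lborel. ennreal (\<bar>f z - T n z\<bar> powr q) \<le> ennreal (\<bar>f z\<bar> powr q)" for n
      using q by (intro AE_I2 ennreal_leI powr_mono2) (auto simp: T_def)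
    show "AE z in lborel. (\<lambda>n. ennreal (\<bar>f z - T n z\<bar> powr q)) \<longlonglongrightarrow> 0"
    proof (rule AE_I2)
      fix z
      obtain n0 where n0: "\<bar>f z\<bar> \<le> real n0" using real_arch_simple by blast
      have "\<forall>\<^sub>F n in sequentially. 0 = ennreal (\<bar>f z - T n z\<bar> powr q)"
        using eventually_ge_at_top[of n0]
      proof eventually_elim
        case (elim n)
        then have "\<bar>f z\<bar> \<le> real n" using n0 by linarith
        then have "T n z = f z" by (auto simp: T_def min_def max_def abs_le_iff)
        then show ?case using q by simp
      qed
      then show "(\<lambda>n. ennreal (\<bar>f z - T n z\<bar> powr q)) \<longlonglongrightarrow> 0"
        by (rule Lim_transform_eventually[OF tendsto_const])
    qed
  qed measurable
  from order_tendstoD(2)[OF this, of "ennreal \<epsilon>"]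
  have "\<forall>\<^sub>F n in sequentially. (\<integral>\<^sup>+z. ennreal (\<bar>f z - T n z\<bar> powr q) \<partial>lborel) < ennreal \<epsilon>"
    using \<epsilon> by simp
  then obtain n where n: "(\<integral>\<^sup>+z. ennreal (\<bar>f z - T n z\<bar> powr q) \<partial>lborel) < ennreal \<epsilon>"
    by (auto simp: eventually_sequentially)
  have "\<bar>T n z\<bar> \<le> real n" for z by (auto simp: T_def)
  moreover have "T n z = 0" if "R < norm z" for z using f0[OF that] by (simp add: T_def)
  ultimately obtain c where c: "continuous_on UNIV c" "\<And>z. R + 1 < norm z \<Longrightarrow> c z = 0"
    "(\<integral>\<^sup>+z. ennreal (\<bar>T n z - c z\<bar> powr q) \<partial>lborel) < ennreal \<epsilon>"
    using Lq_dense_bounded[OF q, of "T n" R "real n" \<epsilon>] \<epsilon> by auto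
  have [measurable]: "c \<in> borel_measurable borel"
    using c(1) by (rule borel_measurable_continuous_onI)
  have "(\<integral>\<^sup>+z. ennreal (\<bar>f z - c z\<bar> powr q) \<partial>lborel)
     = (\<integral>\<^sup>+z. ennreal (\<bar>(f z - T n z) + (T n z - c z)\<bar> powr q) \<partial>lborel)" by simp
  also have "\<dots> \<le> ennreal (2 powr q) * ((\<integral>\<^sup>+z. ennreal (\<bar>f z - T n z\<bar> powr q) \<partial>lborel)
     + (\<integral>\<^sup>+z. ennreal (\<bar>T n z - c z\<bar> powr q) \<partial>lborel))"
    by (rule nn_integral_abs_powr_add_le[OF q]) auto
  also have "\<dots> \<le> ennreal (2 powr q) * (ennreal \<epsilon> + ennreal \<epsilon>)"
    using n c(3) by (intro mult_left_mono add_mono) auto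
  also have "\<dots> = ennreal (2 powr q * (\<epsilon> + \<epsilon>))"
    using \<epsilon> by (subst ennreal_mult') (auto simp: ennreal_plus[symmetric] simp del: ennreal_plus)
  also have "2 powr q * (\<epsilon> + \<epsilon>) = \<eta>" by (simp add: \<epsilon>_def)
  finally show ?thesis using c that by blast
qed

text \<open>Insert a continuous, compactly supported c close to f. Translation invariance makes f -
  c and its translate equally small, and the shift is felt only by c, which is uniformly
  continuous.\<close>

lemma Lq_translation_continuous:
  fixes f :: "'a::euclidean_space \<Rightarrow> real"
  assumes q: "q > 0" and [measurable]: "f \<in> borel_measurable borel"
    and f0: "\<And>z. R < norm z \<Longrightarrow> f z = 0"
    and fin: "(\<integral>\<^sup>+z. ennreal (\<bar>f z\<bar> powr q) \<partial>lborel) < \<infinity>"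
    and \<eta>: "\<eta> > 0"
  obtains \<delta> where "\<delta> > 0" "\<And>a. norm a < \<delta> \<Longrightarrow>
    (\<integral>\<^sup>+z. ennreal (\<bar>f (z - a) - f z\<bar> powr q) \<partial>lborel) \<le> ennreal \<eta>"
proof -
  define K where "K = 2 powr q"
  have K: "K > 0" by (simp add: K_def)
  \<comment> \<open>Two nested uses of the quasi-triangle inequality turn three errors \<epsilon>
    into K (\<epsilon> + K (\<epsilon> + \<epsilon>)), which this choice makes equal to
    \<eta>.\<close>
  define \<epsilon> where "\<epsilon> = \<eta> / (K * (1 + K * 2))"
  have \<epsilon>: "\<epsilon> > 0" using \<eta> K by (simp add: \<epsilon>_def)
  obtain c where c: "continuous_on UNIV c" "\<And>z. R + 1 < norm z \<Longrightarrow> c z = 0"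
    "(\<integral>\<^sup>+z. ennreal (\<bar>f z - c z\<bar> powr q) \<partial>lborel) \<le> ennreal \<epsilon>"
    using Lq_dense[OF q assms(2) f0 fin \<epsilon>] by blast
  have [measurable]: "c \<in> borel_measurable borel"
    using c(1) by (rule borel_measurable_continuous_onI)
  let ?B = "cball (0::'a) (R + 2)"
  define V where "V = measure lborel ?B"
  have V: "emeasure lborel ?B = ennreal V"
    unfolding V_def using emeasure_lborel_cball_finite[of "0::'a" "R + 2"]
    by (intro emeasure_eq_ennreal_measure) auto
  have "V \<ge> 0" by (simp add: V_def)
  \<comment> \<open>A uniform error \<omega> on a ball of volume V costs
    \<open>\<omega> powr q * V\<close>; V + 1 avoids a division by zero.\<close>
  define \<omega> where "\<omega> = (\<epsilon> / (V + 1)) powr (1 / q)"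
  have \<omega>: "\<omega> > 0" "\<omega> powr q * V \<le> \<epsilon>"
    using \<epsilon> q \<open>V \<ge> 0\<close> by (auto simp: \<omega>_def powr_powr field_simps add_pos_nonneg)
  have "uniformly_continuous_on (cball 0 (R + 3)) c"
    by (intro compact_uniformly_continuous continuous_on_subset[OF c(1)]) auto
  then obtain d where d: "d > 0"
    "\<And>x y. x \<in> cball 0 (R + 3) \<Longrightarrow> y \<in> cball 0 (R + 3) \<Longrightarrow> dist y x < d \<Longrightarrow> dist (c y) (c x) < \<omega>"
    using \<omega>(1) unfolding uniformly_continuous_on_def by metis
  show ?thesis
  proof
    show "min d 1 > 0" using d by simp
    fix a :: 'a assume a: "norm a < min d 1"
    have sym: "dist (z - a) z = norm a" for z by (simp add: dist_norm)
    have pt: "\<bar>c (z - a) - c z\<bar> powr q \<le> \<omega> powr q * indicator ?B z" for z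
    proof (cases "z \<in> ?B")
      case True
      have "norm (z - a) \<le> R + 3"
        using norm_triangle_ineq4[of z a] True a by auto
      then have "dist (c (z - a)) (c z) < \<omega>"
        using d(2)[of z "z - a"] True a sym[of z] by simp
      then show ?thesis using True q by (auto simp: dist_real_def intro!: powr_mono2)
    next
      case False
      then have "norm z > R + 2" by simp
      moreover from this have "norm (z - a) > R + 1"
        using norm_triangle_ineq2[of z a] a by linarith
      ultimately show ?thesis using c(2) False by simp
    qed
    have "(\<integral>\<^sup>+z. ennreal (\<bar>c (z - a) - c z\<bar> powr q) \<partial>lborel)
       \<le> (\<integral>\<^sup>+z. ennreal (\<omega> powr q) * indicator ?B z \<partial>lborel)"
      by (intro nn_integral_mono order_trans[OF ennreal_leI[OF pt]])
         (auto simp: indicator_def)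
    also have "\<dots> = ennreal (\<omega> powr q * V)"
      by (simp add: nn_integral_cmult_indicator V ennreal_mult' \<open>V \<ge> 0\<close>)
    also have "\<dots> \<le> ennreal \<epsilon>" using \<omega> by (intro ennreal_leI)
    finally have 1: "(\<integral>\<^sup>+z. ennreal (\<bar>c (z - a) - c z\<bar> powr q) \<partial>lborel) \<le> ennreal \<epsilon>" .
    have 2: "(\<integral>\<^sup>+z. ennreal (\<bar>f (z - a) - c (z - a)\<bar> powr q) \<partial>lborel) \<le> ennreal \<epsilon>"
      using c(3) nn_integral_lborel_translate[of "\<lambda>z. ennreal (\<bar>f z - c z\<bar> powr q)" a] by simp
    have 3: "(\<integral>\<^sup>+z. ennreal (\<bar>c z - f z\<bar> powr q) \<partial>lborel) \<le> ennreal \<epsilon>"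
      using c(3) by (simp add: abs_minus_commute)
    have "(\<integral>\<^sup>+z. ennreal (\<bar>f (z - a) - f z\<bar> powr q) \<partial>lborel)
      = (\<integral>\<^sup>+z. ennreal (\<bar>(f (z - a) - c (z - a)) + ((c (z - a) - c z) + (c z - f z))\<bar> powr q) \<partial>lborel)"
      by simp
    also have "\<dots> \<le> ennreal K * (ennreal \<epsilon> + (ennreal K * (ennreal \<epsilon> + ennreal \<epsilon>)))"
      unfolding K_def
      by (rule order_trans[OF nn_integral_abs_powr_add_le[OF q]];
          (intro mult_left_mono add_mono 2 order_trans[OF nn_integral_abs_powr_add_le[OF q]] 1 3)?) auto
    also have "\<dots> = ennreal (K * (\<epsilon> + K * (\<epsilon> + \<epsilon>)))"
    proof -
      have "ennreal \<epsilon> + ennreal \<epsilon> = ennreal (\<epsilon> + \<epsilon>)"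
        using \<epsilon> by (intro ennreal_plus[symmetric]) auto
      moreover have "ennreal K * ennreal (\<epsilon> + \<epsilon>) = ennreal (K * (\<epsilon> + \<epsilon>))"
        using K by (intro ennreal_mult'[symmetric]) auto
      moreover have "ennreal \<epsilon> + ennreal (K * (\<epsilon> + \<epsilon>)) = ennreal (\<epsilon> + K * (\<epsilon> + \<epsilon>))"
        using \<epsilon> K by (intro ennreal_plus[symmetric]) auto
      moreover have "ennreal K * ennreal (\<epsilon> + K * (\<epsilon> + \<epsilon>)) = ennreal (K * (\<epsilon> + K * (\<epsilon> + \<epsilon>)))"
        using K by (intro ennreal_mult'[symmetric]) auto
      ultimately show ?thesis by metis
    qed
    also have "K * (\<epsilon> + K * (\<epsilon> + \<epsilon>)) = \<eta>"
    proof -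
      have "K * (\<epsilon> + K * (\<epsilon> + \<epsilon>)) = \<epsilon> * (K * (1 + K * 2))" by (simp add: algebra_simps)
      also have "\<dots> = \<eta>"
      proof -
        have "K * (1 + K * 2) > 0" using K by simp
        then show ?thesis unfolding \<epsilon>_def by (metis divide_eq_eq less_irrefl)
      qed
      finally show ?thesis .
    qed
    finally show "(\<integral>\<^sup>+z. ennreal (\<bar>f (z - a) - f z\<bar> powr q) \<partial>lborel) \<le> ennreal \<eta>" .
  qed
qed

section \<open>Mollification of products\<close>

definition mollifier :: "real \<Rightarrow> ('a::euclidean_space \<Rightarrow> real) \<Rightarrow> bool" where
  "mollifier \<delta> k \<longleftrightarrow> (\<forall>j. Ck_smooth j k) \<and> (\<forall>z. 0 \<le> k z) \<and>
     (\<forall>z. \<delta> \<le> norm z \<longrightarrow> k z = 0) \<and> (LINT z|lborel. k z) = 1"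

lemma mollifier_continuous_on: "mollifier \<delta> k \<Longrightarrow> continuous_on UNIV k"
  using Ck_smooth.simps(1) unfolding mollifier_def by blast

lemma mollifier_zero: "mollifier \<delta> k \<Longrightarrow> z \<notin> cball 0 \<delta> \<Longrightarrow> k z = 0"
  unfolding mollifier_def by simp

lemma bounded_continuous_compact_support:
  fixes F :: "'a::euclidean_space \<Rightarrow> real"
  assumes "continuous_on UNIV F" "compact S" "\<And>z. z \<notin> S \<Longrightarrow> F z = 0"
  obtains C where "\<And>z. \<bar>F z\<bar> \<le> C"
proof -
  have "bounded (F ` S)"
    by (intro compact_imp_bounded compact_continuous_image assms continuous_on_subset[OF assms(1)]) auto
  then obtain C where C: "\<And>z. z \<in> S \<Longrightarrow> \<bar>F z\<bar> \<le> C"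
    by (auto simp: bounded_iff)
  have "\<bar>F z\<bar> \<le> max C 0" for z
    using C[of z] assms(3)[of z] by (cases "z \<in> S") auto
  then show ?thesis using that by blast
qed

lemma mollifier_integrable: "mollifier \<delta> k \<Longrightarrow> integrable lborel k"
  by (rule integrable_continuous_compact_support[OF mollifier_continuous_on compact_cball[of 0 \<delta>]])
     (auto dest: mollifier_zero)

lemma mollifier_bounded:
  assumes "mollifier \<delta> k" obtains C where "\<And>z. \<bar>k z\<bar> \<le> C"
  using bounded_continuous_compact_support[OF mollifier_continuous_on[OF assms] compact_cball[of 0 \<delta>]]
    mollifier_zero[OF assms] by blast

lemma mollifier_nn_integral:
  assumes "mollifier \<delta> k"
  shows "(\<integral>\<^sup>+z. ennreal (k z) \<partial>lborel) = 1"
  using nn_integral_eq_integral[OF mollifier_integrable[OF assms]] assms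
  by (simp add: mollifier_def)

lemma mollifier_exists:
  assumes "\<delta> > 0"
  obtains k :: "'a::euclidean_space \<Rightarrow> real" where "mollifier \<delta> k"
proof -
  define b where "b z = bump (z /\<^sub>R \<delta>)" for z :: 'a
  have smooth: "Ck_smooth j b" for j
    using Ck_smooth_compose_affine[OF bounded_linear_scaleR_right[of "inverse \<delta>"] Ck_smooth_bump, of j 0]
    by (simp add: b_def[abs_def])
  have cont: "continuous_on UNIV b" using smooth[of 0] by simp
  have pos: "b z > 0 \<longleftrightarrow> norm z < \<delta>" for z
    using assms by (simp add: b_def bump_pos_iff field_simps)
  have nonneg: "b z \<ge> 0" for z by (simp add: b_def bump_nonneg)
  have zero: "b z = 0" if "\<delta> \<le> norm z" for z
    using pos[of z] nonneg[of z] that by linarith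
  have int: "integrable lborel b"
    by (rule integrable_continuous_compact_support[OF cont compact_cball[of 0 \<delta>]]) (auto simp: zero)
  have "(LINT z|lborel. b z) \<noteq> 0"
  proof
    assume "(LINT z|lborel. b z) = 0"
    then have "AE z in lborel. b z = 0"
      using integral_nonneg_eq_0_iff_AE[OF int] nonneg by simp
    then have "AE z in lborel. z \<notin> ball (0::'a) \<delta>"
      by eventually_elim (use pos in force)
    then have "emeasure lborel (ball (0::'a) \<delta>) = 0"
      by (subst (asm) AE_iff_measurable[OF _ refl]) (auto simp: ball_def)
    moreover have "emeasure lborel (ball (0::'a) \<delta>) \<noteq> 0"
      using open_not_negligible[of "ball (0::'a) \<delta>"] assms
      by (metis centre_in_ball empty_iff negligible_iff_null_sets null_setsI null_sets_completionI
          open_ball borel_open sets_lborel)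
    ultimately show False by simp
  qed
  moreover have "(LINT z|lborel. b z) \<ge> 0" using nonneg by simp
  ultimately have I: "(LINT z|lborel. b z) > 0" by linarith
  have "mollifier \<delta> (\<lambda>z. (1 / (LINT z|lborel. b z)) * b z)"
    unfolding mollifier_def
    using I nonneg zero Ck_smooth_mult[OF Ck_smooth_const smooth, of _ "1 / (LINT z|lborel. b z)"]
    by auto
  then show ?thesis using that by blast
qed

text \<open>Since k is a probability density, the product of two averages is a double average of
  x(a) y(b). Young's inequality applies under the double integral, and in each of its two terms the
  other variable integrates to 1; this replaces Hoelder and Jensen.\<close>

lemma mollifier_product_Young:
  fixes k x y :: "'a::euclidean_space \<Rightarrow> real"
  assumes k: "mollifier \<delta> k"
    and [measurable]: "x \<in> borel_measurable borel" "y \<in> borel_measurable borel"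
    and nonneg: "\<And>a. x a \<ge> 0" "\<And>a. y a \<ge> 0" and C: "C \<ge> 0" "\<eta> \<ge> 0"
    and Young: "\<And>x y. x \<ge> 0 \<Longrightarrow> y \<ge> 0 \<Longrightarrow> x * y \<le> C * x powr p + \<eta> * y powr q"
  shows "(\<integral>\<^sup>+a. ennreal (k a * x a) \<partial>lborel) * (\<integral>\<^sup>+b. ennreal (k b * y b) \<partial>lborel)
    \<le> (\<integral>\<^sup>+a. ennreal (k a * (C * x a powr p)) \<partial>lborel)
     + (\<integral>\<^sup>+b. ennreal (k b * (\<eta> * y b powr q)) \<partial>lborel)"
proof -
  have [measurable]: "k \<in> borel_measurable borel"
    using mollifier_continuous_on[OF k] by (rule borel_measurable_continuous_onI)
  have k0: "k a \<ge> 0" for a using k by (simp add: mollifier_def)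
  define Y where "Y = (\<integral>\<^sup>+b. ennreal (k b * (\<eta> * y b powr q)) \<partial>lborel)"
  have "(\<integral>\<^sup>+a. ennreal (k a * x a) \<partial>lborel) * (\<integral>\<^sup>+b. ennreal (k b * y b) \<partial>lborel)
    = (\<integral>\<^sup>+a. \<integral>\<^sup>+b. ennreal (k a * x a) * ennreal (k b * y b) \<partial>lborel \<partial>lborel)"
    by (simp add: nn_integral_cmult nn_integral_multc)
  also have "\<dots> \<le> (\<integral>\<^sup>+a. \<integral>\<^sup>+b. ennreal (k a * (C * x a powr p)) * ennreal (k b)
       + ennreal (k a) * ennreal (k b * (\<eta> * y b powr q)) \<partial>lborel \<partial>lborel)"
  proof (intro nn_integral_mono)
    fix a b
    have "k a * x a * (k b * y b) = k a * k b * (x a * y b)" by simp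
    also have "\<dots> \<le> k a * k b * (C * x a powr p + \<eta> * y b powr q)"
      using Young nonneg k0 by (intro mult_left_mono) auto
    also have "\<dots> = k a * (C * x a powr p) * k b + k a * (k b * (\<eta> * y b powr q))"
      by (simp add: algebra_simps)
    finally have "ennreal (k a * x a * (k b * y b))
        \<le> ennreal (k a * (C * x a powr p) * k b + k a * (k b * (\<eta> * y b powr q)))"
      by (rule ennreal_leI)
    then show "ennreal (k a * x a) * ennreal (k b * y b) \<le> ennreal (k a * (C * x a powr p)) * ennreal (k b)
       + ennreal (k a) * ennreal (k b * (\<eta> * y b powr q))"
      using k0 nonneg C by (simp add: ennreal_mult ennreal_plus)
  qed
  also have "\<dots> = (\<integral>\<^sup>+a. ennreal (k a * (C * x a powr p)) + ennreal (k a) * Y \<partial>lborel)"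
    unfolding Y_def by (simp add: nn_integral_add nn_integral_cmult mollifier_nn_integral[OF k])
  also have "\<dots> = (\<integral>\<^sup>+a. ennreal (k a * (C * x a powr p)) \<partial>lborel) + Y"
    by (simp add: nn_integral_add nn_integral_multc mollifier_nn_integral[OF k])
  finally show ?thesis unfolding Y_def .
qed

text \<open>After Fubini the bound \<open>c\<close> holds for every shift a in the support of k, and
  k has mass 1.\<close>

lemma nn_integral_mollifier_average_le:
  fixes G :: "'a::euclidean_space \<Rightarrow> 'a \<Rightarrow> real"
  assumes k: "mollifier \<delta> k"
    and G[measurable]: "(\<lambda>(z, a). G z a) \<in> borel_measurable (borel \<Otimes>\<^sub>M borel)"
    and G0: "\<And>z a. G z a \<ge> 0"
    and le: "\<And>a. norm a < \<delta> \<Longrightarrow> (\<integral>\<^sup>+z. ennreal (G z a) \<partial>lborel) \<le> c"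
  shows "(\<integral>\<^sup>+z. \<integral>\<^sup>+a. ennreal (k a * G z a) \<partial>lborel \<partial>lborel) \<le> c"
proof -
  have [measurable]: "k \<in> borel_measurable borel"
    using mollifier_continuous_on[OF k] by (rule borel_measurable_continuous_onI)
  have k0: "k a \<ge> 0" for a using k by (simp add: mollifier_def)
  have "(\<integral>\<^sup>+z. \<integral>\<^sup>+a. ennreal (k a * G z a) \<partial>lborel \<partial>lborel)
      = (\<integral>\<^sup>+a. \<integral>\<^sup>+z. ennreal (k a * G z a) \<partial>lborel \<partial>lborel)"
    by (rule lborel_pair.Fubini'[symmetric]) simp
  also have "\<dots> = (\<integral>\<^sup>+a. ennreal (k a) * (\<integral>\<^sup>+z. ennreal (G z a) \<partial>lborel) \<partial>lborel)"
    by (simp add: ennreal_mult k0 G0 nn_integral_cmult)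
  also have "\<dots> \<le> (\<integral>\<^sup>+a. ennreal (k a) * c \<partial>lborel)"
  proof (intro nn_integral_mono)
    fix a
    show "ennreal (k a) * (\<integral>\<^sup>+z. ennreal (G z a) \<partial>lborel) \<le> ennreal (k a) * c"
    proof (cases "norm a < \<delta>")
      case True then show ?thesis by (intro mult_left_mono le) auto
    next
      case False then have "k a = 0" using k by (simp add: mollifier_def)
      then show ?thesis by simp
    qed
  qed
  also have "\<dots> = c" by (simp add: nn_integral_multc mollifier_nn_integral[OF k])
  finally show ?thesis .
qed

lemma mollifier_average_close:
  fixes f :: "'a::euclidean_space \<Rightarrow> real"
  assumes k: "mollifier \<delta> k" and f: "integrable lborel f"
  shows "ennreal \<bar>conv k f z\<bar> \<le> (\<integral>\<^sup>+a. ennreal (k a * \<bar>f (z - a)\<bar>) \<partial>lborel)"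
    and "ennreal \<bar>conv k f z - f z\<bar> \<le> (\<integral>\<^sup>+a. ennreal (k a * \<bar>f (z - a) - f z\<bar>) \<partial>lborel)"
proof -
  note ck = mollifier_continuous_on[OF k] and ik = mollifier_integrable[OF k]
  obtain C where C: "\<And>z. \<bar>k z\<bar> \<le> C" using mollifier_bounded[OF k] by blast
  have k0: "k a \<ge> 0" for a using k by (simp add: mollifier_def)
  have "integrable lborel (\<lambda>\<zeta>. k (z - \<zeta>) * f \<zeta>)" by (rule integrable_conv[OF ck C f])
  from integrable_lborel_reflect[OF this, of z]
  have i: "integrable lborel (\<lambda>a. k a * f (z - a))" by simp
  show "ennreal \<bar>conv k f z\<bar> \<le> (\<integral>\<^sup>+a. ennreal (k a * \<bar>f (z - a)\<bar>) \<partial>lborel)"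
    using integral_norm_bound_ennreal[OF i] by (simp add: conv_reflect[OF ck f] abs_mult k0)
  have i2: "integrable lborel (\<lambda>a. k a * f (z - a) - k a * f z)" using i ik by simp
  have "conv k f z - f z = (LINT a|lborel. k a * f (z - a) - k a * f z)"
    using k i ik by (simp add: conv_reflect[OF ck f] mollifier_def)
  moreover have "\<bar>k a * f (z - a) - k a * f z\<bar> = k a * \<bar>f (z - a) - f z\<bar>" for a
    using k0[of a] by (simp add: abs_mult flip: right_diff_distrib)
  ultimately show "ennreal \<bar>conv k f z - f z\<bar> \<le> (\<integral>\<^sup>+a. ennreal (k a * \<bar>f (z - a) - f z\<bar>) \<partial>lborel)"
    using integral_norm_bound_ennreal[OF i2] by simp
qed

text \<open>Pointwise |f| is at most the indicator of the ball plus |f|^q, according to whether |f|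
  is at most 1 or larger.\<close>

lemma integrable_of_Lq_bounded_support:
  fixes f :: "'a::euclidean_space \<Rightarrow> real"
  assumes q: "q \<ge> 1" and [measurable]: "f \<in> borel_measurable borel"
    and f0: "\<And>z. R < norm z \<Longrightarrow> f z = 0"
    and fin: "(\<integral>\<^sup>+z. ennreal (\<bar>f z\<bar> powr q) \<partial>lborel) < \<infinity>"
  shows "integrable lborel f"
proof (rule integrableI_bounded)
  let ?B = "cball (0::'a) R"
  have m: "(indicator ?B :: 'a \<Rightarrow> ennreal) \<in> borel_measurable lborel"
    by (intro borel_measurable_indicator) simp
  have "ennreal (norm (f z)) \<le> indicator ?B z + ennreal (\<bar>f z\<bar> powr q)" for z
  proof (cases "\<bar>f z\<bar> \<le> 1")
    case True
    show ?thesis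
    proof (cases "z \<in> ?B")
      case True
      with \<open>\<bar>f z\<bar> \<le> 1\<close> have "ennreal (norm (f z)) \<le> 1" by simp
      also have "1 \<le> indicator ?B z + ennreal (\<bar>f z\<bar> powr q)" using True by simp
      finally show ?thesis .
    qed (use f0[of z] in auto)
  next
    case False
    then have "\<bar>f z\<bar> powr 1 \<le> \<bar>f z\<bar> powr q" using q by (intro powr_mono) auto
    then have "ennreal (norm (f z)) \<le> ennreal (\<bar>f z\<bar> powr q)" using False by (intro ennreal_leI) simp
    then show ?thesis by (simp add: add_increasing)
  qed
  then have "(\<integral>\<^sup>+z. ennreal (norm (f z)) \<partial>lborel)
      \<le> (\<integral>\<^sup>+z. indicator ?B z + ennreal (\<bar>f z\<bar> powr q) \<partial>lborel)"
    by (rule nn_integral_mono)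
  also have "\<dots> = emeasure lborel ?B + (\<integral>\<^sup>+z. ennreal (\<bar>f z\<bar> powr q) \<partial>lborel)"
    by (subst nn_integral_add) (use m in auto)
  also have "\<dots> < \<infinity>" using fin emeasure_lborel_cball_finite[of "0::'a" R] by simp
  finally show "(\<integral>\<^sup>+z. ennreal (norm (f z)) \<partial>lborel) < \<infinity>" .
qed simp

text \<open>Write the difference as (B_k - B) d_k + (d_k - d) B. In each product Young's inequality
  puts the small weight \<open>e\<close> on the factor that is merely bounded in norm, and a large
  constant on the difference, which translation continuity makes small. The four resulting terms
  contribute at most \<eta> / 4 each.\<close>

lemma mollified_product_L1:
  fixes B d :: "'a::euclidean_space \<Rightarrow> real"
  assumes pq: "p > 1" "q > 1" "1 / p + 1 / q = 1"
    and [measurable]: "B \<in> borel_measurable borel" "d \<in> borel_measurable borel"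
    and zero: "\<And>z. R < norm z \<Longrightarrow> B z = 0" "\<And>z. R < norm z \<Longrightarrow> d z = 0"
    and fin: "(\<integral>\<^sup>+z. ennreal (\<bar>B z\<bar> powr p) \<partial>lborel) < \<infinity>"
      "(\<integral>\<^sup>+z. ennreal (\<bar>d z\<bar> powr q) \<partial>lborel) < \<infinity>"
    and \<eta>: "\<eta> > 0"
  obtains \<delta>0 where "\<delta>0 > 0" "\<And>\<delta> k. mollifier \<delta> k \<Longrightarrow> \<delta> \<le> \<delta>0 \<Longrightarrow>
    (\<integral>\<^sup>+z. ennreal \<bar>conv k B z * conv k d z - B z * d z\<bar> \<partial>lborel) \<le> ennreal \<eta>"
proof -
  have iB: "integrable lborel B" and id: "integrable lborel d"
    using integrable_of_Lq_bounded_support[of p B R] integrable_of_Lq_bounded_support[of q d R]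
      pq zero fin by auto
  define NB where "NB = enn2real (\<integral>\<^sup>+z. ennreal (\<bar>B z\<bar> powr p) \<partial>lborel)"
  define Nd where "Nd = enn2real (\<integral>\<^sup>+z. ennreal (\<bar>d z\<bar> powr q) \<partial>lborel)"
  have NB: "(\<integral>\<^sup>+z. ennreal (\<bar>B z\<bar> powr p) \<partial>lborel) = ennreal NB" "NB \<ge> 0"
    and Nd: "(\<integral>\<^sup>+z. ennreal (\<bar>d z\<bar> powr q) \<partial>lborel) = ennreal Nd" "Nd \<ge> 0"
    using fin by (auto simp: NB_def Nd_def)
  define e where "e = \<eta> / (4 * (NB + Nd + 1))"
  have e: "e > 0" "e * NB \<le> \<eta> / 4" "e * Nd \<le> \<eta> / 4"
    using NB(2) Nd(2) \<eta> by (auto simp: e_def field_simps mult_nonneg_nonneg add_pos_nonneg)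
  obtain C where C: "C \<ge> 0" "\<And>x y. x \<ge> 0 \<Longrightarrow> y \<ge> 0 \<Longrightarrow> x * y \<le> C * x powr p + e * y powr q"
    using Youngs_inequality_scaled[OF pq e(1)] by blast
  obtain C' where C': "C' \<ge> 0" "\<And>x y. x \<ge> 0 \<Longrightarrow> y \<ge> 0 \<Longrightarrow> x * y \<le> C' * x powr q + e * y powr p"
    using Youngs_inequality_scaled[OF pq(2,1) _ e(1)] pq(3) by (auto simp: add.commute)
  obtain d1 where d1: "d1 > 0" "\<And>a. norm a < d1 \<Longrightarrow>
     (\<integral>\<^sup>+z. ennreal (\<bar>B (z - a) - B z\<bar> powr p) \<partial>lborel) \<le> ennreal (\<eta> / (4 * (C + 1)))"
    using Lq_translation_continuous[of p B R "\<eta> / (4 * (C + 1))"] pq zero fin C(1) \<eta> by auto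
  obtain d2 where d2: "d2 > 0" "\<And>a. norm a < d2 \<Longrightarrow>
     (\<integral>\<^sup>+z. ennreal (\<bar>d (z - a) - d z\<bar> powr q) \<partial>lborel) \<le> ennreal (\<eta> / (4 * (C' + 1)))"
    using Lq_translation_continuous[of q d R "\<eta> / (4 * (C' + 1))"] pq zero fin C'(1) \<eta> by auto
  show ?thesis
  proof
    show "min d1 d2 > 0" using d1 d2 by simp
    fix \<delta> and k :: "'a \<Rightarrow> real" assume k: "mollifier \<delta> k" and \<delta>: "\<delta> \<le> min d1 d2"
    have [measurable]: "k \<in> borel_measurable borel"
      using mollifier_continuous_on[OF k] by (rule borel_measurable_continuous_onI)
    have k0: "k a \<ge> 0" for a using k by (simp add: mollifier_def)
    define T1 where "T1 z = (\<integral>\<^sup>+a. ennreal (k a * (C * \<bar>B (z - a) - B z\<bar> powr p)) \<partial>lborel)" for z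
    define T2 where "T2 z = (\<integral>\<^sup>+a. ennreal (k a * (e * \<bar>d (z - a)\<bar> powr q)) \<partial>lborel)" for z
    define T3 where "T3 z = (\<integral>\<^sup>+a. ennreal (k a * (C' * \<bar>d (z - a) - d z\<bar> powr q)) \<partial>lborel)" for z
    \<comment> \<open>\<open>B z\<close> is constant in the averaging variable; writing it as an
      average lets the same product inequality treat the second product.\<close>
    define T4 where "T4 z = (\<integral>\<^sup>+a. ennreal (k a * (e * \<bar>B z\<bar> powr p)) \<partial>lborel)" for z
    have pt: "ennreal \<bar>conv k B z * conv k d z - B z * d z\<bar> \<le> (T1 z + T2 z) + (T3 z + T4 z)" for z
    proof -
      have "\<bar>conv k B z * conv k d z - B z * d z\<bar>
          = \<bar>(conv k B z - B z) * conv k d z + (conv k d z - d z) * B z\<bar>"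
        by (simp add: algebra_simps)
      also have "\<dots> \<le> \<bar>conv k B z - B z\<bar> * \<bar>conv k d z\<bar> + \<bar>conv k d z - d z\<bar> * \<bar>B z\<bar>"
        by (metis abs_mult abs_triangle_ineq)
      finally have "ennreal \<bar>conv k B z * conv k d z - B z * d z\<bar>
         \<le> ennreal (\<bar>conv k B z - B z\<bar> * \<bar>conv k d z\<bar> + \<bar>conv k d z - d z\<bar> * \<bar>B z\<bar>)"
        by (rule ennreal_leI)
      also have "\<dots> = ennreal \<bar>conv k B z - B z\<bar> * ennreal \<bar>conv k d z\<bar>
          + ennreal \<bar>conv k d z - d z\<bar> * ennreal \<bar>B z\<bar>"
        by (simp add: ennreal_mult ennreal_plus)
      also have "\<dots> \<le> (\<integral>\<^sup>+a. ennreal (k a * \<bar>B (z - a) - B z\<bar>) \<partial>lborel) *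
           (\<integral>\<^sup>+a. ennreal (k a * \<bar>d (z - a)\<bar>) \<partial>lborel)
         + (\<integral>\<^sup>+a. ennreal (k a * \<bar>d (z - a) - d z\<bar>) \<partial>lborel) *
           (\<integral>\<^sup>+a. ennreal (k a * \<bar>B z\<bar>) \<partial>lborel)"
        using mollifier_average_close[OF k iB] mollifier_average_close[OF k id]
        by (intro add_mono mult_mono)
           (auto simp: ennreal_mult k0 nn_integral_multc mollifier_nn_integral[OF k])
      also have "\<dots> \<le> (T1 z + T2 z) + (T3 z + T4 z)"
        unfolding T1_def T2_def T3_def T4_def
        by (intro add_mono mollifier_product_Young[OF k]) (use C C' e in auto)
      finally show ?thesis .
    qed
    have m [measurable]: "T1 \<in> borel_measurable lborel" "T2 \<in> borel_measurable lborel"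
       "T3 \<in> borel_measurable lborel" "T4 \<in> borel_measurable lborel"
      unfolding T1_def T2_def T3_def T4_def by measurable
    have i1: "(\<integral>\<^sup>+z. T1 z \<partial>lborel) \<le> ennreal (\<eta> / 4)"
      unfolding T1_def
    proof (rule nn_integral_mollifier_average_le[OF k])
      fix a assume "norm (a :: 'a) < \<delta>"
      then have "(\<integral>\<^sup>+z. ennreal (C * \<bar>B (z - a) - B z\<bar> powr p) \<partial>lborel)
         \<le> ennreal C * ennreal (\<eta> / (4 * (C + 1)))"
        using d1(2)[of a] \<delta> by (simp add: ennreal_mult' C(1) nn_integral_cmult mult_left_mono)
      also have "\<dots> = ennreal (C * (\<eta> / (4 * (C + 1))))" by (rule ennreal_mult'[symmetric]) (rule C(1))
      also have "C * (\<eta> / (4 * (C + 1))) \<le> \<eta> / 4" using C(1) \<eta> by (simp add: field_simps)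
      finally show "(\<integral>\<^sup>+z. ennreal (C * \<bar>B (z - a) - B z\<bar> powr p) \<partial>lborel) \<le> ennreal (\<eta> / 4)"
        by (simp add: ennreal_leI)
    qed (use C(1) in auto)
    have i3: "(\<integral>\<^sup>+z. T3 z \<partial>lborel) \<le> ennreal (\<eta> / 4)"
      unfolding T3_def
    proof (rule nn_integral_mollifier_average_le[OF k])
      fix a assume "norm (a :: 'a) < \<delta>"
      then have "(\<integral>\<^sup>+z. ennreal (C' * \<bar>d (z - a) - d z\<bar> powr q) \<partial>lborel)
         \<le> ennreal C' * ennreal (\<eta> / (4 * (C' + 1)))"
        using d2(2)[of a] \<delta> by (simp add: ennreal_mult' C'(1) nn_integral_cmult mult_left_mono)
      also have "\<dots> = ennreal (C' * (\<eta> / (4 * (C' + 1))))" by (rule ennreal_mult'[symmetric]) (rule C'(1))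
      also have "C' * (\<eta> / (4 * (C' + 1))) \<le> \<eta> / 4" using C'(1) \<eta> by (simp add: field_simps)
      finally show "(\<integral>\<^sup>+z. ennreal (C' * \<bar>d (z - a) - d z\<bar> powr q) \<partial>lborel) \<le> ennreal (\<eta> / 4)"
        by (simp add: ennreal_leI)
    qed (use C'(1) in auto)
    have i2: "(\<integral>\<^sup>+z. T2 z \<partial>lborel) \<le> ennreal (\<eta> / 4)"
      unfolding T2_def
    proof (rule nn_integral_mollifier_average_le[OF k])
      fix a assume "norm (a :: 'a) < \<delta>"
      have "(\<integral>\<^sup>+z. ennreal (e * \<bar>d (z - a)\<bar> powr q) \<partial>lborel) = ennreal e * ennreal Nd"
        using nn_integral_lborel_translate[of "\<lambda>z. ennreal (\<bar>d z\<bar> powr q)" a] e Nd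
        by (simp add: ennreal_mult' nn_integral_cmult)
      also have "\<dots> = ennreal (e * Nd)" using e by (simp add: ennreal_mult')
      also have "\<dots> \<le> ennreal (\<eta> / 4)" using e by (intro ennreal_leI)
      finally show "(\<integral>\<^sup>+z. ennreal (e * \<bar>d (z - a)\<bar> powr q) \<partial>lborel) \<le> ennreal (\<eta> / 4)" .
    qed (use e in auto)
    have i4: "(\<integral>\<^sup>+z. T4 z \<partial>lborel) \<le> ennreal (\<eta> / 4)"
      unfolding T4_def
    proof (rule nn_integral_mollifier_average_le[OF k])
      fix a assume "norm (a :: 'a) < \<delta>"
      have "(\<integral>\<^sup>+z. ennreal (e * \<bar>B z\<bar> powr p) \<partial>lborel) = ennreal e * ennreal NB"
        using e NB by (simp add: ennreal_mult' nn_integral_cmult)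
      also have "\<dots> = ennreal (e * NB)" using e by (simp add: ennreal_mult')
      also have "\<dots> \<le> ennreal (\<eta> / 4)" using e by (intro ennreal_leI)
      finally show "(\<integral>\<^sup>+z. ennreal (e * \<bar>B z\<bar> powr p) \<partial>lborel) \<le> ennreal (\<eta> / 4)" .
    qed (use e in auto)
    have "(\<integral>\<^sup>+z. ennreal \<bar>conv k B z * conv k d z - B z * d z\<bar> \<partial>lborel)
       \<le> (\<integral>\<^sup>+z. (T1 z + T2 z) + (T3 z + T4 z) \<partial>lborel)"
      by (rule nn_integral_mono) (rule pt)
    also have "\<dots> = ((\<integral>\<^sup>+z. T1 z \<partial>lborel) + (\<integral>\<^sup>+z. T2 z \<partial>lborel))
         + ((\<integral>\<^sup>+z. T3 z \<partial>lborel) + (\<integral>\<^sup>+z. T4 z \<partial>lborel))"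
      by (simp add: nn_integral_add)
    also have "\<dots> \<le> (ennreal (\<eta> / 4) + ennreal (\<eta> / 4)) + (ennreal (\<eta> / 4) + ennreal (\<eta> / 4))"
      by (intro add_mono i1 i2 i3 i4)
    also have "\<dots> = ennreal \<eta>"
      using \<eta> by (simp add: ennreal_plus[symmetric] del: ennreal_plus)
    finally show "(\<integral>\<^sup>+z. ennreal \<bar>conv k B z * conv k d z - B z * d z\<bar> \<partial>lborel) \<le> ennreal \<eta>" .
  qed
qed

section \<open>Weak solutions on cylinders\<close>

lemma test_function_has_derivative:
  "test_function V \<phi> \<Longrightarrow> (\<phi> has_derivative frechet_derivative \<phi> (at z)) (at z)"
  by (rule Ck_smooth_Suc_has_derivative[of 0]) (simp add: test_function_def del: Ck_smooth.simps)

lemma test_function_continuous_on: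
  assumes "test_function V \<phi>"
  shows "continuous_on UNIV \<phi>" "continuous_on UNIV (\<lambda>z. frechet_derivative \<phi> (at z) v)"
proof -
  have "Ck_smooth 0 \<phi>" "Ck_smooth (Suc 0) \<phi>" using assms unfolding test_function_def by blast+
  then show "continuous_on UNIV \<phi>" "continuous_on UNIV (\<lambda>z. frechet_derivative \<phi> (at z) v)" by auto
qed

lemma frechet_derivative_eq_0_outside:
  fixes \<phi> :: "'a::real_normed_vector \<Rightarrow> real"
  assumes "z \<notin> closure {x. \<phi> x \<noteq> 0}"
  shows "frechet_derivative \<phi> (at z) v = 0"
proof -
  have "((\<lambda>_. 0) has_derivative (\<lambda>_. 0)) (at z)" by simp
  then have "(\<phi> has_derivative (\<lambda>_. 0)) (at z)"
    by (rule has_derivative_transform_within_open[of _ _ _ _ "- closure {x. \<phi> x \<noteq> 0}"])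
       (use assms closure_subset[of "{x. \<phi> x \<noteq> 0}"] in auto)
  from fun_cong[OF frechet_derivative_at[OF this], of v] show ?thesis by simp
qed

lemma test_function_eq_0_outside:
  fixes \<phi> :: "'a::euclidean_space \<Rightarrow> real"
  assumes "z \<notin> closure {x. \<phi> x \<noteq> 0}" shows "\<phi> z = 0"
  using assms closure_subset[of "{x. \<phi> x \<noteq> 0}"] by auto

lemma test_function_bounded:
  assumes "test_function V \<phi>"
  obtains C where "\<And>z. \<bar>\<phi> z\<bar> \<le> C" "\<And>z. \<bar>frechet_derivative \<phi> (at z) v\<bar> \<le> C"
proof -
  have S: "compact (closure {x. \<phi> x \<noteq> 0})" using assms by (simp add: test_function_def)
  obtain C1 where C1: "\<And>z. \<bar>\<phi> z\<bar> \<le> C1"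
    using bounded_continuous_compact_support[OF test_function_continuous_on(1)[OF assms] S]
      test_function_eq_0_outside by blast
  obtain C2 where C2: "\<And>z. \<bar>frechet_derivative \<phi> (at z) v\<bar> \<le> C2"
    using bounded_continuous_compact_support[OF test_function_continuous_on(2)[OF assms] S]
      frechet_derivative_eq_0_outside by blast
  have "\<bar>\<phi> z\<bar> \<le> max C1 C2" "\<bar>frechet_derivative \<phi> (at z) v\<bar> \<le> max C1 C2" for z
    using C1[of z] C2[of z] by auto
  then show ?thesis using that by blast
qed

lemma LINT_cylinder:
  fixes q :: "'a::euclidean_space \<times> real \<Rightarrow> real"
  assumes "set_integrable lborel (cylinder U t1 t2) q"
  shows "(LINT t:{t1<..<t2}|lborel. LINT x:U|lborel. q (x, t)) = (LINT z:cylinder U t1 t2|lborel. q z)"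
proof -
  let ?f = "\<lambda>x t. indicator (cylinder U t1 t2) (x, t) *\<^sub>R q (x, t)"
  have i: "integrable (lborel \<Otimes>\<^sub>M lborel) (case_prod ?f)"
    using assms by (simp add: set_integrable_def lborel_prod case_prod_beta')
  have "(LINT z:cylinder U t1 t2|lborel. q z) = integral\<^sup>L (lborel \<Otimes>\<^sub>M lborel) (case_prod ?f)"
    by (simp add: set_lebesgue_integral_def lborel_prod case_prod_beta')
  also have "\<dots> = (LINT t|lborel. LINT x|lborel. ?f x t)"
    by (rule lborel_pair.integral_snd[OF i, symmetric])
  also have "\<dots> = (LINT t:{t1<..<t2}|lborel. LINT x:U|lborel. q (x, t))"
    unfolding set_lebesgue_integral_def cylinder_def
    by (intro Bochner_Integration.integral_cong refl) (auto simp: indicator_times split: split_indicator)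
  finally show ?thesis by simp
qed

lemma test_function_slice:
  fixes \<phi> :: "'a::euclidean_space \<times> real \<Rightarrow> real"
  assumes "test_function (cylinder U t1 t2) \<phi>"
  shows "test_function U (\<lambda>x. \<phi> (x, t))"
    "frechet_derivative (\<lambda>x. \<phi> (x, t)) (at x) v = frechet_derivative \<phi> (at (x, t)) (v, 0)"
proof -
  let ?S = "closure {z. \<phi> z \<noteq> 0}"
  have smooth: "\<And>k. Ck_smooth k \<phi>" and S: "compact ?S" "?S \<subseteq> cylinder U t1 t2"
    using assms by (auto simp: test_function_def)
  have L: "bounded_linear (\<lambda>x::'a. (x, 0::real))"
    by (simp add: bounded_linear_Pair bounded_linear_ident bounded_linear_zero)
  have 1: "Ck_smooth k (\<lambda>x. \<phi> (x, t))" for k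
    using Ck_smooth_compose_affine[OF L smooth, of k "(0, t)"] by simp
  have K: "compact (fst ` ?S)" by (intro compact_continuous_image continuous_intros S)
  have sub: "{x. \<phi> (x, t) \<noteq> 0} \<subseteq> fst ` ?S"
    using closure_subset[of "{z. \<phi> z \<noteq> 0}"] by force
  have cl: "closure {x. \<phi> (x, t) \<noteq> 0} \<subseteq> fst ` ?S"
    using sub K by (simp add: closure_minimal compact_imp_closed)
  have "fst ` ?S \<subseteq> U" using S(2) by (auto simp: cylinder_def)
  then show "test_function U (\<lambda>x. \<phi> (x, t))"
    unfolding test_function_def using 1 cl compact_Int_closed[OF K, of "closure {x. \<phi> (x, t) \<noteq> 0}"]
    by (auto simp: inf.absorb2)
  have "((\<lambda>x. (x, t)) has_derivative (\<lambda>v. (v, 0))) (at x)"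
    by (auto intro!: derivative_eq_intros)
  from has_derivative_compose[OF this test_function_has_derivative[OF assms]]
  show "frechet_derivative (\<lambda>x. \<phi> (x, t)) (at x) v = frechet_derivative \<phi> (at (x, t)) (v, 0)"
    using frechet_derivative_at by metis
qed

text \<open>Both weak identities are stated with joint integrals and space-time test functions on
  one fixed set, because the mollifier to be inserted later acts in space and time
  simultaneously.\<close>

definition weak_solution ::
    "real \<Rightarrow> ('a::euclidean_space \<times> real) set \<Rightarrow> ('a \<times> real \<Rightarrow> real) \<Rightarrow> ('a \<times> real \<Rightarrow> 'a) \<Rightarrow> bool" where
  "weak_solution p V h g \<longleftrightarrow>
     (\<lambda>z. indicator V z *\<^sub>R g z) \<in> borel_measurable borel \<and>
     set_integrable lborel V (\<lambda>z. norm (g z) powr p) \<and>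
     (\<forall>\<phi>. test_function V \<phi> \<longrightarrow>
       (LINT z:V|lborel. (norm (g z) powr (p - 2) *\<^sub>R g z) \<bullet> space_gradient \<phi> z)
       = (LINT z:V|lborel. h z * time_derivative \<phi> z)) \<and>
     (\<forall>\<phi>. test_function V \<phi> \<longrightarrow> (\<forall>e\<in>Basis.
       (LINT z:V|lborel. h z * frechet_derivative \<phi> (at z) (e, 0))
       = - (LINT z:V|lborel. (g z \<bullet> e) * \<phi> z)))"

section \<open>Integrability of solutions, gradients and fluxes on bounded sets\<close>

lemma set_integrable_continuous_closure:
  fixes f :: "'a::euclidean_space \<Rightarrow> 'b::euclidean_space"
  assumes "continuous_on (closure V) f" "compact (closure V)" "V \<in> sets borel"
  shows "set_integrable lborel V f"
proof -
  have "set_integrable lborel (closure V) f"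
    unfolding set_integrable_def by (intro borel_integrable_compact assms)
  then show ?thesis
    by (rule set_integrable_subset) (use assms closure_subset in auto)
qed

lemma set_integrable_mult_bounded:
  fixes f b :: "'a::euclidean_space \<Rightarrow> real"
  assumes f: "set_integrable lborel V f" and b: "b \<in> borel_measurable borel"
    and C: "\<And>z. \<bar>b z\<bar> \<le> C"
  shows "set_integrable lborel V (\<lambda>z. f z * b z)"
proof -
  let ?f = "\<lambda>z. indicator V z *\<^sub>R f z"
  have i: "integrable lborel ?f" using f by (simp add: set_integrable_def)
  have "integrable lborel (\<lambda>z. ?f z * b z)"
  proof (rule Bochner_Integration.integrable_bound)
    show "integrable lborel (\<lambda>z. C * ?f z)" using i by simp
    show "(\<lambda>z. ?f z * b z) \<in> borel_measurable lborel"
      using borel_measurable_integrable[OF i] b by (intro borel_measurable_times) auto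
    show "AE z in lborel. norm (?f z * b z) \<le> norm (C * ?f z)"
    proof (rule AE_I2)
      fix z
      have "norm (?f z * b z) = \<bar>b z\<bar> * \<bar>?f z\<bar>" by (simp add: abs_mult)
      also have "\<dots> \<le> \<bar>C\<bar> * \<bar>?f z\<bar>" using C[of z] by (intro mult_right_mono) auto
      finally show "norm (?f z * b z) \<le> norm (C * ?f z)" by (simp add: abs_mult)
    qed
  qed
  then show ?thesis by (simp add: set_integrable_def mult.assoc)
qed

lemma powr_le_add_powr:
  fixes x :: real
  assumes "0 \<le> a" "a \<le> b" "0 \<le> x"
  shows "x powr a \<le> 1 + x powr b"
proof (cases "x \<le> 1")
  case True
  have "x powr a \<le> 1" using True assms by (simp add: powr_le1)
  then show ?thesis by (simp add: add_increasing2)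
next
  case False
  then have "x powr a \<le> x powr b" using assms by (intro powr_mono) auto
  then show ?thesis by simp
qed

lemma norm_p_flux:
  fixes g :: "'a::real_normed_vector"
  shows "norm (norm g powr (p - 2) *\<^sub>R g) = norm g powr (p - 1)"
proof (cases "g = 0")
  case False
  then have "norm g powr (p - 2) * norm g = norm g powr (p - 2) * norm g powr 1" by simp
  also have "\<dots> = norm g powr (p - 1)" by (simp only: powr_add[symmetric]) simp
  finally show ?thesis by simp
qed simp

text \<open>Both |g| and |g|^(p-1) are at most 1 + |g|^p, and constants are integrable on the
  bounded set V.\<close>

lemma set_integrable_Lp_components:
  fixes g :: "'a::euclidean_space \<Rightarrow> 'b::euclidean_space"
  assumes p: "p > 1" and V: "V \<in> sets borel" "bounded V"
    and g: "(\<lambda>z. indicator V z *\<^sub>R g z) \<in> borel_measurable borel"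
    and gp: "set_integrable lborel V (\<lambda>z. norm (g z) powr p)"
  shows "set_integrable lborel V (\<lambda>z. g z \<bullet> e)"
    "set_integrable lborel V (\<lambda>z. (norm (g z) powr (p - 2) *\<^sub>R g z) \<bullet> e)"
proof -
  let ?g = "\<lambda>z. indicator V z *\<^sub>R g z"
  have one: "integrable lborel (indicator V :: 'a \<Rightarrow> real)"
    using V emeasure_bounded_finite[OF V(2)] by (intro integrable_real_indicator) auto
  have gp': "integrable lborel (\<lambda>z. indicator V z * norm (g z) powr p)"
    using gp by (simp add: set_integrable_def)
  have w: "integrable lborel (\<lambda>z. norm e * (indicator V z + indicator V z * norm (g z) powr p))"
    using one gp' by simp
  have bound: "norm (indicator V z *\<^sub>R (w \<bullet> e)) \<le> norm (norm e * (indicator V z + indicator V z * norm (g z) powr p))"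
    if "norm w \<le> 1 + norm (g z) powr p" for w :: 'b and z
  proof (cases "z \<in> V")
    case True
    have "\<bar>w \<bullet> e\<bar> \<le> norm w * norm e" by (rule Cauchy_Schwarz_ineq2)
    also have "\<dots> \<le> (1 + norm (g z) powr p) * norm e" using that by (rule mult_right_mono) simp
    finally show ?thesis using True by (simp add: mult.commute abs_mult)
  qed simp
  have m1: "(\<lambda>z. indicator V z *\<^sub>R (g z \<bullet> e)) \<in> borel_measurable lborel"
    using borel_measurable_inner[OF g borel_measurable_const[of e]] by simp
  have eq: "indicator V z *\<^sub>R ((norm (g z) powr (p - 2) *\<^sub>R g z) \<bullet> e)
      = (norm (?g z) powr (p - 2) *\<^sub>R ?g z) \<bullet> e" for z
    by (simp split: split_indicator)
  have m2: "(\<lambda>z. indicator V z *\<^sub>R ((norm (g z) powr (p - 2) *\<^sub>R g z) \<bullet> e)) \<in> borel_measurable lborel"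
    unfolding eq using g by measurable
  show "set_integrable lborel V (\<lambda>z. g z \<bullet> e)"
    unfolding set_integrable_def
    by (rule Bochner_Integration.integrable_bound[OF w m1])
       (use bound powr_le_add_powr[of 1 p "norm (g z)" for z] p in auto)
  show "set_integrable lborel V (\<lambda>z. (norm (g z) powr (p - 2) *\<^sub>R g z) \<bullet> e)"
    unfolding set_integrable_def
  proof (rule Bochner_Integration.integrable_bound[OF w m2], rule AE_I2)
    fix z
    show "norm (indicator V z *\<^sub>R ((norm (g z) powr (p - 2) *\<^sub>R g z) \<bullet> e))
        \<le> norm (norm e * (indicator V z + indicator V z * norm (g z) powr p))"
      by (rule bound) (use powr_le_add_powr[of "p - 1" p "norm (g z)"] p in \<open>simp only: norm_p_flux, simp\<close>)
  qed
qed

lemma inner_space_gradient: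
  "w \<bullet> space_gradient \<phi> z = (\<Sum>e\<in>Basis. (w \<bullet> e) * frechet_derivative \<phi> (at z) (e, 0))"
  by (simp add: space_gradient_def inner_sum_right mult.commute)

text \<open>For the equation this is Fubini's theorem. For the gradient, the time slice of a
  space-time test function is admissible in the weak gradient identity of almost every slice of h,
  and integration over t gives the joint identity.\<close>

lemma p_parabolic_imp_weak_solution:
  fixes h :: "(real^'n) \<times> real \<Rightarrow> real"
  assumes p: "p > 1" and h: "p_parabolic p D h"
    and U: "open U" "t1 < t2" "compactly_inside (cylinder U t1 t2) D"
  obtains g where "weak_solution p (cylinder U t1 t2) h g"
proof -
  let ?V = "cylinder U t1 t2"
  note parabolic = conjunct2[OF mp[OF spec[OF spec[OF spec[OF
    conjunct2[OF h[unfolded p_parabolic_def]], of U], of t1], of t2]]]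
  obtain g where *: "LpW1p_with_gradient p U t1 t2 h g \<and> (\<forall>\<phi>. test_function ?V \<phi> \<longrightarrow>
      (LINT t:{t1<..<t2}|lborel. LINT x:U|lborel.
                (norm (g (x, t)) powr (p - 2) *\<^sub>R g (x, t)) \<bullet> space_gradient \<phi> (x, t))
           - (LINT t:{t1<..<t2}|lborel. LINT x:U|lborel. h (x, t) * time_derivative \<phi> (x, t)) = 0)"
    using parabolic[OF conjI[OF U(1) conjI[OF U(2,3)]]] by (rule exE)
  note g = conjunct1[OF *] and eq = mp[OF spec[OF conjunct2[OF *]]]
  have openV: "open ?V" using U by (simp add: cylinder_def open_Times)
  then have V: "?V \<in> sets borel" by simp
  have cV: "compact (closure ?V)" "closure ?V \<subseteq> D" using U(3) by (auto simp: compactly_inside_def)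
  have bV: "bounded ?V" by (rule bounded_subset[OF compact_imp_bounded[OF cV(1)] closure_subset])
  have ch: "continuous_on (closure ?V) h"
    by (rule continuous_on_subset[OF conjunct1[OF h[unfolded p_parabolic_def]] cV(2)])
  have ih: "set_integrable lborel ?V h" by (rule set_integrable_continuous_closure[OF ch cV(1) V])
  have gm: "(\<lambda>z. indicator ?V z *\<^sub>R g z) \<in> borel_measurable borel"
    and gp: "set_integrable lborel ?V (\<lambda>z. norm (g z) powr p)"
    using g by (auto simp: LpW1p_with_gradient_def Lp_on_def set_borel_measurable_def)
  note comp = set_integrable_Lp_components[OF p V bV gm gp]
  have d: "set_integrable lborel ?V (\<lambda>z. f z * frechet_derivative \<phi> (at z) v)"
    if "test_function ?V \<phi>" "set_integrable lborel ?V f" for \<phi> v f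
  proof -
    note \<phi> = that(1) and f = that(2)
    obtain C where "\<And>z. \<bar>frechet_derivative \<phi> (at z) v\<bar> \<le> C"
      using test_function_bounded[OF \<phi>, where v=v] by metis
    then show ?thesis
      by (intro set_integrable_mult_bounded[OF f] borel_measurable_continuous_onI
            test_function_continuous_on[OF \<phi>])
  qed
  have "(LINT z:?V|lborel. (norm (g z) powr (p - 2) *\<^sub>R g z) \<bullet> space_gradient \<phi> z)
       = (LINT z:?V|lborel. h z * time_derivative \<phi> z)" if \<phi>: "test_function ?V \<phi>" for \<phi>
  proof -
    have 1: "set_integrable lborel ?V (\<lambda>z. (norm (g z) powr (p - 2) *\<^sub>R g z) \<bullet> space_gradient \<phi> z)"
      using d[OF \<phi> comp(2)] unfolding inner_space_gradient set_integrable_def scaleR_sum_right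
      by (intro Bochner_Integration.integrable_sum)
    have 2: "set_integrable lborel ?V (\<lambda>z. h z * time_derivative \<phi> z)"
      unfolding time_derivative_def by (rule d[OF \<phi> ih])
    show ?thesis using eq[OF \<phi>] unfolding LINT_cylinder[OF 1] LINT_cylinder[OF 2] by simp
  qed
  moreover have "(LINT z:?V|lborel. h z * frechet_derivative \<phi> (at z) (e, 0))
       = - (LINT z:?V|lborel. (g z \<bullet> e) * \<phi> z)"
    if \<phi>: "test_function ?V \<phi>" and e: "e \<in> Basis" for \<phi> e
  proof -
    obtain C where C: "\<And>z. \<bar>\<phi> z\<bar> \<le> C"
      using test_function_bounded[OF \<phi>, where v=0] by metis
    have i2: "set_integrable lborel ?V (\<lambda>z. (g z \<bullet> e) * \<phi> z)"
      using C by (intro set_integrable_mult_bounded[OF comp(1)] borel_measurable_continuous_onI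
            test_function_continuous_on[OF \<phi>])
    have ae: "AE t in lborel. t \<in> {t1<..<t2} \<longrightarrow> has_weak_gradient U (\<lambda>x. h (x, t)) (\<lambda>x. g (x, t))"
      using g by (auto simp: LpW1p_with_gradient_def W1p_with_gradient_def elim!: eventually_mono)
    have "(LINT z:?V|lborel. h z * frechet_derivative \<phi> (at z) (e, 0))
       = (LINT t:{t1<..<t2}|lborel. LINT x:U|lborel. h (x, t) * frechet_derivative \<phi> (at (x, t)) (e, 0))"
      by (rule LINT_cylinder[symmetric]) (rule d[OF \<phi> ih])
    also have "\<dots> = (LINT t:{t1<..<t2}|lborel. - (LINT x:U|lborel. (g (x, t) \<bullet> e) * \<phi> (x, t)))"
      unfolding set_lebesgue_integral_def[of _ "{t1<..<t2}"]
    proof (rule Bochner_Integration.integral_cong_AE)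
      show "AE t in lborel. indicat_real {t1<..<t2} t *\<^sub>R (LINT x:U|lborel. h (x, t) * frechet_derivative \<phi> (at (x, t)) (e, 0))
        = indicat_real {t1<..<t2} t *\<^sub>R - (LINT x:U|lborel. (g (x, t) \<bullet> e) * \<phi> (x, t))"
        using ae
      proof eventually_elim
        case (elim t)
        show ?case
        proof (cases "t \<in> {t1<..<t2}")
          case True
          with elim e test_function_slice[OF \<phi>] show ?thesis
            unfolding has_weak_gradient_def by fastforce
        qed simp
      qed
    next
      \<comment> \<open>The slicewise identity holds only for almost every t; to integrate it, both
        inner integrals must be measurable in t, which Fubini's theorem supplies.\<close>
      have "integrable lborel (\<lambda>z. indicator ?V z *\<^sub>R (h z * frechet_derivative \<phi> (at z) (e, 0)))"
        using d[OF \<phi> ih] by (simp add: set_integrable_def)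
      then have "integrable (lborel \<Otimes>\<^sub>M lborel) (\<lambda>(x, t). indicator ?V (x, t) *\<^sub>R (h (x, t) * frechet_derivative \<phi> (at (x, t)) (e, 0)))"
        by (simp add: lborel_prod case_prod_beta')
      from borel_measurable_integrable[OF lborel_pair.integrable_snd[OF this]]
      have "(\<lambda>t. LINT x|lborel. indicator ?V (x, t) *\<^sub>R (h (x, t) * frechet_derivative \<phi> (at (x, t)) (e, 0)))
           \<in> borel_measurable lborel" .
      also have "(\<lambda>t. LINT x|lborel. indicator ?V (x, t) *\<^sub>R (h (x, t) * frechet_derivative \<phi> (at (x, t)) (e, 0)))
         = (\<lambda>t. indicat_real {t1<..<t2} t *\<^sub>R (LINT x:U|lborel. h (x, t) * frechet_derivative \<phi> (at (x, t)) (e, 0)))"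
        by (auto simp: set_lebesgue_integral_def cylinder_def indicator_times fun_eq_iff
            intro!: Bochner_Integration.integral_cong split: split_indicator)
      finally show "(\<lambda>t. indicat_real {t1<..<t2} t *\<^sub>R (LINT x:U|lborel. h (x, t) * frechet_derivative \<phi> (at (x, t)) (e, 0)))
         \<in> borel_measurable lborel" .
      have "integrable lborel (\<lambda>z. indicator ?V z *\<^sub>R ((g z \<bullet> e) * \<phi> z))"
        using i2 by (simp add: set_integrable_def)
      then have "integrable (lborel \<Otimes>\<^sub>M lborel) (\<lambda>(x, t). indicator ?V (x, t) *\<^sub>R ((g (x, t) \<bullet> e) * \<phi> (x, t)))"
        by (simp add: lborel_prod case_prod_beta')
      from borel_measurable_integrable[OF lborel_pair.integrable_snd[OF this]]
      have "(\<lambda>t. - (LINT x|lborel. indicator ?V (x, t) *\<^sub>R ((g (x, t) \<bullet> e) * \<phi> (x, t))))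
           \<in> borel_measurable lborel" by (rule borel_measurable_uminus)
      also have "(\<lambda>t. - (LINT x|lborel. indicator ?V (x, t) *\<^sub>R ((g (x, t) \<bullet> e) * \<phi> (x, t))))
         = (\<lambda>t. indicat_real {t1<..<t2} t *\<^sub>R - (LINT x:U|lborel. (g (x, t) \<bullet> e) * \<phi> (x, t)))"
        by (auto simp: set_lebesgue_integral_def cylinder_def indicator_times fun_eq_iff
            intro!: Bochner_Integration.integral_cong split: split_indicator)
      finally show "(\<lambda>t. indicat_real {t1<..<t2} t *\<^sub>R - (LINT x:U|lborel. (g (x, t) \<bullet> e) * \<phi> (x, t)))
         \<in> borel_measurable lborel" .
    qed
    also have "\<dots> = - (LINT z:?V|lborel. (g z \<bullet> e) * \<phi> z)"
      unfolding LINT_cylinder[OF i2, symmetric] by (simp add: set_lebesgue_integral_def)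
    finally show ?thesis .
  qed
  ultimately have "weak_solution p ?V h g"
    using gm gp by (simp add: weak_solution_def)
  then show ?thesis by (rule that)
qed

text \<open>F is extended by 0 outside W. The extension stays continuously differentiable along e
  because W and the complement of the compact S are open and cover the space.\<close>

lemma set_integral_directional_derivative_eq_0:
  fixes F :: "'a::euclidean_space \<Rightarrow> real"
  assumes W: "open W" and S: "compact S" "S \<subseteq> W"
    and D: "\<And>z. z \<in> W \<Longrightarrow> ((\<lambda>s. F (z + s *\<^sub>R e)) has_real_derivative F' z) (at 0)"
    and cont: "continuous_on W F" "continuous_on W F'"
    and zero: "\<And>z. z \<in> W \<Longrightarrow> z \<notin> S \<Longrightarrow> F z = 0"
  shows "set_integrable lborel W F'" "(LINT z:W|lborel. F' z) = 0"
proof -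
  define f where "f z = indicator W z *\<^sub>R F z" for z
  define f' where "f' z = indicator W z *\<^sub>R F' z" for z
  have near: "\<forall>\<^sub>F s in nhds 0. z + s *\<^sub>R e \<in> U" if "open U" "z \<in> U" for U z
  proof -
    have "open ((\<lambda>s. z + s *\<^sub>R e) -` U)"
      using that(1) by (intro open_vimage continuous_intros)
    then show ?thesis
      using eventually_nhds_in_open[of "(\<lambda>s. z + s *\<^sub>R e) -` U" 0] that(2) by simp
  qed
  have openS: "open (- S)" using compact_imp_closed[OF S(1)] by (simp add: open_Compl)
  have F0: "f z = 0" if "z \<notin> S" for z
    using zero that by (cases "z \<in> W") (auto simp: f_def)
  have D0: "((\<lambda>s. f (z + s *\<^sub>R e)) has_real_derivative 0) (at 0)" if "z \<notin> S" for z
  proof -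
    have "\<forall>\<^sub>F s in nhds 0. f (z + s *\<^sub>R e) = 0"
      using near[OF openS, of z] that by (auto elim!: eventually_mono intro: F0)
    from DERIV_cong_ev[OF refl this refl] show ?thesis by simp
  qed
  have DW: "((\<lambda>s. f (z + s *\<^sub>R e)) has_real_derivative F' z) (at 0)" if "z \<in> W" for z
  proof -
    have "\<forall>\<^sub>F s in nhds 0. f (z + s *\<^sub>R e) = F (z + s *\<^sub>R e)"
      using near[OF W that] by (auto elim!: eventually_mono simp: f_def)
    from DERIV_cong_ev[OF refl this refl] D[OF that] show ?thesis by simp
  qed
  have F'0: "f' z = 0" if "z \<notin> S" for z
    using DERIV_unique[OF DW D0[OF that]] by (cases "z \<in> W") (auto simp: f'_def)
  have Df: "((\<lambda>s. f (z + s *\<^sub>R e)) has_real_derivative f' z) (at 0)" for z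
  proof (cases "z \<in> W")
    case True then show ?thesis using DW by (simp add: f'_def)
  next
    case False
    then have "z \<notin> S" using S(2) by blast
    then show ?thesis using D0 F'0 by simp
  qed
  have UN: "UNIV = W \<union> - S" using S(2) by blast
  have cf: "continuous_on UNIV f" unfolding UN
    by (intro continuous_on_open_Un W openS continuous_on_eq[OF cont(1)]
          continuous_on_eq[OF continuous_on_const[of "- S" 0]]) (auto simp: F0, simp add: f_def)
  have cf': "continuous_on UNIV f'" unfolding UN
    by (intro continuous_on_open_Un W openS continuous_on_eq[OF cont(2)]
          continuous_on_eq[OF continuous_on_const[of "- S" 0]]) (auto simp: F'0, simp add: f'_def)
  from integral_directional_derivative_eq_0[OF Df cf cf' S(1) F0]
  show "set_integrable lborel W F'" "(LINT z:W|lborel. F' z) = 0"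
    by (simp_all add: set_integrable_def set_lebesgue_integral_def f'_def[abs_def])
qed

text \<open>From the second power on, the positive part is differentiable across its kink, so the
  truncations in the comparison argument need no further smoothing.\<close>

lemma DERIV_pos_part_power:
  "((\<lambda>s::real. (max 0 s) ^ Suc (Suc n)) has_real_derivative real (Suc (Suc n)) * (max 0 s) ^ Suc n) (at s)"
proof (cases s "0::real" rule: linorder_cases)
  case less
  have ev: "\<forall>\<^sub>F x in nhds s. (max 0 x) ^ Suc (Suc n) = (0::real)"
    using eventually_nhds_in_open[of "{..<0}" s] less by (auto elim!: eventually_mono)
  from DERIV_cong_ev[OF refl ev refl] less show ?thesis by simp
next
  case greater
  have ev: "\<forall>\<^sub>F x in nhds s. (max 0 x) ^ Suc (Suc n) = x ^ Suc (Suc n)"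
    using eventually_nhds_in_open[of "{0<..}" s] greater by (auto elim!: eventually_mono)
  have "((\<lambda>s. s ^ Suc (Suc n)) has_real_derivative real (Suc (Suc n)) * s ^ Suc n) (at s)"
    using DERIV_pow[of "Suc (Suc n)" s] by simp
  with DERIV_cong_ev[OF refl ev refl] greater show ?thesis by simp
next
  case equal
  have "((\<lambda>x::real. (max 0 x) ^ Suc n) \<longlongrightarrow> (max 0 0) ^ Suc n) (at 0)"
    by (intro tendsto_intros)
  then have "((\<lambda>x::real. (max 0 x) ^ Suc n) \<longlongrightarrow> 0) (at 0)" by simp
  then have "((\<lambda>x::real. ((max 0 x) ^ Suc (Suc n)) / x) \<longlongrightarrow> 0) (at 0)"
    by (rule Lim_transform_eventually) (auto simp: eventually_at_filter max_def)
  then show ?thesis using equal by (simp add: has_field_derivative_iff)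
qed

section \<open>Mollified weak solutions\<close>

lemma conv_diff:
  assumes "continuous_on UNIV k" "\<And>z. \<bar>k z\<bar> \<le> C" "integrable lborel f" "integrable lborel g"
  shows "conv k (\<lambda>z. f z - g z) z = conv k f z - conv k g z"
  using integrable_conv[OF assms(1,2,3), of z] integrable_conv[OF assms(1,2,4), of z]
  by (simp add: conv_def right_diff_distrib)

lemma mollifier_derivative_bounded:
  assumes "mollifier \<delta> k"
  shows "continuous_on UNIV (\<lambda>z. frechet_derivative k (at z) v)"
    and "\<exists>C. \<forall>z. \<bar>frechet_derivative k (at z) v\<bar> \<le> C"
proof -
  have smooth: "\<And>j. Ck_smooth j k" using assms unfolding mollifier_def by blast
  have sub: "closure {z. k z \<noteq> 0} \<subseteq> cball 0 \<delta>"
    using mollifier_zero[OF assms] by (intro closure_minimal) blast+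
  then have "compact (closure {z. k z \<noteq> 0})"
    by (meson bounded_cball bounded_subset closed_closure compact_eq_bounded_closed)
  then have test: "test_function UNIV k" using smooth by (simp add: test_function_def del: Ck_smooth.simps)
  show "continuous_on UNIV (\<lambda>z. frechet_derivative k (at z) v)"
    by (rule test_function_continuous_on[OF test])
  show "\<exists>C. \<forall>z. \<bar>frechet_derivative k (at z) v\<bar> \<le> C"
    using test_function_bounded[OF test, where v=v] by metis
qed

lemma mollifier_directional_derivative:
  assumes "mollifier \<delta> k"
  shows "((\<lambda>s. k (z + s *\<^sub>R v)) has_real_derivative frechet_derivative k (at z) v) (at 0)"
proof -
  have "Ck_smooth (Suc 0) k" using assms unfolding mollifier_def by blast
  from Ck_smooth_Suc_has_derivative[OF this, of z]
  have k: "(k has_derivative frechet_derivative k (at z)) (at (z + 0 *\<^sub>R v))" by simp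
  have "((\<lambda>s. z + s *\<^sub>R v) has_derivative (\<lambda>s. s *\<^sub>R v)) (at 0)"
    by (auto intro!: derivative_eq_intros)
  from has_derivative_compose[OF this k]
  have "((\<lambda>s. k (z + s *\<^sub>R v)) has_derivative (\<lambda>s. frechet_derivative k (at z) (s *\<^sub>R v))) (at 0)" .
  moreover have "frechet_derivative k (at z) (s *\<^sub>R v) = frechet_derivative k (at z) v * s" for s
    using linear_frechet_derivative[of k "at z"] k
    by (metis add.right_neutral differentiable_def linear_cmul mult.commute real_scaleR_def scale_zero_left)
  ultimately show ?thesis by (simp add: has_field_derivative_def)
qed

lemma test_function_reflected_mollifier:
  assumes k: "mollifier \<delta> k" and sub: "cball z \<delta> \<subseteq> V"
  shows "test_function V (\<lambda>\<zeta>. k (z - \<zeta>))"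
    and "frechet_derivative (\<lambda>\<zeta>. k (z - \<zeta>)) (at \<zeta>) v = - frechet_derivative k (at (z - \<zeta>)) v"
proof -
  have smooth: "\<And>j. Ck_smooth j k" using k unfolding mollifier_def by blast
  have 1: "Ck_smooth j (\<lambda>\<zeta>. k (z - \<zeta>))" for j
    using Ck_smooth_compose_affine[OF bounded_linear_minus[OF bounded_linear_ident] smooth, of j z]
    by simp
  have "{\<zeta>. k (z - \<zeta>) \<noteq> 0} \<subseteq> cball z \<delta>"
    using mollifier_zero[OF k] unfolding mem_cball_0[symmetric] by (force simp: dist_norm)
  then have sub2: "closure {\<zeta>. k (z - \<zeta>) \<noteq> 0} \<subseteq> cball z \<delta>" by (intro closure_minimal) auto
  then have "compact (closure {\<zeta>. k (z - \<zeta>) \<noteq> 0})"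
    by (meson bounded_cball bounded_subset closed_closure compact_eq_bounded_closed)
  then show "test_function V (\<lambda>\<zeta>. k (z - \<zeta>))"
    using 1 sub sub2 by (auto simp: test_function_def simp del: Ck_smooth.simps)
  have d: "((\<lambda>\<zeta>. z - \<zeta>) has_derivative (\<lambda>v. - v)) (at \<zeta>)"
    by (auto intro!: derivative_eq_intros)
  have "Ck_smooth (Suc 0) k" by (rule smooth)
  note dk = Ck_smooth_Suc_has_derivative[OF this, of "z - \<zeta>"]
  have "frechet_derivative (\<lambda>\<zeta>. k (z - \<zeta>)) (at \<zeta>) v = frechet_derivative k (at (z - \<zeta>)) (- v)"
    using frechet_derivative_at[OF has_derivative_compose[OF d dk]] by metis
  also have "\<dots> = - frechet_derivative k (at (z - \<zeta>)) v"
    using linear_neg[OF linear_frechet_derivative[OF differentiableI[OF dk]]] .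
  finally show "frechet_derivative (\<lambda>\<zeta>. k (z - \<zeta>)) (at \<zeta>) v = - frechet_derivative k (at (z - \<zeta>)) v" .
qed

text \<open>The reflected kernel centred at z is a test function when its support lies in V.
  Inserting it turns the weak identities into pointwise ones at z: the gradient of the mollified h
  is the mollified g, and its time derivative is the divergence of the mollified flux.\<close>

lemma weak_solution_conv:
  fixes h :: "'a::euclidean_space \<times> real \<Rightarrow> real"
  assumes p: "p > 1" and V: "V \<in> sets borel" "bounded V" and h: "weak_solution p V h g"
    and ih: "set_integrable lborel V h"
    and k: "mollifier \<delta> k" and sub: "cball z \<delta> \<subseteq> V"
  shows "e \<in> Basis \<Longrightarrow> conv (\<lambda>z. frechet_derivative k (at z) (e, 0)) (\<lambda>z. indicator V z * h z) z
      = conv k (\<lambda>z. indicator V z * (g z \<bullet> e)) z"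
    and "conv (\<lambda>z. frechet_derivative k (at z) (0, 1)) (\<lambda>z. indicator V z * h z) z
      = (\<Sum>e\<in>Basis. conv (\<lambda>z. frechet_derivative k (at z) (e, 0))
           (\<lambda>z. indicator V z * ((norm (g z) powr (p - 2) *\<^sub>R g z) \<bullet> e)) z)"
proof -
  let ?\<phi> = "\<lambda>\<zeta>. k (z - \<zeta>)"
  note test = test_function_reflected_mollifier[OF k sub]
  have gm: "(\<lambda>z. indicator V z *\<^sub>R g z) \<in> borel_measurable borel"
    and gp: "set_integrable lborel V (\<lambda>z. norm (g z) powr p)"
    using h by (auto simp: weak_solution_def)
  note comp = set_integrable_Lp_components[OF p V gm gp]
  have grad: "(LINT z:V|lborel. h z * frechet_derivative ?\<phi> (at z) (e, 0))
       = - (LINT z:V|lborel. (g z \<bullet> e) * ?\<phi> z)" if "e \<in> Basis" for e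
    using h test(1) that unfolding weak_solution_def by blast
  show "conv (\<lambda>z. frechet_derivative k (at z) (e, 0)) (\<lambda>z. indicator V z * h z) z
      = conv k (\<lambda>z. indicator V z * (g z \<bullet> e)) z" if "e \<in> Basis"
    using grad[OF that] by (simp add: test(2) conv_def set_lebesgue_integral_def mult_ac)
  have eq: "(LINT z:V|lborel. (norm (g z) powr (p - 2) *\<^sub>R g z) \<bullet> space_gradient ?\<phi> z)
       = (LINT z:V|lborel. h z * time_derivative ?\<phi> z)"
    using h test(1) unfolding weak_solution_def by blast
  have int: "integrable lborel (\<lambda>\<zeta>. frechet_derivative k (at (z - \<zeta>)) (e, 0) *
      (indicator V \<zeta> * ((norm (g \<zeta>) powr (p - 2) *\<^sub>R g \<zeta>) \<bullet> e)))" for e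
  proof -
    obtain C where C: "\<And>z. \<bar>frechet_derivative k (at z) (e, 0)\<bar> \<le> C"
      using mollifier_derivative_bounded(2)[OF k] by blast
    show ?thesis
      by (rule integrable_conv[OF mollifier_derivative_bounded(1)[OF k] C])
         (use comp(2)[of e] in \<open>simp add: set_integrable_def\<close>)
  qed
  have "- (\<Sum>e\<in>Basis. conv (\<lambda>z. frechet_derivative k (at z) (e, 0))
           (\<lambda>z. indicator V z * ((norm (g z) powr (p - 2) *\<^sub>R g z) \<bullet> e)) z)
      = - (LINT \<zeta>|lborel. (\<Sum>e\<in>Basis. frechet_derivative k (at (z - \<zeta>)) (e, 0) *
      (indicator V \<zeta> * ((norm (g \<zeta>) powr (p - 2) *\<^sub>R g \<zeta>) \<bullet> e))))"
    unfolding conv_def by (subst Bochner_Integration.integral_sum) (use int in auto)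
  also have "\<dots> = (LINT z:V|lborel. (norm (g z) powr (p - 2) *\<^sub>R g z) \<bullet> space_gradient ?\<phi> z)"
    unfolding set_lebesgue_integral_def inner_space_gradient test(2)
      Bochner_Integration.integral_minus[symmetric] scaleR_sum_right sum_negf[symmetric]
    by (intro Bochner_Integration.integral_cong sum.cong refl)
       (simp only: real_scaleR_def mult_minus_right mult.commute mult.left_commute)
  also have "\<dots> = - conv (\<lambda>z. frechet_derivative k (at z) (0, 1)) (\<lambda>z. indicator V z * h z) z"
    unfolding eq by (simp add: time_derivative_def test(2) conv_def set_lebesgue_integral_def mult_ac)
  finally show "conv (\<lambda>z. frechet_derivative k (at z) (0, 1)) (\<lambda>z. indicator V z * h z) z
      = (\<Sum>e\<in>Basis. conv (\<lambda>z. frechet_derivative k (at z) (e, 0))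
           (\<lambda>z. indicator V z * ((norm (g z) powr (p - 2) *\<^sub>R g z) \<bullet> e)) z)" by simp
qed

text \<open>Cauchy-Schwarz applied to the mixed terms reduces the claim to (x^(p-1) - y^(p-1)) (x -
  y) \<ge> 0 for the norms x and y.\<close>

lemma p_flux_monotone:
  fixes a b :: "'a::real_inner"
  assumes p: "p > 1"
  shows "0 \<le> (norm a powr (p - 2) *\<^sub>R a - norm b powr (p - 2) *\<^sub>R b) \<bullet> (a - b)"
proof -
  define x where "x = norm a" define y where "y = norm b"
  have self: "norm u powr (p - 2) * (u \<bullet> u) = norm u powr (p - 1) * norm u" for u :: 'a
  proof (cases "u = 0")
    case False
    have "norm u powr (p - 2) * (u \<bullet> u) = norm (norm u powr (p - 2) *\<^sub>R u) * norm u"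
      by (simp add: power2_norm_eq_inner[symmetric] power2_eq_square)
    then show ?thesis by (simp only: norm_p_flux)
  qed simp
  have cross: "norm u powr (p - 2) * (u \<bullet> w) \<le> norm u powr (p - 1) * norm w" for u w :: 'a
  proof -
    have "(norm u powr (p - 2) *\<^sub>R u) \<bullet> w \<le> norm (norm u powr (p - 2) *\<^sub>R u) * norm w"
      by (rule norm_cauchy_schwarz)
    then show ?thesis by (simp only: norm_p_flux inner_scaleR_left)
  qed
  have "(x powr (p - 1) - y powr (p - 1)) * (x - y) \<ge> 0"
  proof (cases "x \<le> y")
    case True
    then have "x powr (p - 1) \<le> y powr (p - 1)" using p by (intro powr_mono2) (auto simp: x_def)
    with True show ?thesis by (simp add: mult_nonpos_nonpos)
  next
    case False
    then have "y powr (p - 1) \<le> x powr (p - 1)" using p by (intro powr_mono2) (auto simp: y_def)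
    with False show ?thesis by simp
  qed
  moreover have "(norm a powr (p - 2) *\<^sub>R a - norm b powr (p - 2) *\<^sub>R b) \<bullet> (a - b)
     = norm a powr (p - 2) * (a \<bullet> a) + norm b powr (p - 2) * (b \<bullet> b)
       - norm a powr (p - 2) * (a \<bullet> b) - norm b powr (p - 2) * (b \<bullet> a)"
    by (simp add: inner_diff algebra_simps)
  ultimately show ?thesis
    using self[of a] self[of b] cross[of a b] cross[of b a]
    by (simp add: x_def y_def algebra_simps)
qed

text \<open>Gradients lie in L^p, and fluxes in the dual space, since |g|^(p-1) raised to p / (p -
  1) is |g|^p. These conjugate exponents are what \<open>mollified_product_L1\<close> needs.\<close>

lemma weak_solution_Lq_bounds:
  fixes g1 g2 :: "'a::euclidean_space \<times> real \<Rightarrow> 'a"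
  assumes p: "p > 1" and e: "e \<in> Basis"
    and g1: "(\<lambda>z. indicator V z *\<^sub>R g1 z) \<in> borel_measurable borel"
       "set_integrable lborel V (\<lambda>z. norm (g1 z) powr p)"
    and g2: "(\<lambda>z. indicator V z *\<^sub>R g2 z) \<in> borel_measurable borel"
       "set_integrable lborel V (\<lambda>z. norm (g2 z) powr p)"
  shows "(\<integral>\<^sup>+z. ennreal (\<bar>indicator V z * (g1 z \<bullet> e) - indicator V z * (g2 z \<bullet> e)\<bar> powr p) \<partial>lborel) < \<infinity>"
    "(\<integral>\<^sup>+z. ennreal (\<bar>indicator V z * ((norm (g1 z) powr (p - 2) *\<^sub>R g1 z) \<bullet> e)
        - indicator V z * ((norm (g2 z) powr (p - 2) *\<^sub>R g2 z) \<bullet> e)\<bar> powr (p / (p - 1))) \<partial>lborel) < \<infinity>"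
proof -
  define w where "w z = indicator V z * norm (g1 z) powr p + indicator V z * norm (g2 z) powr p" for z
  have w: "integrable lborel w" "\<And>z. w z \<ge> 0"
    using g1(2) g2(2) by (auto simp: w_def[abs_def] set_integrable_def)
  have fin: "(\<integral>\<^sup>+z. ennreal (\<bar>u z - v z\<bar> powr q) \<partial>lborel) < \<infinity>"
    if q: "q > 0" and u: "\<And>z. \<bar>u z\<bar> powr q \<le> indicator V z * norm (g1 z) powr p"
      and v: "\<And>z. \<bar>v z\<bar> powr q \<le> indicator V z * norm (g2 z) powr p" for u v q
  proof -
    have "\<bar>u z - v z\<bar> powr q \<le> 2 powr q * w z" for z
    proof -
      have "\<bar>u z - v z\<bar> powr q \<le> 2 powr q * (\<bar>u z\<bar> powr q + \<bar>v z\<bar> powr q)"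
        using powr_abs_add_le[OF q, of "u z" "- v z"] by simp
      also have "\<dots> \<le> 2 powr q * w z" unfolding w_def by (intro mult_left_mono add_mono u v) simp
      finally show ?thesis .
    qed
    then have "(\<integral>\<^sup>+z. ennreal (\<bar>u z - v z\<bar> powr q) \<partial>lborel) \<le> (\<integral>\<^sup>+z. ennreal (2 powr q * w z) \<partial>lborel)"
      by (intro nn_integral_mono ennreal_leI)
    also have "\<dots> = ennreal (LINT z|lborel. 2 powr q * w z)"
      using w by (intro nn_integral_eq_integral) auto
    also have "\<dots> < \<infinity>" by simp
    finally show ?thesis .
  qed
  have comp: "\<bar>x \<bullet> e\<bar> \<le> norm x" for x :: 'a using Basis_le_norm[OF e] .
  have A: "\<bar>indicator V z * (x \<bullet> e)\<bar> powr p \<le> indicator V z * norm x powr p" for x and z :: "'a \<times> real"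
    using comp[of x] p by (cases "z \<in> V") (auto intro!: powr_mono2)
  have B: "\<bar>indicator V z * ((norm x powr (p - 2) *\<^sub>R x) \<bullet> e)\<bar> powr (p / (p - 1)) \<le> indicator V z * norm x powr p"
    for x and z :: "'a \<times> real"
  proof (cases "z \<in> V")
    case True
    have "\<bar>(norm x powr (p - 2) *\<^sub>R x) \<bullet> e\<bar> powr (p / (p - 1)) \<le> (norm x powr (p - 1)) powr (p / (p - 1))"
      using comp[of "norm x powr (p - 2) *\<^sub>R x"] p unfolding norm_p_flux by (intro powr_mono2) auto
    also have "\<dots> = norm x powr p" using p by (simp add: powr_powr)
    finally show ?thesis using True by simp
  qed simp
  show "(\<integral>\<^sup>+z. ennreal (\<bar>indicator V z * (g1 z \<bullet> e) - indicator V z * (g2 z \<bullet> e)\<bar> powr p) \<partial>lborel) < \<infinity>"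
    by (rule fin) (use p A in auto)
  show "(\<integral>\<^sup>+z. ennreal (\<bar>indicator V z * ((norm (g1 z) powr (p - 2) *\<^sub>R g1 z) \<bullet> e)
        - indicator V z * ((norm (g2 z) powr (p - 2) *\<^sub>R g2 z) \<bullet> e)\<bar> powr (p / (p - 1))) \<partial>lborel) < \<infinity>"
    by (rule fin) (use p in simp, (rule B)+)
qed

section \<open>Comparison of weak solutions\<close>

lemma finite_common_lower_bound:
  assumes "finite A" "\<And>x. x \<in> A \<Longrightarrow> (0::real) < f x"
  obtains d where "d > 0" "\<And>x. x \<in> A \<Longrightarrow> d \<le> f x"
proof -
  have "\<exists>d>0. \<forall>x\<in>A. d \<le> f x"
    using assms
  proof (induction A rule: finite_induct)
    case empty then show ?case by (intro exI[of _ 1]) auto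
  next
    case (insert a A)
    then obtain d where "d > 0" "\<forall>x\<in>A. d \<le> f x" by auto
    then show ?case using insert.prems[of a]
      by (intro exI[of _ "min d (f a)"]) auto
  qed
  then show ?thesis using that by blast
qed

text \<open>With \<open>m\<close> the mollified difference \<open>h1 - h2\<close>, the equation is tested with
  \<open>3 (m + \<epsilon> / 2)\<^sub>+\<^sup>2 (T - t)\<^sub>+\<^sup>2\<close>: the decreasing factor in time yields a term that stays positive
  near \<open>z0\<close>, whereas the flux term has the opposite sign up to an error that vanishes with the
  mollification.\<close>

lemma weak_comparison:
  fixes h1 h2 :: "'a::euclidean_space \<times> real \<Rightarrow> real"
  assumes p: "p > 1" and V: "open V" "compact (closure V)"
    and cont: "continuous_on (closure V) h1" "continuous_on (closure V) h2"
    and sol: "weak_solution p V h1 g1" "weak_solution p V h2 g2"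
    and \<epsilon>: "\<epsilon> > 0"
    and sub: "{z \<in> closure V. - (3 * \<epsilon> / 4) \<le> h1 z - h2 z \<and> snd z \<le> T} \<subseteq> V"
    and z0: "z0 \<in> V" "snd z0 < T" "h2 z0 \<le> h1 z0"
  shows False
proof -
  define q where "q = p / (p - 1)"
  have q: "q > 1" "1 / q + 1 / p = 1" using p by (auto simp: q_def field_simps)
  \<comment> \<open>A truncation level between two regimes: before time T and off \<open>S\<close>
    the difference m is below - 3\<epsilon>/4, near z0 it is at least - \<epsilon>/8. A
    mollification error of \<epsilon>/8 spoils neither side, so the truncated function vanishes in
    the first regime and is at least \<epsilon>/8 in the second.\<close>
  define \<kappa> where "\<kappa> = - (\<epsilon> / 2)"
  define m where "m z = h1 z - h2 z" for z
  define A where "A g = norm g powr (p - 2) *\<^sub>R g" for g :: 'a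
  define mt where "mt z = indicator V z * h1 z - indicator V z * h2 z" for z
  define B where "B e z = indicator V z * (A (g1 z) \<bullet> e) - indicator V z * (A (g2 z) \<bullet> e)" for e z
  define d where "d e z = indicator V z * (g1 z \<bullet> e) - indicator V z * (g2 z \<bullet> e)" for e z
  have Vm: "V \<in> sets borel" using V by simp
  have bV: "bounded V" by (rule bounded_subset[OF compact_imp_bounded[OF V(2)] closure_subset])
  have gm: "(\<lambda>z. indicator V z *\<^sub>R g1 z) \<in> borel_measurable borel"
       "set_integrable lborel V (\<lambda>z. norm (g1 z) powr p)"
       "(\<lambda>z. indicator V z *\<^sub>R g2 z) \<in> borel_measurable borel"
       "set_integrable lborel V (\<lambda>z. norm (g2 z) powr p)"
    using sol by (auto simp: weak_solution_def)
  have ih: "set_integrable lborel V h1" "set_integrable lborel V h2"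
    using set_integrable_continuous_closure cont V Vm by blast+
  then have ih': "integrable lborel (\<lambda>z. indicator V z * h1 z)" "integrable lborel (\<lambda>z. indicator V z * h2 z)"
    by (simp_all add: set_integrable_def)
  then have imt: "integrable lborel mt" by (simp add: mt_def[abs_def])
  note comp1 = set_integrable_Lp_components[OF p Vm bV gm(1,2)]
  note comp2 = set_integrable_Lp_components[OF p Vm bV gm(3,4)]
  have iA: "integrable lborel (\<lambda>z. indicator V z * (A (g1 z) \<bullet> e))"
           "integrable lborel (\<lambda>z. indicator V z * (A (g2 z) \<bullet> e))" for e
    using comp1(2)[of e] comp2(2)[of e] by (simp_all add: set_integrable_def A_def)
  have ig: "integrable lborel (\<lambda>z. indicator V z * (g1 z \<bullet> e))"
           "integrable lborel (\<lambda>z. indicator V z * (g2 z \<bullet> e))" for e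
    using comp1(1)[of e] comp2(1)[of e] by (simp_all add: set_integrable_def)
  have iB: "integrable lborel (B e)" and id: "integrable lborel (d e)" for e
    using iA[of e] ig[of e] by (auto simp: B_def[abs_def] d_def[abs_def])
  have [measurable]: "B e \<in> borel_measurable borel" "d e \<in> borel_measurable borel" for e
    using iB[of e] id[of e] by (auto dest: borel_measurable_integrable)
  have fin: "(\<integral>\<^sup>+z. ennreal (\<bar>B e z\<bar> powr q) \<partial>lborel) < \<infinity>"
     "(\<integral>\<^sup>+z. ennreal (\<bar>d e z\<bar> powr p) \<partial>lborel) < \<infinity>" if "e \<in> Basis" for e
    using weak_solution_Lq_bounds[OF p that gm] unfolding B_def d_def A_def q_def by simp_all
  have mono: "0 \<le> (\<Sum>e\<in>Basis. B e z * d e z)" for z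
  proof (cases "z \<in> V")
    case True
    have *: "(\<Sum>e\<in>Basis. B e z * d e z) = (A (g1 z) - A (g2 z)) \<bullet> (g1 z - g2 z)"
      by (subst euclidean_inner) (use True in \<open>simp add: B_def d_def inner_diff_left\<close>)
    show ?thesis using p_flux_monotone[OF p, of "g1 z" "g2 z"] unfolding * A_def .
  qed (simp add: B_def)
  obtain R where "R > 0 \<and> (\<forall>z\<in>closure V. norm z \<le> R)"
    using compact_imp_bounded[OF V(2)] unfolding bounded_pos by (rule exE)
  then have R: "\<And>z. z \<in> closure V \<Longrightarrow> norm z \<le> R" "R \<ge> 0" by simp_all
  have VR: "norm z \<le> R" if "z \<in> V" for z using R(1) closure_subset that by blast
  have zero: "B e z = 0" "d e z = 0" if "R < norm z" for e z
    using VR[of z] that by (auto simp: B_def d_def indicator_def)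
  have cm: "continuous_on (closure V) m" unfolding m_def by (intro continuous_intros cont)
  have mt: "mt z = m z" if "z \<in> V" for z using that by (simp add: mt_def m_def)
  have bm: "bounded (m ` closure V)" by (intro compact_imp_bounded compact_continuous_image cm V)
  obtain Cm where "Cm > 0 \<and> (\<forall>y\<in>m ` closure V. norm y \<le> Cm)"
    using bm unfolding bounded_pos by (rule exE)
  then have Cm: "\<And>z. z \<in> closure V \<Longrightarrow> \<bar>m z\<bar> \<le> Cm" "Cm \<ge> 0" by simp_all
  define S where "S = {z \<in> closure V. - (3 * \<epsilon> / 4) \<le> m z \<and> snd z \<le> T}"
  have SV: "S \<subseteq> V" using sub by (simp add: S_def m_def)
  have "closed S"
  proof -
    have "closed {z \<in> closure V. - (3 * \<epsilon> / 4) \<le> m z}"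
      using continuous_on_closed_Collect_le[OF continuous_on_const cm closed_closure] by simp
    moreover have "closed {z :: 'a \<times> real. snd z \<le> T}"
      by (intro closed_Collect_le continuous_intros)
    moreover have "S = {z \<in> closure V. - (3 * \<epsilon> / 4) \<le> m z} \<inter> {z. snd z \<le> T}"
      by (auto simp: S_def)
    ultimately show ?thesis by (simp add: closed_Int)
  qed
  then have cS: "compact S"
    using compact_Int_closed[OF V(2), of S] by (simp add: S_def inf.absorb2 Int_absorb1 subset_eq)
  obtain r3 where r3: "r3 > 0" "(\<Union>x\<in>S. ball x r3) \<subseteq> V"
    using compact_subset_open_imp_ball_epsilon_subset[OF cS V(1) SV] by blast
  define r where "r = r3 / 3"
  have r: "r > 0" using r3 by (simp add: r_def)
  \<comment> \<open>A kernel of radius at most r centred in W is supported within 2 r < r3 of S,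
    hence in V. So the mollified equations hold pointwise on W, which still contains the support of
    the test function.\<close>
  define W where "W = (\<Union>s\<in>S. ball s r)"
  have W: "open W" "S \<subseteq> W" using r by (auto simp: W_def intro!: open_UN)
  have WV: "cball z \<delta> \<subseteq> V" if zW: "z \<in> W" "\<delta> \<le> r" for z \<delta>
  proof
    fix y assume y: "y \<in> cball z \<delta>"
    obtain s where s: "s \<in> S" "dist s z < r" using zW(1) unfolding W_def by auto
    have "dist s y < r3"
      using dist_triangle[of s y z] y s zW(2) r by (simp add: r_def)
    then show "y \<in> V" using r3(2) s(1) by (meson UN_I mem_ball subsetD)
  qed
  have WV': "W \<subseteq> V" using WV[of _ 0] r by auto
  have z0S: "z0 \<in> S" using z0 \<epsilon> closure_subset[of V] by (auto simp: S_def m_def)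
  have "uniformly_continuous_on (closure V) m" by (rule compact_uniformly_continuous[OF cm V(2)])
  then obtain du where du: "du > 0"
    "\<And>x y. x \<in> closure V \<Longrightarrow> y \<in> closure V \<Longrightarrow> dist y x < du \<Longrightarrow> dist (m y) (m x) < \<epsilon> / 8"
    using \<epsilon> unfolding uniformly_continuous_on_def by (metis divide_pos_pos zero_less_numeral)
  define \<rho> where "\<rho> = min (min r du) ((T - snd z0) / 2)"
  have \<rho>: "\<rho> > 0" using r du z0 by (simp add: \<rho>_def)
  define N where "N = ball z0 \<rho>"
  have NW: "N \<subseteq> W" using z0S by (auto simp: N_def W_def \<rho>_def)
  \<comment> \<open>Lower bound on N for \<open>P z ^ 3 * (2 * \<tau> z)\<close>, from P \<ge>
    \<epsilon>/8 and 2 \<tau> \<ge> T - snd z0.\<close>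
  define c1 where "c1 = (\<epsilon> / 8) ^ 3 * (T - snd z0)"
  have c1: "c1 > 0" using \<epsilon> z0 by (simp add: c1_def)
  have Npos: "measure lborel N > 0" using \<rho> content_ball_pos[of \<rho> z0] by (simp add: N_def)
  have N: "m z \<ge> - (\<epsilon> / 8)" "T - snd z \<ge> (T - snd z0) / 2" if "z \<in> N" for z
  proof -
    have "z \<in> closure V" "z0 \<in> closure V" using that NW WV' z0 closure_subset by blast+
    moreover have "dist z z0 < du" using that by (simp add: N_def \<rho>_def dist_commute)
    ultimately have "dist (m z) (m z0) < \<epsilon> / 8" using du by blast
    moreover have "m z0 \<ge> 0" using z0 by (simp add: m_def)
    ultimately show "m z \<ge> - (\<epsilon> / 8)" unfolding dist_real_def by linarith
    have "\<bar>snd z0 - snd z\<bar> \<le> dist z0 z" using dist_snd_le[of z0 z] by (simp add: dist_real_def)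
    moreover have "dist z0 z < (T - snd z0) / 2" using that by (simp add: N_def \<rho>_def)
    ultimately show "T - snd z \<ge> (T - snd z0) / 2" by (simp add: abs_le_iff field_simps)
  qed
  \<comment> \<open>Upper bound for the factor \<open>6 * P z * \<tau> z ^ 2\<close> of the flux
    term, from P \<le> Cm + \<epsilon> and \<tau> \<le> |T| + R.\<close>
  define K where "K = 6 * (Cm + \<epsilon>) * (\<bar>T\<bar> + R)\<^sup>2"
  have K: "K \<ge> 0" using Cm(2) \<epsilon> by (simp add: K_def)
  \<comment> \<open>Small enough that the mollification errors of all components, weighted by K,
    stay below the gain c1 times the measure of N.\<close>
  define \<eta> where "\<eta> = c1 * measure lborel N / (K * real (card (Basis :: 'a set)) + 1) / 2"
  have \<eta>: "\<eta> > 0" "K * (real (card (Basis :: 'a set)) * \<eta>) < c1 * measure lborel N"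
  proof -
    define X where "X = K * real (card (Basis :: 'a set))"
    define Y where "Y = c1 * measure lborel N"
    have X: "X \<ge> 0" and Y: "Y > 0" using K c1 Npos by (auto simp: X_def Y_def)
    have e: "\<eta> = Y / (X + 1) / 2" by (simp add: \<eta>_def X_def Y_def)
    show "\<eta> > 0" using X Y by (simp add: e)
    have "X * \<eta> = (X / (X + 1)) * (Y / 2)" by (simp add: e)
    also have "\<dots> \<le> 1 * (Y / 2)" using X Y by (intro mult_right_mono) auto
    also have "\<dots> < Y" using Y by simp
    finally show "K * (real (card (Basis :: 'a set)) * \<eta>) < c1 * measure lborel N"
      by (simp add: X_def Y_def mult.assoc)
  qed
  have "\<forall>e\<in>Basis. \<exists>\<delta>0>0. \<forall>\<delta> k. mollifier \<delta> k \<longrightarrow> \<delta> \<le> \<delta>0 \<longrightarrow>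
    (\<integral>\<^sup>+z. ennreal \<bar>conv k (B e) z * conv k (d e) z - B e z * d e z\<bar> \<partial>lborel) \<le> ennreal \<eta>"
  proof
    fix e :: 'a assume e: "e \<in> Basis"
    show "\<exists>\<delta>0>0. \<forall>\<delta> k. mollifier \<delta> k \<longrightarrow> \<delta> \<le> \<delta>0 \<longrightarrow>
    (\<integral>\<^sup>+z. ennreal \<bar>conv k (B e) z * conv k (d e) z - B e z * d e z\<bar> \<partial>lborel) \<le> ennreal \<eta>"
      by (rule mollified_product_L1[OF q(1) p q(2) _ _ zero fin[OF e] \<eta>(1)]) auto
  qed
  from bchoice[OF this] obtain dl where dl0: "\<forall>e\<in>Basis. 0 < dl e \<and> (\<forall>\<delta> k. mollifier \<delta> k \<longrightarrow> \<delta> \<le> dl e \<longrightarrow>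
    (\<integral>\<^sup>+z. ennreal \<bar>conv k (B e) z * conv k (d e) z - B e z * d e z\<bar> \<partial>lborel) \<le> ennreal \<eta>)"
    by (rule exE)
  then have dl: "\<And>e. e \<in> Basis \<Longrightarrow> dl e > 0"
    "\<And>e \<delta> k. e \<in> Basis \<Longrightarrow> mollifier \<delta> k \<Longrightarrow> \<delta> \<le> dl e \<Longrightarrow>
    (\<integral>\<^sup>+z. ennreal \<bar>conv k (B e) z * conv k (d e) z - B e z * d e z\<bar> \<partial>lborel) \<le> ennreal \<eta>"
    by simp_all
  have "\<exists>dm>0. \<forall>e\<in>(Basis :: 'a set). dm \<le> dl e"
    by (rule finite_common_lower_bound[of "Basis :: 'a set" dl]) (simp, rule dl(1), assumption, blast)
  then obtain dm where dm: "dm > 0" "\<And>e::'a. e \<in> Basis \<Longrightarrow> dm \<le> dl e" by blast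
  define \<delta> where "\<delta> = min dm (min r du)"
  have \<delta>: "\<delta> > 0" "\<delta> \<le> dm" "\<delta> \<le> r" "\<delta> \<le> du" using dm r du by (auto simp: \<delta>_def)
  obtain k :: "'a \<times> real \<Rightarrow> real" where k: "mollifier \<delta> k" using mollifier_exists[OF \<delta>(1)] by blast
  note ck = mollifier_continuous_on[OF k]
  obtain Ck where Ck: "\<And>z. \<bar>k z\<bar> \<le> Ck" using mollifier_bounded[OF k] by blast
  define k' where "k' v z = frechet_derivative k (at z) v" for v z
  have ck': "continuous_on UNIV (k' v)" for v
    using mollifier_derivative_bounded(1)[OF k] by (simp add: k'_def[abs_def])
  have "\<exists>C. \<forall>z. \<bar>k' v z\<bar> \<le> C" for v
    using mollifier_derivative_bounded(2)[OF k] by (simp add: k'_def[abs_def])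
  then obtain Ck' where Ck': "\<And>v z. \<bar>k' v z\<bar> \<le> Ck' v" by metis
  have Dconv: "((\<lambda>s. conv k f (z + s *\<^sub>R v)) has_real_derivative conv (k' v) f z) (at 0)"
    if "integrable lborel f" for f z v
    by (rule conv_directional_derivative[OF _ ck Ck ck' Ck' that])
       (use mollifier_directional_derivative[OF k] in \<open>simp add: k'_def\<close>)
  define M where "M = conv k mt"
  define P where "P z = max 0 (M z - \<kappa>)" for z
  define \<tau> where "\<tau> z = max 0 (T - snd z)" for z :: "'a \<times> real"
  have Mclose: "\<bar>M z - m z\<bar> \<le> \<epsilon> / 8" if "z \<in> W" for z
  proof -
    have zV: "z \<in> V" using that WV' by blast
    have "\<bar>conv k mt z - mt z\<bar> \<le> \<epsilon> / 8"
    proof (rule conv_close[OF ck _ _ mollifier_integrable[OF k] _ imt _ Ck])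
      fix \<zeta> assume \<zeta>: "norm (z - \<zeta>) < \<delta>"
      then have "\<zeta> \<in> cball z \<delta>" by (simp add: dist_norm)
      then have "\<zeta> \<in> V" using WV[OF that \<delta>(3)] by blast
      moreover have "dist \<zeta> z < du" using \<zeta> \<delta>(4) by (simp add: dist_norm norm_minus_commute)
      ultimately show "\<bar>mt \<zeta> - mt z\<bar> \<le> \<epsilon> / 8"
        using du(2)[of z \<zeta>] zV closure_subset by (force simp: mt dist_real_def)
    qed (use k in \<open>auto simp: mollifier_def\<close>)
    then show ?thesis using mt[OF zV] by (simp add: M_def)
  qed
  have Mle: "M z \<le> m z + \<epsilon> / 8" "m z - \<epsilon> / 8 \<le> M z" if "z \<in> W" for z
    using Mclose[OF that] unfolding abs_le_iff by linarith+
  have cM: "continuous_on UNIV M" unfolding M_def by (rule continuous_on_conv[OF ck Ck imt])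
  have cP: "continuous_on UNIV P" unfolding P_def by (intro continuous_intros cM)
  have c\<tau>: "continuous_on UNIV \<tau>" unfolding \<tau>_def by (intro continuous_intros)
  have cB: "continuous_on UNIV (conv k (B e))" "continuous_on UNIV (conv (k' v) (B e))"
    "continuous_on UNIV (conv (k' v) mt)" for e v
    by (rule continuous_on_conv[OF ck Ck iB] continuous_on_conv[OF ck' Ck' iB]
          continuous_on_conv[OF ck' Ck' imt])+
  have zeroW: "P z = 0 \<or> \<tau> z = 0" if "z \<in> W" "z \<notin> S" for z
  proof -
    have "z \<in> closure V" using that WV' closure_subset by blast
    then have "m z < - (3 * \<epsilon> / 4) \<or> T < snd z" using that(2) by (auto simp: S_def)
    then show ?thesis using Mclose[OF that(1)] \<epsilon> by (auto simp: P_def \<tau>_def \<kappa>_def max_def)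
  qed
  \<comment> \<open>\<open>F1'\<close> is the time derivative of F1, and the \<open>F2' e\<close>
    sum to a spatial divergence, so both have integral 0 over W. In their difference
    \<open>I\<close> the mollified equation cancels the two terms with 3 P^2 \<tau>^2; what remains
    is 2 \<tau> P^3 plus 6 P \<tau>^2 times mollified flux dot mollified gradient.\<close>
  define F1 where "F1 z = P z ^ 3 * \<tau> z ^ 2" for z
  define F1' where "F1' z = 3 * P z ^ 2 * conv (k' (0, 1)) mt z * \<tau> z ^ 2 - P z ^ 3 * (2 * \<tau> z)" for z
  define F2 where "F2 e z = conv k (B e) z * (3 * P z ^ 2 * \<tau> z ^ 2)" for e z
  define F2' where "F2' e z = conv (k' (e, 0)) (B e) z * (3 * P z ^ 2 * \<tau> z ^ 2)
     + conv k (B e) z * (6 * P z * conv (k' (e, 0)) mt z * \<tau> z ^ 2)" for e z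
  have DM: "((\<lambda>s. M (z + s *\<^sub>R v) - \<kappa>) has_real_derivative conv (k' v) mt z) (at 0)" for z v
    using DERIV_diff[OF Dconv[OF imt, of z v] DERIV_const[of \<kappa>]] by (simp add: M_def)
  have DP3: "((\<lambda>s. P (z + s *\<^sub>R v) ^ 3) has_real_derivative 3 * P z ^ 2 * conv (k' v) mt z) (at 0)" for z v
    using DERIV_chain2[OF DERIV_pos_part_power[of 1] DM[of z v]]
    by (simp add: P_def numeral_2_eq_2 numeral_3_eq_3)
  have DP2: "((\<lambda>s. P (z + s *\<^sub>R v) ^ 2) has_real_derivative 2 * P z * conv (k' v) mt z) (at 0)" for z v
    using DERIV_chain2[OF DERIV_pos_part_power[of 0] DM[of z v]]
    by (simp add: P_def numeral_2_eq_2)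
  have D\<tau>: "((\<lambda>s. \<tau> (z + s *\<^sub>R (0, 1)) ^ 2) has_real_derivative - (2 * \<tau> z)) (at 0)" for z
  proof -
    have "((\<lambda>s. T - (snd z + s)) has_real_derivative - 1) (at 0)"
      by (auto intro!: derivative_eq_intros)
    from DERIV_chain2[OF DERIV_pos_part_power[of 0] this]
    show ?thesis by (simp add: \<tau>_def numeral_2_eq_2)
  qed
  have zz: "w + (0, 0) = w" for w :: "'a \<times> real" by (simp add: zero_prod_def[symmetric])
  have \<tau>x: "\<tau> (z + s *\<^sub>R (e, 0)) = \<tau> z" for z s e by (simp add: \<tau>_def)
  have D1: "((\<lambda>s. F1 (z + s *\<^sub>R (0, 1))) has_real_derivative F1' z) (at 0)" for z
    using DERIV_mult[OF DP3[of z "(0, 1)"] D\<tau>[of z]]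
    by (simp add: F1_def F1'_def zz algebra_simps)
  have D2: "((\<lambda>s. F2 e (z + s *\<^sub>R (e, 0))) has_real_derivative F2' e z) (at 0)" for e z
    using DERIV_mult[OF Dconv[OF iB, of e z "(e, 0)"] DERIV_cmult[OF DP2[of z "(e, 0)"], of "3 * \<tau> z ^ 2"]]
    unfolding F2_def F2'_def \<tau>x by (simp add: zz algebra_simps)
  have cF: "continuous_on UNIV F1" "continuous_on UNIV F1'"
     "continuous_on UNIV (F2 e)" "continuous_on UNIV (F2' e)" for e
    unfolding F1_def F1'_def F2_def F2'_def
    by (intro continuous_intros cP c\<tau> cB)+
  have cW: "continuous_on W f" if "continuous_on UNIV f" for f :: "'a \<times> real \<Rightarrow> real"
    using that continuous_on_subset by blast
  have I1: "set_integrable lborel W F1'" "(LINT z:W|lborel. F1' z) = 0"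
    by (rule set_integral_directional_derivative_eq_0[OF W(1) cS W(2) D1 cW cW];
        use cF zeroW in \<open>force simp: F1_def\<close>)+
  have I2: "set_integrable lborel W (F2' e)" "(LINT z:W|lborel. F2' e z) = 0" for e
    by (rule set_integral_directional_derivative_eq_0[OF W(1) cS W(2) D2 cW cW];
        use cF zeroW in \<open>force simp: F2_def\<close>)+
  define I where "I z = (\<Sum>e\<in>Basis. F2' e z) - F1' z" for z
  have iI: "integrable lborel (\<lambda>z. indicator W z * I z)"
    and I0: "(LINT z|lborel. indicator W z * I z) = 0"
  proof -
    have a: "integrable lborel (\<lambda>z. indicator W z * F1' z)" "(LINT z|lborel. indicator W z * F1' z) = 0"
      "\<And>e. integrable lborel (\<lambda>z. indicator W z * F2' e z)" "\<And>e. (LINT z|lborel. indicator W z * F2' e z) = 0"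
      using I1 I2 by (simp_all add: set_integrable_def set_lebesgue_integral_def)
    have e: "(\<lambda>z. indicator W z * I z) = (\<lambda>z. (\<Sum>e\<in>Basis. indicator W z * F2' e z) - indicator W z * F1' z)"
      by (simp add: I_def right_diff_distrib sum_distrib_left)
    have s: "integrable lborel (\<lambda>z. \<Sum>e\<in>Basis. indicator W z * F2' e z)"
      by (intro Bochner_Integration.integrable_sum a(3))
    have s0: "(LINT z|lborel. (\<Sum>e\<in>Basis. indicator W z * F2' e z)) = 0"
      unfolding Bochner_Integration.integral_sum[OF a(3)] a(4) by simp
    show "integrable lborel (\<lambda>z. indicator W z * I z)"
      unfolding e by (rule Bochner_Integration.integrable_diff[OF s a(1)])
    show "(LINT z|lborel. indicator W z * I z) = 0"
      unfolding e Bochner_Integration.integral_diff[OF s a(1)] s0 a(2) by simp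
  qed
  have id1: "conv (k' (e, 0)) mt z = conv k (d e) z" if "z \<in> W" "e \<in> Basis" for z e
    using weak_solution_conv(1)[OF p Vm bV sol(1) ih(1) k WV[OF that(1) \<delta>(3)] that(2)]
      weak_solution_conv(1)[OF p Vm bV sol(2) ih(2) k WV[OF that(1) \<delta>(3)] that(2)]
      conv_diff[OF ck' Ck' ih'(1,2), of "(e, 0)" z] conv_diff[OF ck Ck ig(1)[of e] ig(2)[of e], of z]
    unfolding mt_def[abs_def] d_def[abs_def] k'_def[abs_def] by simp
  have cd: "conv (k' v) (B e) z = conv (k' v) (\<lambda>z. indicator V z * (A (g1 z) \<bullet> e)) z
      - conv (k' v) (\<lambda>z. indicator V z * (A (g2 z) \<bullet> e)) z" for v e z
    unfolding B_def[abs_def] by (rule conv_diff[OF ck' Ck' iA(1) iA(2)])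
  have id2: "conv (k' (0, 1)) mt z = (\<Sum>e\<in>Basis. conv (k' (e, 0)) (B e) z)" if "z \<in> W" for z
    using weak_solution_conv(2)[OF p Vm bV sol(1) ih(1) k WV[OF that(1) \<delta>(3)]]
      weak_solution_conv(2)[OF p Vm bV sol(2) ih(2) k WV[OF that(1) \<delta>(3)]]
      conv_diff[OF ck' Ck' ih'(1,2), of "(0, 1)" z]
    unfolding cd unfolding mt_def[abs_def] k'_def[abs_def] A_def
    by (simp only: sum_subtractf)
  \<comment> \<open>Monotonicity gives a sign to the sum of \<open>B e z * d e z\<close>, but not to
    that of the mollified factors; E is the price of exchanging the two.\<close>
  define E where "E e z = \<bar>conv k (B e) z * conv k (d e) z - B e z * d e z\<bar>" for e z
  have [measurable]: "k \<in> borel_measurable borel" using ck by (rule borel_measurable_continuous_onI)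
  have Em [measurable]: "E e \<in> borel_measurable borel" for e
  proof -
    have "conv k (B e) \<in> borel_measurable borel" "conv k (d e) \<in> borel_measurable borel"
      using continuous_on_conv[OF ck Ck iB] continuous_on_conv[OF ck Ck id]
      by (auto intro: borel_measurable_continuous_onI)
    then show ?thesis unfolding E_def[abs_def] by measurable
  qed
  have En: "(\<integral>\<^sup>+z. ennreal (E e z) \<partial>lborel) \<le> ennreal \<eta>" if "e \<in> Basis" for e
    using dl(2)[OF that k] dm(2)[OF that] \<delta>(2) by (simp add: E_def)
  have iE: "integrable lborel (E e)" and E\<eta>: "(LINT z|lborel. E e z) \<le> \<eta>" if "e \<in> Basis" for e
  proof -
    have nn: "E e z \<ge> 0" for z by (simp add: E_def)
    have "(\<integral>\<^sup>+z. ennreal (norm (E e z)) \<partial>lborel) < \<infinity>"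
      using le_less_trans[OF En[OF that], of \<infinity>] nn by simp
    then show i: "integrable lborel (E e)" by (intro integrableI_bounded) auto
    have "ennreal (LINT z|lborel. E e z) \<le> ennreal \<eta>"
      using En[OF that] nn_integral_eq_integral[OF i] nn by simp
    then show "(LINT z|lborel. E e z) \<le> \<eta>" using \<eta> by (simp add: ennreal_le_iff)
  qed
  have lower: "c1 * indicator N z - K * (\<Sum>e\<in>Basis. E e z) \<le> indicator W z * I z" for z
  proof (cases "z \<in> W")
    case False
    then have "z \<notin> N" using NW by blast
    moreover have "0 \<le> K * (\<Sum>e\<in>Basis. E e z)" using K by (simp add: E_def sum_nonneg)
    ultimately show ?thesis using False by simp
  next
    case True
    have P0: "P z \<ge> 0" "\<tau> z \<ge> 0" by (auto simp: P_def \<tau>_def)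
    have zc: "z \<in> closure V" using True WV' closure_subset by blast
    have PK: "6 * P z * \<tau> z ^ 2 \<le> K"
    proof -
      have "P z \<le> Cm + \<epsilon>" unfolding P_def
        using Mle(1)[OF True] abs_le_D1[OF Cm(1)[OF zc]] Cm(2) \<epsilon>
        by (intro max.boundedI) (simp_all add: \<kappa>_def)
      moreover have "\<tau> z \<le> \<bar>T\<bar> + R"
        using R(1)[OF zc] R(2) norm_snd_le[of "snd z" "fst z"] unfolding \<tau>_def
        by (intro max.boundedI) auto
      ultimately show ?thesis unfolding K_def using P0 Cm(2) \<epsilon>
        by (intro mult_mono power_mono) auto
    qed
    have Ieq: "I z = P z ^ 3 * (2 * \<tau> z) + 6 * P z * \<tau> z ^ 2 * (\<Sum>e\<in>Basis. conv k (B e) z * conv k (d e) z)"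
    proof -
      have "(\<Sum>e\<in>Basis. F2' e z) = (\<Sum>e\<in>Basis. conv (k' (e, 0)) (B e) z * (3 * P z ^ 2 * \<tau> z ^ 2)
         + 6 * P z * \<tau> z ^ 2 * (conv k (B e) z * conv k (d e) z))"
        by (intro sum.cong) (auto simp: F2'_def id1[OF True] algebra_simps)
      also have "\<dots> = (\<Sum>e\<in>Basis. conv (k' (e, 0)) (B e) z) * (3 * P z ^ 2 * \<tau> z ^ 2)
         + 6 * P z * \<tau> z ^ 2 * (\<Sum>e\<in>Basis. conv k (B e) z * conv k (d e) z)"
        by (simp add: sum.distrib sum_distrib_left sum_distrib_right)
      finally show ?thesis using id2[OF True] by (simp add: I_def F1'_def algebra_simps)
    qed
    have "- (\<Sum>e\<in>Basis. E e z) \<le> (\<Sum>e\<in>Basis. conv k (B e) z * conv k (d e) z)"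
    proof -
      have "(\<Sum>e\<in>Basis. B e z * d e z - E e z) \<le> (\<Sum>e\<in>Basis. conv k (B e) z * conv k (d e) z)"
        by (intro sum_mono) (simp add: E_def abs_le_iff)
      then show ?thesis using mono[of z] by (simp add: sum_subtractf)
    qed
    then have "6 * P z * \<tau> z ^ 2 * - (\<Sum>e\<in>Basis. E e z)
        \<le> 6 * P z * \<tau> z ^ 2 * (\<Sum>e\<in>Basis. conv k (B e) z * conv k (d e) z)"
      using P0 by (intro mult_left_mono) auto
    moreover have "6 * P z * \<tau> z ^ 2 * (\<Sum>e\<in>Basis. E e z) \<le> K * (\<Sum>e\<in>Basis. E e z)"
      using PK by (intro mult_right_mono) (auto simp: E_def sum_nonneg)
    moreover have "c1 * indicator N z \<le> P z ^ 3 * (2 * \<tau> z)"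
    proof (cases "z \<in> N")
      case True
      have "P z \<ge> \<epsilon> / 8" unfolding P_def
        using Mle(2)[OF \<open>z \<in> W\<close>] N(1)[OF True] \<epsilon> by (intro max.coboundedI2) (simp add: \<kappa>_def)
      then have "(\<epsilon> / 8) ^ 3 \<le> P z ^ 3" using \<epsilon> by (intro power_mono) auto
      moreover have "T - snd z0 \<le> 2 * \<tau> z" 
      proof -
        have "T - snd z \<le> \<tau> z" by (simp add: \<tau>_def)
        moreover have "T - snd z0 \<le> 2 * (T - snd z)" using N(2)[OF True] by (simp add: field_simps)
        ultimately show ?thesis by simp
      qed
      ultimately have "c1 \<le> P z ^ 3 * (2 * \<tau> z)"
        unfolding c1_def using z0 P0 \<epsilon> by (intro mult_mono) auto
      then show ?thesis using True by simp
    qed (use P0 in simp)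
    ultimately have "c1 * indicator N z - K * (\<Sum>e\<in>Basis. E e z) \<le> I z"
      unfolding Ieq mult_minus_right by linarith
    then show ?thesis using True by simp
  qed
  have iN: "integrable lborel (indicator N :: 'a \<times> real \<Rightarrow> real)"
    using emeasure_bounded_finite[of N] by (intro integrable_real_indicator) (auto simp: N_def)
  have iEs: "integrable lborel (\<lambda>z. K * (\<Sum>e\<in>Basis. E e z))"
    by (intro integrable_mult_right Bochner_Integration.integrable_sum iE)
  have "c1 * measure lborel N - K * (\<Sum>e\<in>Basis. (LINT z|lborel. E e z))
     = (LINT z|lborel. c1 * indicator N z - K * (\<Sum>e\<in>Basis. E e z))"
    using iN iEs iE by (simp add: Bochner_Integration.integral_diff Bochner_Integration.integral_sum)
  also have "\<dots> \<le> (LINT z|lborel. indicator W z * I z)"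
    by (intro integral_mono lower iI Bochner_Integration.integrable_diff iEs integrable_mult_right iN)
  also have "\<dots> = 0" by (rule I0)
  finally have "c1 * measure lborel N \<le> K * (\<Sum>e\<in>Basis. (LINT z|lborel. E e z))" by simp
  also have "(\<Sum>e\<in>Basis. (LINT z|lborel. E e z)) \<le> (\<Sum>e\<in>(Basis::'a set). \<eta>)"
    by (intro sum_mono E\<eta>)
  then have "K * (\<Sum>e\<in>Basis. (LINT z|lborel. E e z)) \<le> K * (real (card (Basis :: 'a set)) * \<eta>)"
    using K by (intro mult_left_mono) auto
  finally show False using \<eta>(2) by simp
qed

section \<open>Exact solutions\<close>

lemma p_parabolic_subset:
  assumes h: "p_parabolic p D h" and sub: "D' \<subseteq> D"
  shows "p_parabolic p D' h"
  unfolding p_parabolic_def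
proof (intro conjI allI impI)
  show "continuous_on D' h" by (rule continuous_on_subset[OF conjunct1[OF h[unfolded p_parabolic_def]] sub])
  fix U :: "(real^'a) set" and t1 t2 assume U: "open U \<and> t1 < t2 \<and> compactly_inside (cylinder U t1 t2) D'"
  then have U': "open U \<and> t1 < t2 \<and> compactly_inside (cylinder U t1 t2) D"
    using sub by (auto simp: compactly_inside_def)
  note * = mp[OF spec[OF spec[OF spec[OF conjunct2[OF h[unfolded p_parabolic_def]], of U], of t1], of t2] U']
  show "continuous_on {t1..t2} (\<lambda>t. LINT x:U|lborel. \<bar>h (x, t)\<bar>\<^sup>2)" by (rule conjunct1[OF *])
  show "\<exists>g. LpW1p_with_gradient p U t1 t2 h g \<and>
          (\<forall>\<phi>. test_function (cylinder U t1 t2) \<phi> \<longrightarrow>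
             (LINT t:{t1<..<t2}|lborel. LINT x:U|lborel.
                (norm (g (x, t)) powr (p - 2) *\<^sub>R g (x, t)) \<bullet> space_gradient \<phi> (x, t))
           - (LINT t:{t1<..<t2}|lborel. LINT x:U|lborel. h (x, t) * time_derivative \<phi> (x, t))
           = 0)" by (rule conjunct2[OF *])
qed

text \<open>Differentiability is demanded of the flux rather than of the gradient \<open>G\<close>.
  The power |x - y|^(p/(p-1)) has a linear flux, although for p > 2 it is not twice differentiable
  at y.\<close>

definition exact_solution ::
    "real \<Rightarrow> 'a::euclidean_space set \<Rightarrow> ('a \<times> real \<Rightarrow> real) \<Rightarrow> bool" where
  "exact_solution p X h \<longleftrightarrow> (\<exists>\<eta> c G F'.
     (\<forall>z. h z = \<eta> (fst z) + c * snd z) \<and>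
     (\<forall>x\<in>X. (\<eta> has_derivative (\<lambda>v. G x \<bullet> v)) (at x)) \<and> continuous_on X G \<and>
     (\<forall>x\<in>X. ((\<lambda>x. norm (G x) powr (p - 2) *\<^sub>R G x) has_derivative F' x) (at x)) \<and>
     (\<forall>v. continuous_on X (\<lambda>x. F' x v)) \<and>
     (\<forall>x\<in>X. (\<Sum>e\<in>Basis. F' x e \<bullet> e) = c))"

lemma exact_solution_uminus:
  assumes "exact_solution p X h" shows "exact_solution p X (\<lambda>z. - h z)"
proof -
  obtain \<eta> c G F' where *: "\<And>z. h z = \<eta> (fst z) + c * snd z"
     "\<And>x. x \<in> X \<Longrightarrow> (\<eta> has_derivative (\<lambda>v. G x \<bullet> v)) (at x)" "continuous_on X G"
     "\<And>x. x \<in> X \<Longrightarrow> ((\<lambda>x. norm (G x) powr (p - 2) *\<^sub>R G x) has_derivative F' x) (at x)"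
     "\<And>v. continuous_on X (\<lambda>x. F' x v)"
     "\<And>x. x \<in> X \<Longrightarrow> (\<Sum>e\<in>Basis. F' x e \<bullet> e) = c"
    using assms unfolding exact_solution_def by blast
  have D: "((\<lambda>x. - \<eta> x) has_derivative (\<lambda>v. (- G x) \<bullet> v)) (at x)" if "x \<in> X" for x
    using has_derivative_minus[OF *(2)[OF that]] by simp
  show ?thesis unfolding exact_solution_def
  proof (rule exI[of _ "\<lambda>x. - \<eta> x"], rule exI[of _ "- c"], rule exI[of _ "\<lambda>x. - G x"],
      rule exI[of _ "\<lambda>x v. - F' x v"], intro conjI allI ballI D)
    show "- h z = - \<eta> (fst z) + (- c) * snd z" for z by (simp add: *(1))
    show "continuous_on X (\<lambda>x. - G x)" by (intro continuous_intros *(3))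
    show "((\<lambda>x. norm (- G x) powr (p - 2) *\<^sub>R - G x) has_derivative (\<lambda>v. - F' x v)) (at x)"
      if "x \<in> X" for x
      using has_derivative_minus[OF *(4)[OF that]] by simp
    show "continuous_on X (\<lambda>x. - F' x v)" for v by (intro continuous_intros *(5))
    show "(\<Sum>e\<in>Basis. - F' x e \<bullet> e) = - c" if "x \<in> X" for x
      using *(6)[OF that] by (simp add: sum_negf)
  qed
qed

lemma exact_solution_add_const:
  assumes "exact_solution p X h" shows "exact_solution p X (\<lambda>z. h z + k)"
proof -
  obtain \<eta> c G F' where *: "\<And>z. h z = \<eta> (fst z) + c * snd z"
     "\<And>x. x \<in> X \<Longrightarrow> (\<eta> has_derivative (\<lambda>v. G x \<bullet> v)) (at x)" "continuous_on X G"
     "\<And>x. x \<in> X \<Longrightarrow> ((\<lambda>x. norm (G x) powr (p - 2) *\<^sub>R G x) has_derivative F' x) (at x)"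
     "\<And>v. continuous_on X (\<lambda>x. F' x v)"
     "\<And>x. x \<in> X \<Longrightarrow> (\<Sum>e\<in>Basis. F' x e \<bullet> e) = c"
    using assms unfolding exact_solution_def by blast
  have "((\<lambda>x. \<eta> x + k) has_derivative (\<lambda>v. G x \<bullet> v)) (at x)" if "x \<in> X" for x
    using has_derivative_add[OF *(2)[OF that] has_derivative_const[of k]] by simp
  then show ?thesis unfolding exact_solution_def
    by (intro exI[of _ "\<lambda>x. \<eta> x + k"] exI[of _ c] exI[of _ G] exI[of _ F']) (auto simp: *)
qed

section \<open>Classical solutions satisfy the weak formulation\<close>

lemma has_derivative_along:
  fixes f :: "'a::real_normed_vector \<Rightarrow> real"
  assumes "(f has_derivative f') (at z)"
  shows "((\<lambda>s. f (z + s *\<^sub>R v)) has_real_derivative f' v) (at 0)"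
proof -
  have f: "(f has_derivative f') (at (z + 0 *\<^sub>R v))" using assms by simp
  have "((\<lambda>s. z + s *\<^sub>R v) has_derivative (\<lambda>s. s *\<^sub>R v)) (at 0)"
    by (auto intro!: derivative_eq_intros)
  from has_derivative_compose[OF this f]
  have "((\<lambda>s. f (z + s *\<^sub>R v)) has_derivative (\<lambda>s. f' (s *\<^sub>R v))) (at 0)" .
  moreover have "f' (s *\<^sub>R v) = f' v * s" for s
    using linear_scale[OF has_derivative_linear[OF assms], of s v] by simp
  ultimately show ?thesis by (simp add: has_field_derivative_def)
qed

lemma set_integrable_compact_support:
  fixes f :: "'a::euclidean_space \<Rightarrow> real"
  assumes "continuous_on W f" "compact S" "S \<subseteq> W" "\<And>z. z \<in> W \<Longrightarrow> z \<notin> S \<Longrightarrow> f z = 0"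
  shows "set_integrable lborel W f"
proof -
  have "integrable lborel (\<lambda>z. indicator S z *\<^sub>R f z)"
    by (intro borel_integrable_compact assms continuous_on_subset[OF assms(1,3)])
  also have "(\<lambda>z. indicator S z *\<^sub>R f z) = (\<lambda>z. indicator W z *\<^sub>R f z)"
  proof
    fix z show "indicator S z *\<^sub>R f z = indicator W z *\<^sub>R f z"
      using assms(3,4) by (cases "z \<in> S"; cases "z \<in> W") auto
  qed
  finally show ?thesis by (simp add: set_integrable_def)
qed

lemma integration_by_parts_test_function:
  fixes f \<phi> :: "'a::euclidean_space \<Rightarrow> real"
  assumes W: "open W" and \<phi>: "test_function W \<phi>"
    and D: "\<And>z. z \<in> W \<Longrightarrow> ((\<lambda>s. f (z + s *\<^sub>R v)) has_real_derivative f' z) (at 0)"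
    and cont: "continuous_on W f" "continuous_on W f'"
  shows "set_integrable lborel W (\<lambda>z. f z * frechet_derivative \<phi> (at z) v)"
    "set_integrable lborel W (\<lambda>z. f' z * \<phi> z)"
    "(LINT z:W|lborel. f z * frechet_derivative \<phi> (at z) v) = - (LINT z:W|lborel. f' z * \<phi> z)"
proof -
  let ?S = "closure {z. \<phi> z \<noteq> 0}"
  have S: "compact ?S" "?S \<subseteq> W" using \<phi> by (auto simp: test_function_def)
  note c\<phi> = continuous_on_subset[OF test_function_continuous_on(1)[OF \<phi>] subset_UNIV[of W]]
    continuous_on_subset[OF test_function_continuous_on(2)[OF \<phi>] subset_UNIV[of W]]
  show 1: "set_integrable lborel W (\<lambda>z. f z * frechet_derivative \<phi> (at z) v)"
    by (rule set_integrable_compact_support[OF continuous_on_mult[OF cont(1) c\<phi>(2)] S])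
       (simp add: frechet_derivative_eq_0_outside)
  have \<phi>0: "g z * \<phi> z = 0" if "z \<notin> ?S" for g :: "'a \<Rightarrow> real" and z
    unfolding test_function_eq_0_outside[OF that] by simp
  show 2: "set_integrable lborel W (\<lambda>z. f' z * \<phi> z)"
    by (rule set_integrable_compact_support[OF continuous_on_mult[OF cont(2) c\<phi>(1)] S])
       (rule \<phi>0)
  have D\<phi>: "((\<lambda>s. \<phi> (z + s *\<^sub>R v)) has_real_derivative frechet_derivative \<phi> (at z) v) (at 0)" for z
    by (rule has_derivative_along[OF test_function_has_derivative[OF \<phi>]])
  have DF: "((\<lambda>s. f (z + s *\<^sub>R v) * \<phi> (z + s *\<^sub>R v)) has_real_derivative
        f z * frechet_derivative \<phi> (at z) v + f' z * \<phi> z) (at 0)" if "z \<in> W" for z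
    using DERIV_mult[OF D[OF that] D\<phi>] by (simp add: algebra_simps)
  have cF: "continuous_on W (\<lambda>z. f z * \<phi> z)"
    by (rule continuous_on_mult[OF cont(1) c\<phi>(1)])
  have cF': "continuous_on W (\<lambda>z. f z * frechet_derivative \<phi> (at z) v + f' z * \<phi> z)"
    by (rule continuous_on_add[OF continuous_on_mult[OF cont(1) c\<phi>(2)] continuous_on_mult[OF cont(2) c\<phi>(1)]])
  have F0: "f z * \<phi> z = 0" if "z \<in> W" "z \<notin> ?S" for z
    by (rule \<phi>0[OF that(2)])
  have "(LINT z:W|lborel. f z * frechet_derivative \<phi> (at z) v + f' z * \<phi> z) = 0"
    by (rule set_integral_directional_derivative_eq_0(2)[OF W S DF cF cF' F0])
  then show "(LINT z:W|lborel. f z * frechet_derivative \<phi> (at z) v) = - (LINT z:W|lborel. f' z * \<phi> z)"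
    using set_integral_add(2)[OF 1 2] by simp
qed

lemma Lp_on_continuous_closure:
  fixes f :: "'a::euclidean_space \<Rightarrow> 'b::euclidean_space"
  assumes "p > 0" "continuous_on (closure V) f" "compact (closure V)" "V \<in> sets borel"
  shows "Lp_on p V f"
proof -
  have "set_integrable lborel V f" by (rule set_integrable_continuous_closure[OF assms(2-4)])
  then have "set_borel_measurable lborel V f"
    unfolding set_integrable_def set_borel_measurable_def by (rule borel_measurable_integrable)
  moreover have "continuous_on (closure V) (\<lambda>z. norm (f z) powr p)"
    using assms(1) by (intro continuous_on_powr' continuous_intros assms(2)) auto
  then have "set_integrable lborel V (\<lambda>z. norm (f z) powr p)"
    by (rule set_integrable_continuous_closure[OF _ assms(3,4)])
  ultimately show ?thesis by (simp add: Lp_on_def)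
qed

lemma closure_cylinder:
  fixes U :: "'a::euclidean_space set"
  shows "t1 < t2 \<Longrightarrow> closure (cylinder U t1 t2) = closure U \<times> {t1..t2}"
  by (simp add: cylinder_def closure_Times)

lemma exact_solution_p_parabolic:
  fixes h :: "(real^'n) \<times> real \<Rightarrow> real"
  assumes p: "p > 1" and X: "open X" and h: "exact_solution p X h"
  shows "p_parabolic p (X \<times> UNIV) h"
proof -
  obtain \<eta> c G F' where h: "\<And>z. h z = \<eta> (fst z) + c * snd z"
     and D\<eta>: "\<And>x. x \<in> X \<Longrightarrow> (\<eta> has_derivative (\<lambda>v. G x \<bullet> v)) (at x)" and cG: "continuous_on X G"
     and DF: "\<And>x. x \<in> X \<Longrightarrow> ((\<lambda>x. norm (G x) powr (p - 2) *\<^sub>R G x) has_derivative F' x) (at x)"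
     and cF': "\<And>v. continuous_on X (\<lambda>x. F' x v)"
     and div: "\<And>x. x \<in> X \<Longrightarrow> (\<Sum>e\<in>Basis. F' x e \<bullet> e) = c"
    using h unfolding exact_solution_def by blast
  define F where "F x = norm (G x) powr (p - 2) *\<^sub>R G x" for x
  have c\<eta>: "continuous_on X \<eta>"
    using D\<eta> has_derivative_continuous continuous_at_imp_continuous_on by blast
  have cF: "continuous_on X F"
    using DF has_derivative_continuous continuous_at_imp_continuous_on unfolding F_def[abs_def] by blast
  have fst': "continuous_on (A \<times> B) (\<lambda>z. f (fst z))" if "continuous_on A f"
    for f :: "real^'n \<Rightarrow> 'c::topological_space" and A and B :: "real set"
    by (rule continuous_on_compose2[OF that continuous_on_fst[OF continuous_on_id]]) auto
  have ch: "continuous_on (X \<times> UNIV) h"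
    unfolding h[abs_def] by (intro continuous_intros fst' c\<eta>)
  show ?thesis unfolding p_parabolic_def
  proof (intro conjI allI impI ch)
    fix U t1 t2 assume "open U \<and> t1 < t2 \<and> compactly_inside (cylinder U t1 t2) (X \<times> UNIV)"
    then have U: "open U" "t1 < t2" and cc: "compact (closure (cylinder U t1 t2))"
        "closure (cylinder U t1 t2) \<subseteq> X \<times> UNIV"
      unfolding compactly_inside_def by blast+
    note cc' = cc[unfolded closure_cylinder[OF U(2)]]
    have t1: "t1 \<in> {t1..t2}" using U(2) by simp
    have cU: "compact (closure U)"
    proof -
      have "compact (fst ` (closure U \<times> {t1..t2}))"
        by (intro compact_continuous_image continuous_intros cc'(1))
      also have "fst ` (closure U \<times> {t1..t2}) = closure U" using t1 by force
      finally show ?thesis .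
    qed
    have UX: "closure U \<subseteq> X" using cc'(2) t1 by blast
    have UX': "U \<subseteq> X" using UX closure_subset by blast
    let ?V = "cylinder U t1 t2"
    have V: "open ?V" using U by (simp add: cylinder_def open_Times)
    have clV: "closure ?V = closure U \<times> {t1..t2}" by (rule closure_cylinder[OF U(2)])
    note cV = cc(1)
    have Um: "U \<in> sets borel" and Vm: "?V \<in> sets borel" using U V by auto
    note c\<eta>U = continuous_on_subset[OF c\<eta> UX] and cGU = continuous_on_subset[OF cG UX]
    have i: "set_integrable lborel U (\<lambda>x. \<eta> x ^ 2)" "set_integrable lborel U \<eta>"
        "set_integrable lborel U (\<lambda>x. 1 :: real)"
      by (intro set_integrable_continuous_closure[OF _ cU Um] continuous_intros c\<eta>U)+
    \<comment> \<open>Continuity in t is immediate once the integral is recognised as a quadratic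
      polynomial in t.\<close>
    have "(LINT x:U|lborel. \<bar>h (x, t)\<bar>\<^sup>2) = (LINT x:U|lborel. \<eta> x ^ 2)
         + 2 * c * t * (LINT x:U|lborel. \<eta> x) + c ^ 2 * t ^ 2 * (LINT x:U|lborel. 1)" for t
    proof -
      have "(LINT x:U|lborel. \<bar>h (x, t)\<bar>\<^sup>2)
         = (LINT x:U|lborel. (\<eta> x ^ 2 + 2 * c * t * \<eta> x) + (c ^ 2 * t ^ 2) * 1)"
        by (simp add: h power2_eq_square algebra_simps)
      also have "\<dots> = (LINT x:U|lborel. \<eta> x ^ 2 + 2 * c * t * \<eta> x) + (LINT x:U|lborel. (c ^ 2 * t ^ 2) * 1)"
        by (intro set_integral_add(2) set_integral_add(1) set_integrable_mult_right i)
      also have "(LINT x:U|lborel. \<eta> x ^ 2 + 2 * c * t * \<eta> x)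
          = (LINT x:U|lborel. \<eta> x ^ 2) + (LINT x:U|lborel. 2 * c * t * \<eta> x)"
        by (intro set_integral_add(2) set_integrable_mult_right i)
      finally show ?thesis by (simp only: set_integral_mult_right)
    qed
    then show "continuous_on {t1..t2} (\<lambda>t. LINT x:U|lborel. \<bar>h (x, t)\<bar>\<^sup>2)"
      by (simp only:) (intro continuous_intros)
    let ?g = "\<lambda>z :: (real^'n) \<times> real. G (fst z)"
    have chV: "continuous_on (closure ?V) h"
      unfolding clV by (rule continuous_on_subset[OF ch]) (use UX in auto)
    have cgV: "continuous_on (closure ?V) ?g"
      unfolding clV by (rule fst'[OF cGU])
    have weak: "has_weak_gradient U (\<lambda>x. h (x, t)) (\<lambda>x. ?g (x, t))" for t
      unfolding has_weak_gradient_def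
    proof (intro allI impI ballI)
      fix \<psi> e assume \<psi>: "test_function U \<psi>" and e: "(e :: real^'n) \<in> Basis"
      show "(LINT x:U|lborel. h (x, t) * frechet_derivative \<psi> (at x) e)
         = - (LINT x:U|lborel. (?g (x, t) \<bullet> e) * \<psi> x)"
      proof (rule integration_by_parts_test_function(3)[OF U(1) \<psi>])
        fix x assume "x \<in> U"
        then have "((\<lambda>x. \<eta> x + c * t) has_derivative (\<lambda>v. G x \<bullet> v)) (at x)"
          using has_derivative_add[OF D\<eta>[of x] has_derivative_const[of "c * t"]] UX' by auto
        from has_derivative_along[OF this, of e]
        show "((\<lambda>s. h (x + s *\<^sub>R e, t)) has_real_derivative ?g (x, t) \<bullet> e) (at 0)" by (simp add: h)
      next
        show "continuous_on U (\<lambda>x. h (x, t))"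
          unfolding h by (auto intro!: continuous_intros continuous_on_subset[OF c\<eta> UX'])
        show "continuous_on U (\<lambda>x. ?g (x, t) \<bullet> e)"
          by (auto intro!: continuous_intros continuous_on_subset[OF cG UX'])
      qed
    qed
    have "W1p_with_gradient p U (\<lambda>x. h (x, t)) (\<lambda>x. ?g (x, t))" for t
      unfolding W1p_with_gradient_def
    proof (intro conjI weak)
      show "Lp_on p U (\<lambda>x. h (x, t))" unfolding h
        by (rule Lp_on_continuous_closure[OF _ _ cU Um]) (use p in \<open>auto intro!: continuous_intros c\<eta>U\<close>)
      show "Lp_on p U (\<lambda>x. ?g (x, t))"
        by (rule Lp_on_continuous_closure[OF _ _ cU Um]) (use p cGU in auto)
    qed
    moreover have "Lp_on p ?V h" "Lp_on p ?V ?g"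
      using p by (auto intro!: Lp_on_continuous_closure chV cgV cV Vm)
    ultimately have Lp: "LpW1p_with_gradient p U t1 t2 h ?g"
      by (simp add: LpW1p_with_gradient_def)
    have VX: "fst z \<in> X" if "z \<in> ?V" for z using that UX' by (auto simp: cylinder_def)
    have fV: "continuous_on ?V (\<lambda>z. f (fst z))" if "continuous_on X f"
      for f :: "real^'n \<Rightarrow> 'c::topological_space"
      unfolding cylinder_def by (intro fst' continuous_on_subset[OF that UX'])
    have eq: "(LINT t:{t1<..<t2}|lborel. LINT x:U|lborel.
                (norm (?g (x, t)) powr (p - 2) *\<^sub>R ?g (x, t)) \<bullet> space_gradient \<phi> (x, t))
           - (LINT t:{t1<..<t2}|lborel. LINT x:U|lborel. h (x, t) * time_derivative \<phi> (x, t)) = 0"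
      if \<phi>: "test_function ?V \<phi>" for \<phi>
    proof -
      have Ft: "((\<lambda>s. F (fst (z + s *\<^sub>R (e, 0))) \<bullet> e) has_real_derivative F' (fst z) e \<bullet> e) (at 0)"
        if "z \<in> ?V" for z e
        using has_derivative_along[OF has_derivative_inner_left[OF DF[OF VX[OF that]]], of e e]
        by (simp add: F_def)
      have ht: "((\<lambda>s. h (z + s *\<^sub>R (0, 1))) has_real_derivative c) (at 0)" for z
        unfolding h by (auto intro!: derivative_eq_intros)
      have ft_sp: "continuous_on ?V (\<lambda>z. F (fst z) \<bullet> e)" "continuous_on ?V (\<lambda>z. F' (fst z) e \<bullet> e)" for e
        by (intro continuous_intros fV cF cF')+
      note ibp1 = integration_by_parts_test_function[OF V \<phi> Ft ft_sp]
      have hV: "continuous_on ?V h" by (rule continuous_on_subset[OF chV closure_subset])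
      note ibp2 = integration_by_parts_test_function[OF V \<phi> ht hV continuous_on_const]
      have e1: "(\<lambda>z. (norm (?g z) powr (p - 2) *\<^sub>R ?g z) \<bullet> space_gradient \<phi> z)
         = (\<lambda>z. \<Sum>e\<in>Basis. (F (fst z) \<bullet> e) * frechet_derivative \<phi> (at z) (e, 0))"
        unfolding inner_space_gradient F_def ..
      have i1: "set_integrable lborel ?V (\<lambda>z. (norm (?g z) powr (p - 2) *\<^sub>R ?g z) \<bullet> space_gradient \<phi> z)"
        using ibp1(1) unfolding e1 set_integrable_def scaleR_sum_right
        by (intro Bochner_Integration.integrable_sum)
      have i2: "set_integrable lborel ?V (\<lambda>z. h z * time_derivative \<phi> z)"
        using ibp2(1) unfolding time_derivative_def .
      have "(LINT z:?V|lborel. (norm (?g z) powr (p - 2) *\<^sub>R ?g z) \<bullet> space_gradient \<phi> z)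
         = (\<Sum>e\<in>Basis. (LINT z:?V|lborel. (F (fst z) \<bullet> e) * frechet_derivative \<phi> (at z) (e, 0)))"
        using ibp1(1) unfolding e1 set_integrable_def set_lebesgue_integral_def scaleR_sum_right
        by (intro Bochner_Integration.integral_sum)
      also have "\<dots> = - (\<Sum>e\<in>Basis. (LINT z:?V|lborel. (F' (fst z) e \<bullet> e) * \<phi> z))"
        unfolding sum_negf[symmetric] by (intro sum.cong refl ibp1(3))
      also have "(\<Sum>e\<in>Basis. (LINT z:?V|lborel. (F' (fst z) e \<bullet> e) * \<phi> z))
         = (LINT z:?V|lborel. (\<Sum>e\<in>Basis. (F' (fst z) e \<bullet> e) * \<phi> z))"
        using ibp1(2) unfolding set_integrable_def set_lebesgue_integral_def scaleR_sum_right
        by (intro Bochner_Integration.integral_sum[symmetric])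
      also have "\<dots> = (LINT z:?V|lborel. c * \<phi> z)"
        by (intro set_lebesgue_integral_cong) (use Vm VX div in \<open>auto simp: sum_distrib_right[symmetric]\<close>)
      also have "- \<dots> = (LINT z:?V|lborel. h z * time_derivative \<phi> z)"
        unfolding time_derivative_def ibp2(3) ..
      finally show ?thesis
        using LINT_cylinder[OF i1] LINT_cylinder[OF i2] by simp
    qed
    show "\<exists>g. LpW1p_with_gradient p U t1 t2 h g \<and>
          (\<forall>\<phi>. test_function (cylinder U t1 t2) \<phi> \<longrightarrow>
             (LINT t:{t1<..<t2}|lborel. LINT x:U|lborel.
                (norm (g (x, t)) powr (p - 2) *\<^sub>R g (x, t)) \<bullet> space_gradient \<phi> (x, t))
           - (LINT t:{t1<..<t2}|lborel. LINT x:U|lborel. h (x, t) * time_derivative \<phi> (x, t))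
           = 0)"
      using Lp eq by blast
  qed
qed

section \<open>Barriers and comparison with superparabolic functions\<close>

text \<open>The margin \<epsilon> keeps the set where h1 - h2 \<ge> - 3\<epsilon>/4 away from the
  bottom and the lateral boundary; this is the confinement that \<open>weak_comparison\<close> asks
  for.\<close>

lemma parabolic_strict_comparison:
  fixes h1 h2 :: "(real^'n) \<times> real \<Rightarrow> real"
  assumes p: "p > 1" and h: "p_parabolic p D h1" "p_parabolic p D h2"
    and Q: "open Q" "t1 < t2" "compactly_inside (cylinder Q t1 t2) D"
    and z0: "z0 \<in> cylinder Q t1 t2" "h2 z0 \<le> h1 z0"
    and \<epsilon>: "\<epsilon> > 0" "\<And>z. z \<in> parabolic_boundary Q t1 t2 \<Longrightarrow> h1 z + \<epsilon> \<le> h2 z"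
  shows False
proof -
  let ?V = "cylinder Q t1 t2"
  obtain g1 where g1: "weak_solution p ?V h1 g1" by (rule p_parabolic_imp_weak_solution[OF p h(1) Q])
  obtain g2 where g2: "weak_solution p ?V h2 g2" by (rule p_parabolic_imp_weak_solution[OF p h(2) Q])
  have V: "open ?V" using Q by (simp add: cylinder_def open_Times)
  have cV: "compact (closure ?V)" "closure ?V \<subseteq> D" using Q(3) unfolding compactly_inside_def by blast+
  have cont: "continuous_on (closure ?V) h1" "continuous_on (closure ?V) h2"
    by (rule continuous_on_subset[OF conjunct1[OF h(1)[unfolded p_parabolic_def]] cV(2)]
        continuous_on_subset[OF conjunct1[OF h(2)[unfolded p_parabolic_def]] cV(2)])+
  \<comment> \<open>The hypotheses say nothing about the top face t = t2. A cut-off time strictly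
    between z0 and t2 keeps the relevant set away from it.\<close>
  define T where "T = (snd z0 + t2) / 2"
  have T: "snd z0 < T" "T < t2" using z0(1) by (auto simp: T_def cylinder_def)
  have sub: "{z \<in> closure ?V. - (3 * \<epsilon> / 4) \<le> h1 z - h2 z \<and> snd z \<le> T} \<subseteq> ?V"
  proof
    fix z assume z: "z \<in> {z \<in> closure ?V. - (3 * \<epsilon> / 4) \<le> h1 z - h2 z \<and> snd z \<le> T}"
    then have zc: "fst z \<in> closure Q" "t1 \<le> snd z" "snd z < t2"
      using T by (auto simp: closure_cylinder[OF Q(2)])
    have "z \<notin> parabolic_boundary Q t1 t2" using \<epsilon>(2)[of z] z \<epsilon>(1) by auto
    then have "\<not> (fst z \<in> closure Q \<and> snd z = t1)" "\<not> (fst z \<in> frontier Q \<and> t1 < snd z \<and> snd z \<le> t2)"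
      by (auto simp: parabolic_boundary_def mem_Times_iff)
    with zc have "t1 < snd z" "fst z \<in> Q" using Q(1) by (auto simp: frontier_def interior_open)
    then show "z \<in> ?V" using zc by (simp add: cylinder_def mem_Times_iff)
  qed
  show False by (rule weak_comparison[OF p V cV(1) cont g1 g2 \<epsilon>(1) sub z0(1) T(1) z0(2)])
qed

section \<open>Lower semicontinuous functions\<close>

lemma lower_semicontinuous_onD:
  assumes "lower_semicontinuous_on S u" "z \<in> S" "c < u z"
  obtains U where "open U" "z \<in> U" "\<And>y. y \<in> U \<Longrightarrow> y \<in> S \<Longrightarrow> c < u y"
proof -
  have "u z \<le> Liminf (at z within S) u" using assms(1,2) by (simp add: lower_semicontinuous_on_def)
  then have "\<forall>\<^sub>F y in at z within S. c < u y" using assms(3) by (simp add: le_Liminf_iff)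
  then obtain U where "open U" "z \<in> U" "\<forall>y\<in>U. y \<noteq> z \<longrightarrow> y \<in> S \<longrightarrow> c < u y"
    unfolding eventually_at_topological by blast
  then show ?thesis using that[of U] assms(3) by metis
qed

lemma lower_semicontinuous_onI:
  fixes u :: "'a::topological_space \<Rightarrow> ereal"
  assumes "\<And>z c. z \<in> S \<Longrightarrow> c < u z \<Longrightarrow> \<exists>U. open U \<and> z \<in> U \<and> (\<forall>y\<in>U. y \<in> S \<longrightarrow> c < u y)"
  shows "lower_semicontinuous_on S u"
  unfolding lower_semicontinuous_on_def le_Liminf_iff eventually_at_topological
proof (intro ballI allI impI)
  fix z c assume "z \<in> S" "c < u z"
  from assms[OF this] obtain U where "open U \<and> z \<in> U \<and> (\<forall>y\<in>U. y \<in> S \<longrightarrow> c < u y)" by (rule exE)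
  then show "\<exists>U. open U \<and> z \<in> U \<and> (\<forall>y\<in>U. y \<noteq> z \<longrightarrow> y \<in> S \<longrightarrow> c < u y)"
    by (intro exI[of _ U]) simp
qed

lemma lower_semicontinuous_on_continuous:
  assumes "continuous_on S (w :: 'a::topological_space \<Rightarrow> real)"
  shows "lower_semicontinuous_on S (\<lambda>z. ereal (w z))"
  unfolding lower_semicontinuous_on_def le_Liminf_iff
proof (intro ballI allI impI)
  fix z c assume "z \<in> S" and c: "c < ereal (w z)"
  have "((\<lambda>z. ereal (w z)) \<longlongrightarrow> ereal (w z)) (at z within S)"
    using assms \<open>z \<in> S\<close> by (intro tendsto_ereal) (simp add: continuous_on_def)
  from order_tendstoD(1)[OF this c] show "\<forall>\<^sub>F y in at z within S. c < ereal (w y)" .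
qed

lemma lower_semicontinuous_on_subset:
  assumes "lower_semicontinuous_on S (u :: 'a::topological_space \<Rightarrow> ereal)" "S' \<subseteq> S"
  shows "lower_semicontinuous_on S' u"
proof (rule lower_semicontinuous_onI)
  fix z c assume z: "z \<in> S'" "c < u z"
  then have "z \<in> S" using assms(2) by blast
  from lower_semicontinuous_onD[OF assms(1) this z(2)] assms(2)
  show "\<exists>U. open U \<and> z \<in> U \<and> (\<forall>y\<in>U. y \<in> S' \<longrightarrow> c < u y)" by (metis subsetD)
qed

lemma lower_semicontinuous_on_add:
  assumes u: "lower_semicontinuous_on S u" "\<And>z. z \<in> S \<Longrightarrow> u z \<noteq> - \<infinity>"
    and w: "lower_semicontinuous_on S (\<lambda>z. ereal (w z))"
  shows "lower_semicontinuous_on S (\<lambda>z. u z + ereal (w z))"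
proof (rule lower_semicontinuous_onI)
  fix z c assume z: "z \<in> S" and c: "c < u z + ereal (w z)"
  obtain a b where ab: "ereal a < u z" "b < w z" "c \<le> ereal (a + b)"
  proof -
    have "c - ereal (w z) < u z" using c by (cases c; cases "u z") (auto simp: field_simps)
    then obtain a where a: "c - ereal (w z) < ereal a" "ereal a < u z"
      using ereal_dense2 by blast
    show ?thesis
    proof (cases c)
      case (real r)
      then have "r - a < w z" using a(1) by simp
      then obtain b where "r - a < b" "b < w z" using dense by blast
      then show ?thesis using that[of a b] a(2) real by simp
    next
      case PInf then show ?thesis using c by simp
    next
      case MInf then show ?thesis using that[of a "w z - 1"] a(2) by simp
    qed
  qed
  obtain U1 where U1: "open U1" "z \<in> U1" "\<And>y. y \<in> U1 \<Longrightarrow> y \<in> S \<Longrightarrow> ereal a < u y"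
    by (rule lower_semicontinuous_onD[OF u(1) z ab(1)]) blast
  have "ereal b < ereal (w z)" using ab(2) by simp
  then obtain U2 where U2: "open U2" "z \<in> U2" "\<And>y. y \<in> U2 \<Longrightarrow> y \<in> S \<Longrightarrow> ereal b < ereal (w y)"
    using lower_semicontinuous_onD[OF w z, of "ereal b"] by blast
  have "c < u y + ereal (w y)" if "y \<in> U1 \<inter> U2" "y \<in> S" for y
  proof -
    have "ereal a < u y" "b < w y" using U1(3) U2(3) that by auto
    then have "ereal (a + b) < u y + ereal (w y)" by (cases "u y") auto
    then show ?thesis using ab(3) by (rule order_le_less_trans[rotated])
  qed
  then show "\<exists>U. open U \<and> z \<in> U \<and> (\<forall>y\<in>U. y \<in> S \<longrightarrow> c < u y + ereal (w y))"
    using U1(1,2) U2(1,2) by (intro exI[of _ "U1 \<inter> U2"]) auto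
qed

text \<open>Otherwise each x has some \<open>s x\<close> with a smaller value, and f stays above f
  (s x) near x. In a finite subcover take the centre c with least f (s c): the point s c lies in the
  neighbourhood of another centre c', so f (s c') is smaller still.\<close>

lemma lower_semicontinuous_attains_inf:
  fixes f :: "'a::topological_space \<Rightarrow> ereal"
  assumes K: "compact K" "K \<noteq> {}" and f: "lower_semicontinuous_on K f"
  obtains x where "x \<in> K" "\<And>y. y \<in> K \<Longrightarrow> f x \<le> f y"
proof -
  have "\<exists>x\<in>K. \<forall>y\<in>K. f x \<le> f y"
  proof (rule ccontr)
    assume "\<not> (\<exists>x\<in>K. \<forall>y\<in>K. f x \<le> f y)"
    then have "\<forall>x\<in>K. \<exists>y. y \<in> K \<and> f y < f x" by (meson not_le)
    from bchoice[OF this] obtain s where s: "\<forall>x\<in>K. s x \<in> K \<and> f (s x) < f x" by (rule exE)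
    have "\<forall>x\<in>K. \<exists>U. open U \<and> x \<in> U \<and> (\<forall>y\<in>U. y \<in> K \<longrightarrow> f (s x) < f y)"
      using lower_semicontinuous_onD[OF f] s by metis
    from bchoice[OF this] obtain U where U: "\<forall>x\<in>K. open (U x) \<and> x \<in> U x \<and> (\<forall>y\<in>U x. y \<in> K \<longrightarrow> f (s x) < f y)"
      by (rule exE)
    obtain C where C: "C \<subseteq> K" "finite C" "K \<subseteq> (\<Union>c\<in>C. U c)"
      using compactE_image[OF K(1), of K U] U by blast
    have "C \<noteq> {}" using C K by auto
    then have "finite ((\<lambda>c. f (s c)) ` C)" "(\<lambda>c. f (s c)) ` C \<noteq> {}" using C by auto
    from Min_in[OF this] obtain c where c: "c \<in> C" "f (s c) = Min ((\<lambda>c. f (s c)) ` C)" by auto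
    have "s c \<in> K" using s c C by blast
    then obtain c' where c': "c' \<in> C" "s c \<in> U c'" using C by blast
    then have "f (s c') < f (s c)" using U C(1) \<open>s c \<in> K\<close> by blast
    moreover have "f (s c) \<le> f (s c')" unfolding c(2) using c' C(2) by auto
    ultimately show False by simp
  qed
  then show ?thesis using that by blast
qed

text \<open>As f may be nonpositive after the time of z0, the top of the box can exceed that time
  only slightly, by \<open>\<tau> k\<close>. If no k worked, parabolic boundary points with f below
  1 / (k + 1) would accumulate at a boundary point no later than z0, where f is positive and lower
  semicontinuous.\<close>

lemma touching_box:
  fixes f :: "(real^'n) \<times> real \<Rightarrow> ereal"
  assumes N: "open N" "z0 \<in> N" and f: "lower_semicontinuous_on N f"
    and pos: "\<And>z. z \<in> N \<Longrightarrow> snd z \<le> snd z0 \<Longrightarrow> z \<noteq> z0 \<Longrightarrow> 0 < f z"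
  obtains a b t1 t2 \<epsilon> where "\<And>i. a $ i < b $ i" "t1 < t2" "z0 \<in> cylinder (box a b) t1 t2"
    "compactly_inside (cylinder (box a b) t1 t2) N" "\<epsilon> > 0"
    "\<And>z. z \<in> parabolic_boundary (box a b) t1 t2 \<Longrightarrow> ereal \<epsilon> \<le> f z"
proof -
  obtain x0 t0 where z0: "z0 = (x0, t0)" by (cases z0)
  obtain A B where AB: "open A" "open B" "z0 \<in> A \<times> B" "A \<times> B \<subseteq> N"
    using open_prod_elim[OF N] by metis
  obtain r where r: "r > 0" "cball x0 r \<subseteq> A" using AB z0 open_contains_cball by blast
  obtain d where d: "d > 0" "cball t0 d \<subseteq> B" using AB z0 open_contains_cball by blast
  \<comment> \<open>The Euclidean norm is at most the l1 norm, so a cube of this half-width lies in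
    the ball of radius r.\<close>
  define s where "s = r / real CARD('n)"
  have s: "s > 0" using r by (simp add: s_def)
  define a where "a = (\<chi> i. x0 $ i - s)"
  define b where "b = (\<chi> i. x0 $ i + s)"
  have ab: "a $ i < b $ i" for i using s by (simp add: a_def b_def)
  have x0: "x0 \<in> box a b" using s by (simp add: mem_box_cart a_def b_def)
  have cb: "cbox a b \<subseteq> cball x0 r"
  proof
    fix x assume "x \<in> cbox a b"
    then have "\<bar>(x - x0) $ i\<bar> \<le> s" for i
      by (auto simp: mem_box_cart a_def b_def abs_le_iff algebra_simps)
    then have "(\<Sum>i\<in>UNIV. \<bar>(x - x0) $ i\<bar>) \<le> (\<Sum>i\<in>(UNIV::'n set). s)" by (intro sum_mono)
    then have "norm (x - x0) \<le> r" using norm_le_l1_cart[of "x - x0"] by (simp add: s_def)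
    then show "x \<in> cball x0 r" by (simp add: dist_norm norm_minus_commute)
  qed
  have cl: "closure (box a b) = cbox a b" using x0 by (intro closure_box) auto
  have fr: "frontier (box a b) = cbox a b - box a b"
    using cl by (simp add: frontier_def interior_open[OF open_box])
  define t1 where "t1 = t0 - d"
  define \<tau> where "\<tau> k = d / real (Suc k)" for k
  have \<tau>: "\<tau> k > 0" "\<tau> k \<le> d" for k using d by (auto simp: \<tau>_def field_simps)
  have \<tau>dec: "\<tau> k \<le> \<tau> j" if "j \<le> k" for j k using that d by (simp add: \<tau>_def frac_le)
  have inN: "cbox a b \<times> {t1..t0 + \<tau> k} \<subseteq> N" for k
  proof -
    have "{t1..t0 + \<tau> k} \<subseteq> cball t0 d" using \<tau>[of k] by (auto simp: t1_def dist_real_def abs_le_iff)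
    then show ?thesis using cb r d AB by blast
  qed
  have "\<exists>k. \<forall>z\<in>parabolic_boundary (box a b) t1 (t0 + \<tau> k). ereal (1 / real (Suc k)) \<le> f z"
  proof (rule ccontr)
    assume "\<not> ?thesis"
    then have "\<forall>k. \<exists>z. z \<in> parabolic_boundary (box a b) t1 (t0 + \<tau> k) \<and> f z < ereal (1 / real (Suc k))"
      by (meson not_le)
    from choice[OF this] obtain z where
      z: "\<forall>k. z k \<in> parabolic_boundary (box a b) t1 (t0 + \<tau> k) \<and> f (z k) < ereal (1 / real (Suc k))"
      by (rule exE)
    \<comment> \<open>Closed sets, decreasing in j, that contain the bad points of index at least j;
      the limit l therefore lies in all of them.\<close>
    define \<Gamma> where "\<Gamma> j = cbox a b \<times> {t1} \<union> (cbox a b - box a b) \<times> {t1..t0 + \<tau> j}" for j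
    have \<Gamma>c: "closed (\<Gamma> j)" for j
      unfolding \<Gamma>_def by (intro closed_Un closed_Times closed_Diff) auto
    have z\<Gamma>: "z k \<in> \<Gamma> j" if "j \<le> k" for j k
      using z[rule_format, of k] \<tau>dec[OF that] unfolding parabolic_boundary_def \<Gamma>_def cl fr
      by auto
    have "compact (cbox a b \<times> {t1..t0 + \<tau> 0})" by (intro compact_Times) auto
    moreover have "\<Gamma> 0 \<subseteq> cbox a b \<times> {t1..t0 + \<tau> 0}" using \<tau>[of 0] d by (auto simp: \<Gamma>_def t1_def)
    then have "\<forall>k. z k \<in> cbox a b \<times> {t1..t0 + \<tau> 0}" using z\<Gamma> by blast
    ultimately obtain l q where l: "l \<in> cbox a b \<times> {t1..t0 + \<tau> 0}" and q: "strict_mono q"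
      and lim: "(z \<circ> q) \<longlonglongrightarrow> l" unfolding compact_def by blast
    have l\<Gamma>: "l \<in> \<Gamma> j" for j
    proof (rule closed_sequentially[OF \<Gamma>c _ LIMSEQ_ignore_initial_segment[OF lim, of j]])
      fix k
      have "j \<le> q (k + j)" using seq_suble[OF q, of "k + j"] by linarith
      then show "(z \<circ> q) (k + j) \<in> \<Gamma> j" using z\<Gamma> by simp
    qed
    have lN: "l \<in> N" using l inN by blast
    have "snd l \<le> t0 \<and> l \<noteq> z0"
    proof (cases "snd l = t1")
      case True then show ?thesis using d by (auto simp: z0 t1_def)
    next
      case False
      then have *: "fst l \<notin> box a b \<and> snd l \<le> t0 + \<tau> j" for j
        using l\<Gamma>[of j] by (auto simp: \<Gamma>_def)
      have "snd l \<le> t0"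
      proof (rule ccontr)
        assume "\<not> snd l \<le> t0"
        then obtain j where "d / (snd l - t0) < real j" using reals_Archimedean2 by blast
        then have "\<tau> j < snd l - t0" using \<open>\<not> snd l \<le> t0\<close> d by (simp add: \<tau>_def field_simps)
        then show False using *[of j] by linarith
      qed
      then show ?thesis using *[of 0] x0 by (auto simp: z0)
    qed
    then have "0 < f l" using pos[OF lN] by (simp add: z0)
    then obtain c where c: "0 < ereal c" "ereal c < f l" using ereal_dense2 by blast
    obtain U where U: "open U" "l \<in> U" "\<And>y. y \<in> U \<Longrightarrow> y \<in> N \<Longrightarrow> ereal c < f y"
      by (rule lower_semicontinuous_onD[OF f lN c(2)]) blast
    have "\<forall>\<^sub>F k in sequentially. (z \<circ> q) k \<in> U" using lim U topological_tendstoD by blast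
    moreover have "\<forall>\<^sub>F k in sequentially. 1 / real (Suc k) < c"
      using c(1) by (intro order_tendstoD(2)[OF LIMSEQ_Suc[OF lim_1_over_n]]) simp
    ultimately have "\<forall>\<^sub>F k in sequentially. False"
    proof eventually_elim
      case (elim k)
      have "z (q k) \<in> N" using z\<Gamma>[of 0 "q k"] \<open>\<Gamma> 0 \<subseteq> _\<close> inN by blast
      then have "ereal c < f (z (q k))" using U(3) elim(1) by simp
      also have "\<dots> < ereal (1 / real (Suc (q k)))" using z by blast
      finally have "c < 1 / real (Suc (q k))" by simp
      also have "\<dots> \<le> 1 / real (Suc k)" using seq_suble[OF q, of k] by (simp add: frac_le)
      finally show False using elim(2) by simp
    qed
    then show False by simp
  qed
  then obtain k where k: "\<forall>z\<in>parabolic_boundary (box a b) t1 (t0 + \<tau> k). ereal (1 / real (Suc k)) \<le> f z" ..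
  have lt: "t1 < t0 + \<tau> k" using d \<tau>[of k] by (simp add: t1_def)
  show ?thesis
  proof (rule that[OF ab lt])
    show "z0 \<in> cylinder (box a b) t1 (t0 + \<tau> k)" using x0 d \<tau>[of k] by (simp add: cylinder_def z0 t1_def)
    show "compactly_inside (cylinder (box a b) t1 (t0 + \<tau> k)) N"
      unfolding compactly_inside_def closure_cylinder[OF lt] cl
      by (intro conjI inN compact_Times) auto
    show "1 / real (Suc k) > 0" by simp
    show "ereal (1 / real (Suc k)) \<le> f z" if "z \<in> parabolic_boundary (box a b) t1 (t0 + \<tau> k)" for z
      using k that by blast
  qed
qed

text \<open>At a barrier point an exact solution touches \<open>w\<close> strictly from above in the past. Nothing is
  required of \<open>w\<close> at later times, so \<open>w\<close> may jump upwards.\<close>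

definition barrier_point ::
    "real \<Rightarrow> ('a::euclidean_space \<times> real \<Rightarrow> real) \<Rightarrow> 'a \<times> real \<Rightarrow> bool" where
  "barrier_point p w z0 \<longleftrightarrow> (\<exists>X H e. open X \<and> fst z0 \<in> X \<and> exact_solution p X H \<and> H z0 = w z0 \<and>
     0 < e \<and> (\<forall>z\<in>ball z0 e. snd z \<le> snd z0 \<longrightarrow> z \<noteq> z0 \<longrightarrow> w z < H z))"

text \<open>If h exceeded w, let z0 maximise h - w, with value \<mu>. The touching solution raised
  by \<mu> meets h at z0 and lies strictly above it in the past; \<open>touching_box\<close> turns
  this into a positive gap on the parabolic boundary of a small box, which
  \<open>parabolic_strict_comparison\<close> excludes.\<close>

theorem barrier_p_superparabolic:
  fixes w :: "(real^'n) \<times> real \<Rightarrow> real"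
  assumes p: "p > 1" and lsc: "lower_semicontinuous_on \<Theta> (\<lambda>z. ereal (w z))"
    and bar: "\<And>z. z \<in> \<Theta> \<Longrightarrow> barrier_point p w z"
  shows "p_superparabolic p \<Theta> (\<lambda>z. ereal (w z))"
proof -
  have "\<forall>z\<in>cylinder (box a b) t1 t2. ereal (h z) \<le> ereal (w z)"
    if ab: "\<forall>i. a $ i < b $ i" and t: "t1 < t2"
      and inside: "compactly_inside (cylinder (box a b) t1 t2) \<Theta>"
      and h: "p_parabolic p (cylinder (box a b) t1 t2) h"
      and ch: "continuous_on (closure (cylinder (box a b) t1 t2)) h"
      and le: "\<forall>z\<in>parabolic_boundary (box a b) t1 t2. ereal (h z) \<le> ereal (w z)"
    for a b :: "real^'n" and t1 t2 h
  proof (rule ccontr)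
    let ?Q = "box a b" let ?V = "cylinder (box a b) t1 t2"
    assume "\<not> (\<forall>z\<in>?V. ereal (h z) \<le> ereal (w z))"
    then obtain zs where zs: "zs \<in> ?V" "w zs < h zs" by auto
    \<comment> \<open>Stopping at the time of zs keeps the maximum point off the top face t = t2,
      while all points of the cylinder in its past still belong to K.\<close>
    define K where "K = closure ?Q \<times> {t1..snd zs}"
    have zsK: "zs \<in> K" using zs(1) closure_subset by (auto simp: K_def cylinder_def)
    have sub: "K \<subseteq> closure ?V"
      using zs(1) unfolding closure_cylinder[OF t] K_def by (auto simp: cylinder_def)
    have sub2: "closure ?V \<subseteq> \<Theta>" "compact (closure ?V)" using inside unfolding compactly_inside_def by blast+
    have "closed K" unfolding K_def by (intro closed_Times) auto
    then have cK: "compact K" using compact_Int_closed[OF sub2(2), of K] sub by (simp add: Int_absorb1)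
    have lsc2: "lower_semicontinuous_on K (\<lambda>z. ereal (w z) + ereal (- h z))"
      by (intro lower_semicontinuous_on_add lower_semicontinuous_on_subset[OF lsc]
            lower_semicontinuous_on_continuous continuous_intros continuous_on_subset[OF ch sub])
         (use sub sub2 in auto)
    obtain z0 where z0: "z0 \<in> K" "\<And>z. z \<in> K \<Longrightarrow> ereal (w z0) + ereal (- h z0) \<le> ereal (w z) + ereal (- h z)"
      using lower_semicontinuous_attains_inf[OF cK _ lsc2] zsK by blast
    have max: "h z - w z \<le> h z0 - w z0" if "z \<in> K" for z using z0(2)[OF that] by simp
    define \<mu> where "\<mu> = h z0 - w z0"
    have \<mu>: "\<mu> > 0" using max[OF zsK] zs(2) by (simp add: \<mu>_def)
    have z0pb: "z0 \<notin> parabolic_boundary ?Q t1 t2" using le \<mu> by (force simp: \<mu>_def)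
    have z0V: "z0 \<in> ?V"
    proof -
      have "snd zs < t2" using zs(1) by (simp add: cylinder_def mem_Times_iff)
      moreover have "fst z0 \<in> closure ?Q" "t1 \<le> snd z0" "snd z0 \<le> snd zs" using z0(1) by (auto simp: K_def)
      moreover have "\<not> (fst z0 \<in> closure ?Q \<and> snd z0 = t1)" "\<not> (fst z0 \<in> frontier ?Q \<and> t1 < snd z0 \<and> snd z0 \<le> t2)"
        using z0pb by (auto simp: parabolic_boundary_def mem_Times_iff)
      ultimately have "t1 < snd z0" "snd z0 < t2" "fst z0 \<in> ?Q"
        by (auto simp: frontier_def interior_open[OF open_box])
      then show ?thesis by (simp add: cylinder_def mem_Times_iff)
    qed
    then have "z0 \<in> \<Theta>" using sub2 closure_subset by blast
    from bar[OF this] obtain X H e where X: "open X" "fst z0 \<in> X" and H: "exact_solution p X H" "H z0 = w z0"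
      and e: "0 < e" "\<And>z. z \<in> ball z0 e \<Longrightarrow> snd z \<le> snd z0 \<Longrightarrow> z \<noteq> z0 \<Longrightarrow> w z < H z"
      unfolding barrier_point_def by blast
    define N where "N = ball z0 e \<inter> (X \<times> UNIV) \<inter> ?V"
    have N: "open N" "z0 \<in> N"
      using X e(1) z0V by (auto simp: N_def mem_Times_iff cylinder_def intro!: open_Int open_Times)
    define H' where "H' z = H z + \<mu>" for z
    have pH: "p_parabolic p N H'"
      by (rule p_parabolic_subset[OF exact_solution_p_parabolic[OF p X(1)]])
         (auto simp: N_def H'_def[abs_def] intro!: exact_solution_add_const H(1))
    have ph: "p_parabolic p N h" by (rule p_parabolic_subset[OF h]) (auto simp: N_def)
    have cN: "continuous_on N (\<lambda>z. H' z - h z)"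
      by (intro continuous_intros conjunct1[OF pH[unfolded p_parabolic_def]] conjunct1[OF ph[unfolded p_parabolic_def]])
    have pos: "0 < ereal (H' z - h z)" if z: "z \<in> N" "snd z \<le> snd z0" "z \<noteq> z0" for z
    proof -
      have "z \<in> K" using z z0(1) closure_subset[of ?Q] by (auto simp: N_def K_def cylinder_def)
      then have "h z \<le> w z + \<mu>" using max[of z] by (simp add: \<mu>_def)
      also have "\<dots> < H' z" using e(2)[of z] z by (simp add: N_def H'_def)
      finally show ?thesis by simp
    qed
    obtain a' b' s1 s2 \<epsilon> where box: "\<And>i. a' $ i < b' $ i" "s1 < s2" "z0 \<in> cylinder (box a' b') s1 s2"
      "compactly_inside (cylinder (box a' b') s1 s2) N" "\<epsilon> > 0"
      "\<And>z. z \<in> parabolic_boundary (box a' b') s1 s2 \<Longrightarrow> ereal \<epsilon> \<le> ereal (H' z - h z)"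
      by (rule touching_box[OF N lower_semicontinuous_on_continuous[OF cN] pos]) blast+
    show False
    proof (rule parabolic_strict_comparison[OF p ph pH open_box box(2,4,3) _ box(5)])
      show "H' z0 \<le> h z0" by (simp add: H'_def H(2) \<mu>_def)
      show "h z + \<epsilon> \<le> H' z" if "z \<in> parabolic_boundary (box a' b') s1 s2" for z
        using box(6)[OF that] by simp
    qed
  qed
  moreover have "\<Theta> \<subseteq> closure {z \<in> \<Theta>. ereal (w z) \<noteq> \<infinity>}" using closure_subset by auto
  ultimately show ?thesis using lsc unfolding p_superparabolic_def by auto
qed

text \<open>At a negative interior minimum of u + w, with value m0, the solution m0 - H equals u and
  lies strictly below it in the past. The gap on the parabolic boundary of a small box leaves room
  to add \<delta>, and the defining comparison of u then pushes u above its own value at the minimum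
  point.\<close>

theorem superparabolic_barrier_comparison:
  fixes u :: "(real^'n) \<times> real \<Rightarrow> ereal"
  assumes p: "p > 1" and \<Theta>: "open \<Theta>" "bounded \<Theta>" and u: "p_superparabolic p \<Theta> u"
    and lsc: "lower_semicontinuous_on \<Theta> (\<lambda>z. ereal (w z))"
    and bar: "\<And>z. z \<in> \<Theta> \<Longrightarrow> barrier_point p w z"
    and bd: "\<And>\<xi> \<epsilon>. \<xi> \<in> frontier \<Theta> \<Longrightarrow> \<epsilon> > 0 \<Longrightarrow>
      \<forall>\<^sub>F z in at \<xi> within \<Theta>. ereal (- \<epsilon>) < u z + ereal (w z)"
    and z: "z \<in> \<Theta>"
  shows "ereal (- w z) \<le> u z"
proof (rule ccontr)
  assume "\<not> ereal (- w z) \<le> u z"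
  then have zneg: "u z + ereal (w z) < 0" by (cases "u z") auto
  have unm: "u z \<noteq> - \<infinity>" if "z \<in> \<Theta>" for z using u that by (simp add: p_superparabolic_def)
  have ulsc: "lower_semicontinuous_on \<Theta> u" using u by (simp add: p_superparabolic_def)
  define f where "f z = u z + ereal (w z)" for z
  have flsc: "lower_semicontinuous_on \<Theta> f"
    unfolding f_def[abs_def] by (rule lower_semicontinuous_on_add[OF ulsc unm lsc])
  obtain \<epsilon> where \<epsilon>: "\<epsilon> > 0" "f z < ereal (- \<epsilon>)"
  proof -
    obtain r where "f z < ereal r" "ereal r < 0" using zneg ereal_dense2 unfolding f_def by blast
    then show ?thesis using that[of "- r"] by simp
  qed
  have "\<forall>\<xi>\<in>frontier \<Theta>. \<exists>U. open U \<and> \<xi> \<in> U \<and> (\<forall>z\<in>U. z \<in> \<Theta> \<longrightarrow> ereal (- \<epsilon>) < f z)"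
  proof
    fix \<xi> assume \<xi>: "\<xi> \<in> frontier \<Theta>"
    then have "\<xi> \<notin> \<Theta>" using \<Theta>(1) by (simp add: frontier_def interior_open)
    then show "\<exists>U. open U \<and> \<xi> \<in> U \<and> (\<forall>z\<in>U. z \<in> \<Theta> \<longrightarrow> ereal (- \<epsilon>) < f z)"
      using bd[OF \<xi> \<epsilon>(1)] unfolding eventually_at_topological f_def by metis
  qed
  from bchoice[OF this] obtain U where U: "\<forall>\<xi>\<in>frontier \<Theta>. open (U \<xi>) \<and> \<xi> \<in> U \<xi> \<and> (\<forall>z\<in>U \<xi>. z \<in> \<Theta> \<longrightarrow> ereal (- \<epsilon>) < f z)"
    by (rule exE)
  \<comment> \<open>Removing neighbourhoods of the boundary points in which f > - \<epsilon> leaves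
    a compact part of \<Theta>; since f is below - \<epsilon> at z, a minimum over this part is a
    minimum over \<Theta>.\<close>
  define K where "K = closure \<Theta> - (\<Union>\<xi>\<in>frontier \<Theta>. U \<xi>)"
  have "open (\<Union>\<xi>\<in>frontier \<Theta>. U \<xi>)" using U by blast
  moreover have "bounded K" unfolding K_def using \<Theta>(2) by (meson Diff_subset bounded_closure bounded_subset)
  ultimately have cK: "compact K" unfolding compact_eq_bounded_closed by (simp add: K_def closed_Diff)
  have K\<Theta>: "K \<subseteq> \<Theta>" using U \<Theta>(1) by (auto simp: K_def frontier_def interior_open)
  have outK: "ereal (- \<epsilon>) < f y" if "y \<in> \<Theta>" "y \<notin> K" for y
    using that U closure_subset[of \<Theta>] by (auto simp: K_def)
  have zK: "z \<in> K" using outK[OF z] \<epsilon>(2) by fastforce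
  obtain z0 where z0: "z0 \<in> K" "\<And>y. y \<in> K \<Longrightarrow> f z0 \<le> f y"
    using lower_semicontinuous_attains_inf[OF cK _ lower_semicontinuous_on_subset[OF flsc K\<Theta>]] zK by blast
  have fz0: "f z0 < ereal (- \<epsilon>)" using z0(2)[OF zK] \<epsilon>(2) by simp
  have min: "f z0 \<le> f y" if "y \<in> \<Theta>" for y
    using z0(2)[of y] outK[OF that] fz0 by (cases "y \<in> K") auto
  have z0\<Theta>: "z0 \<in> \<Theta>" using z0 K\<Theta> by blast
  obtain u0 where u0: "u z0 = ereal u0"
    using unm[OF z0\<Theta>] fz0 by (cases "u z0") (auto simp: f_def)
  define m0 where "m0 = u0 + w z0"
  from bar[OF z0\<Theta>] obtain X H e where X: "open X" "fst z0 \<in> X" and H: "exact_solution p X H" "H z0 = w z0"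
      and e: "0 < e" "\<And>z. z \<in> ball z0 e \<Longrightarrow> snd z \<le> snd z0 \<Longrightarrow> z \<noteq> z0 \<Longrightarrow> w z < H z"
    unfolding barrier_point_def by blast
  define N where "N = ball z0 e \<inter> (X \<times> UNIV) \<inter> \<Theta>"
  have N: "open N" "z0 \<in> N" "N \<subseteq> \<Theta>"
    using X e(1) z0\<Theta> \<Theta> by (auto simp: N_def mem_Times_iff intro!: open_Int open_Times)
  define h where "h z = - H z + m0" for z
  have hex: "exact_solution p X (\<lambda>z. h z + k)" for k
    unfolding h_def[abs_def] by (intro exact_solution_add_const exact_solution_uminus H(1))
  have ph: "p_parabolic p N (\<lambda>z. h z + k)" for k
    by (rule p_parabolic_subset[OF exact_solution_p_parabolic[OF p X(1) hex]]) (auto simp: N_def)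
  have ch: "continuous_on N h" using conjunct1[OF ph[of 0, unfolded p_parabolic_def]] by simp
  have lsc': "lower_semicontinuous_on N (\<lambda>z. u z + ereal (- h z))"
    by (intro lower_semicontinuous_on_add lower_semicontinuous_on_subset[OF ulsc N(3)]
          lower_semicontinuous_on_continuous continuous_intros ch) (use N(3) unm in auto)
  have pos: "0 < u y + ereal (- h y)" if y: "y \<in> N" "snd y \<le> snd z0" "y \<noteq> z0" for y
  proof -
    have "w y < H y" using e(2)[of y] y by (simp add: N_def)
    moreover have "ereal m0 \<le> u y + ereal (w y)" using min[of y] N(3) y(1) u0 by (auto simp: f_def m0_def)
    moreover have "u y \<noteq> - \<infinity>" using unm N(3) y(1) by blast
    ultimately show ?thesis by (cases "u y") (auto simp: h_def)
  qed
  obtain a b t1 t2 \<delta> where box: "\<And>i. a $ i < b $ i" "t1 < t2" "z0 \<in> cylinder (box a b) t1 t2"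
      "compactly_inside (cylinder (box a b) t1 t2) N" "\<delta> > 0"
      "\<And>z. z \<in> parabolic_boundary (box a b) t1 t2 \<Longrightarrow> ereal \<delta> \<le> u z + ereal (- h z)"
    by (rule touching_box[OF N(1,2) lsc' pos]) blast+
  let ?V = "cylinder (box a b) t1 t2"
  have clV: "closure ?V \<subseteq> N" using box(4) by (simp add: compactly_inside_def)
  have "compactly_inside ?V \<Theta>" using box(4) N(3) by (auto simp: compactly_inside_def)
  moreover have "p_parabolic p ?V (\<lambda>z. h z + \<delta>)"
    by (rule p_parabolic_subset[OF ph]) (use clV closure_subset in blast)
  moreover have "continuous_on (closure ?V) (\<lambda>z. h z + \<delta>)"
    by (intro continuous_intros continuous_on_subset[OF ch clV])
  moreover have "\<forall>z\<in>parabolic_boundary (box a b) t1 t2. ereal (h z + \<delta>) \<le> u z"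
  proof
    fix y assume "y \<in> parabolic_boundary (box a b) t1 t2"
    from box(6)[OF this] show "ereal (h y + \<delta>) \<le> u y" by (cases "u y") auto
  qed
  ultimately have "\<forall>z\<in>?V. ereal (h z + \<delta>) \<le> u z"
    using u box(1,2) unfolding p_superparabolic_def by blast
  then have "ereal (h z0 + \<delta>) \<le> u z0" using box(3) by blast
  then show False using box(5) by (simp add: u0 h_def H(2) m0_def)
qed

section \<open>Radial exact solutions and barriers\<close>

text \<open>Touching passes to any function that is smaller in the past and agrees at the point. So
  a minimum inherits it from whichever function attains it, and values at later times may be changed
  freely.\<close>

lemma barrier_point_le:
  assumes "barrier_point p \<phi> z0" "w z0 = \<phi> z0" "e > 0"
    and le: "\<And>z. z \<in> ball z0 e \<Longrightarrow> snd z \<le> snd z0 \<Longrightarrow> w z \<le> \<phi> z"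
  shows "barrier_point p w z0"
proof -
  obtain X H e' where H: "open X" "fst z0 \<in> X" "exact_solution p X H" "H z0 = \<phi> z0" "0 < e'"
     "\<forall>z\<in>ball z0 e'. snd z \<le> snd z0 \<longrightarrow> z \<noteq> z0 \<longrightarrow> \<phi> z < H z"
    using assms(1) unfolding barrier_point_def by blast
  have "\<forall>z\<in>ball z0 (min e e'). snd z \<le> snd z0 \<longrightarrow> z \<noteq> z0 \<longrightarrow> w z < H z"
    using H(6) le by fastforce
  then show ?thesis unfolding barrier_point_def
    using H(1-5) assms(2,3) by (intro exI[of _ X] exI[of _ H] exI[of _ "min e e'"]) auto
qed

section \<open>Powers of the distance\<close>

lemma has_derivative_norm_powr:
  fixes y :: "'a::euclidean_space"
  assumes q: "q > 1"
  shows "((\<lambda>x. norm (x - y) powr q) has_derivative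
    (\<lambda>v. ((q * norm (x - y) powr (q - 2)) *\<^sub>R (x - y)) \<bullet> v)) (at x)"
proof (cases "x = y")
  case True
  have "((\<lambda>h::'a. norm h powr (q - 1)) \<longlongrightarrow> norm (0::'a) powr (q - 1)) (at 0)"
    by (rule tendsto_powr'[OF tendsto_norm[OF tendsto_ident_at] tendsto_const]) (use q in auto)
  then have "((\<lambda>h::'a. norm h powr (q - 1)) \<longlongrightarrow> 0) (at 0)" using q by simp
  then have "((\<lambda>h::'a. norm (norm h powr q) / norm h) \<longlongrightarrow> 0) (at 0)"
    by (rule Lim_transform_eventually) (auto simp: eventually_at_filter powr_diff)
  then show ?thesis using True q by (simp add: has_derivative_at)
next
  case False
  have n: "((\<lambda>x. norm (x - y)) has_derivative (\<lambda>h. h \<bullet> sgn (x - y))) (at x)"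
    by (rule has_derivative_compose[OF _ has_derivative_norm])
       (use False in \<open>auto intro!: derivative_eq_intros\<close>)
  have pw: "((\<lambda>r. r powr q) has_real_derivative q * norm (x - y) powr (q - 1)) (at (norm (x - y)))"
    using False by (intro has_real_derivative_powr) simp
  have "((\<lambda>x. norm (x - y) powr q) has_derivative
      (\<lambda>h. q * norm (x - y) powr (q - 1) * (h \<bullet> sgn (x - y)))) (at x)"
    using has_derivative_compose[OF n pw[unfolded has_field_derivative_def]] by simp
  moreover have "q * norm (x - y) powr (q - 1) * (h \<bullet> sgn (x - y))
      = ((q * norm (x - y) powr (q - 2)) *\<^sub>R (x - y)) \<bullet> h" for h
  proof -
    have "norm (x - y) powr (q - 1) = norm (x - y) powr (q - 2) * norm (x - y)"
      using powr_add[of "norm (x - y)" "q - 2" 1] False by simp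
    then show ?thesis using False by (simp add: sgn_div_norm inner_commute)
  qed
  ultimately show ?thesis by simp
qed

text \<open>The exponent satisfies (q - 1) (p - 1) = 1, so the flux is the linear field
  \<open>(A * q) powr (p - 1) *\<^sub>R (x - y)\<close>, whose divergence is constant.\<close>

lemma exact_solution_power:
  fixes y :: "'a::euclidean_space"
  assumes p: "p > 1" and A: "A \<ge> 0" and q: "q = p / (p - 1)"
  shows "exact_solution p UNIV (\<lambda>z. A * norm (fst z - y) powr q + (real DIM('a) * (A * q) powr (p - 1)) * snd z)"
proof -
  have q1: "q > 1" "(q - 1) * (p - 1) = 1" using p by (auto simp: q field_simps)
  define G where "G x = (A * q * norm (x - y) powr (q - 2)) *\<^sub>R (x - y)" for x
  define F' where "F' = (\<lambda>(x::'a) v::'a. (A * q) powr (p - 1) *\<^sub>R v)"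
  have D: "((\<lambda>x. A * norm (x - y) powr q) has_derivative (\<lambda>v. G x \<bullet> v)) (at x)" for x
    using has_derivative_mult_right[OF has_derivative_norm_powr[OF q1(1), of y x], of A]
    by (simp add: G_def mult.assoc)
  have nG: "norm (G x) = A * q * norm (x - y) powr (q - 1)" for x
  proof (cases "x = y")
    case False
    then have "norm (x - y) powr (q - 1) = norm (x - y) powr (q - 2) * norm (x - y)"
      using powr_add[of "norm (x - y)" "q - 2" 1] by simp
    then show ?thesis using A q1 by (simp add: G_def)
  qed (use q1 in \<open>simp add: G_def\<close>)
  have flux: "norm (G x) powr (p - 2) *\<^sub>R G x = (A * q) powr (p - 1) *\<^sub>R (x - y)" for x
  proof (cases "A = 0 \<or> x = y")
    case True then show ?thesis using p by (auto simp: G_def)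
  next
    case False
    then have Aq: "A * q > 0" and r: "norm (x - y) > 0" using A q1 by auto
    have "norm (G x) powr (p - 2) * (A * q * norm (x - y) powr (q - 2))
        = ((A * q) powr (p - 2) * (A * q) powr 1) * (norm (x - y) powr ((q - 1) * (p - 2)) * norm (x - y) powr (q - 2))"
      using Aq r by (simp add: nG powr_mult powr_powr)
    also have "\<dots> = (A * q) powr (p - 1) * norm (x - y) powr ((q - 1) * (p - 2) + (q - 2))"
      unfolding powr_add[symmetric] by simp
    also have "(q - 1) * (p - 2) + (q - 2) = 0" using q1(2) by (simp add: algebra_simps)
    finally show ?thesis using r by (simp add: G_def)
  qed
  have cG: "continuous_on UNIV G"
  proof -
    have "isCont G x" for x
    proof (cases "x = y")
      case False
      have "(G \<longlongrightarrow> G x) (at x)" unfolding G_def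
        by (intro tendsto_intros) (use False in auto)
      then show ?thesis by (simp add: isCont_def)
    next
      case True
      have "((\<lambda>x. norm (x - y) powr (q - 1)) \<longlongrightarrow> norm (y - y) powr (q - 1)) (at y)"
        by (rule tendsto_powr'[OF tendsto_norm[OF tendsto_diff[OF tendsto_ident_at tendsto_const]] tendsto_const])
           (use q1 in auto)
      then have "((\<lambda>x. A * q * norm (x - y) powr (q - 1)) \<longlongrightarrow> A * q * 0) (at y)"
        using q1 by (intro tendsto_intros) simp
      then have "((\<lambda>x. norm (G x)) \<longlongrightarrow> 0) (at y)" by (simp add: nG)
      then have "(G \<longlongrightarrow> 0) (at y)" by (rule tendsto_norm_zero_cancel)
      then show ?thesis using True by (simp add: isCont_def G_def)
    qed
    then show ?thesis by (simp add: continuous_at_imp_continuous_on)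
  qed
  have trace: "(\<Sum>e\<in>Basis. F' x e \<bullet> e) = real DIM('a) * (A * q) powr (p - 1)" for x
    by (simp add: F'_def inner_Basis)
  show ?thesis unfolding exact_solution_def
    by (rule exI[of _ "\<lambda>x. A * norm (x - y) powr q"], rule exI[of _ "real DIM('a) * (A * q) powr (p - 1)"],
        rule exI[of _ G], rule exI[of _ F'])
       (auto simp: flux trace F'_def intro!: D cG derivative_eq_intros continuous_intros)
qed

text \<open>At the centre there is no radial direction along which to move it, as is done for the
  other points. Instead A is raised to A' so little that the matching slope c' stays below c: the
  new solution is larger in space, and in the past larger by (c - c') (t0 - t).\<close>

lemma barrier_point_power_centre:
  fixes x0 :: "'a::euclidean_space"
  assumes p: "p > 1" and A: "A \<ge> 0" and q: "q = p / (p - 1)"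
    and c: "real DIM('a) * (A * q) powr (p - 1) < c"
  shows "barrier_point p (\<lambda>z. A * norm (fst z - x0) powr q + c * snd z + k) (x0, t0)"
proof -
  have q1: "q > 1" using p by (simp add: q field_simps)
  have "((\<lambda>a. real DIM('a) * (a * q) powr (p - 1)) \<longlongrightarrow> real DIM('a) * (A * q) powr (p - 1)) (at_right A)"
    by (intro tendsto_intros tendsto_powr') (use p A q1 in \<open>auto simp: eventually_at_filter\<close>)
  then have "\<forall>\<^sub>F a in at_right A. real DIM('a) * (a * q) powr (p - 1) < c"
    using c by (rule order_tendstoD)
  moreover have "\<forall>\<^sub>F a in at_right A. A < a" by (simp add: eventually_at_filter)
  ultimately have "\<forall>\<^sub>F a in at_right A. A < a \<and> real DIM('a) * (a * q) powr (p - 1) < c"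
    by eventually_elim simp
  then obtain A' where A': "A < A'" "real DIM('a) * (A' * q) powr (p - 1) < c"
    using eventually_happens'[of "at_right A"] by (auto simp: trivial_limit_at_right_real)
  define c' where "c' = real DIM('a) * (A' * q) powr (p - 1)"
  define H where "H z = (A' * norm (fst z - x0) powr q + c' * snd z) + (k + (c - c') * t0)" for z :: "'a \<times> real"
  have H: "exact_solution p UNIV H" unfolding H_def[abs_def] c'_def
    by (rule exact_solution_add_const[OF exact_solution_power[OF p _ q]]) (use A A' in simp)
  have "A * norm (fst z - x0) powr q + c * snd z + k < H z"
    if z: "snd z \<le> t0" "z \<noteq> (x0, t0)" for z
  proof -
    have "H z - (A * norm (fst z - x0) powr q + c * snd z + k)
      = (A' - A) * norm (fst z - x0) powr q + (c - c') * (t0 - snd z)"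
      by (simp add: H_def algebra_simps)
    also have "\<dots> > 0"
    proof (cases "snd z = t0")
      case True
      then have "fst z \<noteq> x0" using z by (cases z) auto
      then show ?thesis using A' True by simp
    next
      case False
      then have "(c - c') * (t0 - snd z) > 0" using z A' by (simp add: c'_def)
      then show ?thesis using A' by (simp add: add_nonneg_pos)
    qed
    finally show ?thesis by simp
  qed
  then show ?thesis unfolding barrier_point_def
    by (intro exI[of _ UNIV] exI[of _ H] exI[of _ 1])
       (use H q1 in \<open>auto simp: H_def algebra_simps\<close>)
qed

text \<open>\<open>P\<close> is the radial flux, that is (\<Psi>')^(p-1). The solutions of R^(1-n)
  (R^(n-1) P)' = c are k R^(1-n) + c R / n, and positivity of P keeps the gradient away from its
  degenerate value 0.\<close>

lemma exact_solution_radial: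
  fixes y :: "'a::euclidean_space"
  assumes p: "p > 1" and r1: "r1 \<ge> 0"
    and \<Psi>: "\<And>R. r1 < R \<Longrightarrow> R < r2 \<Longrightarrow> (\<Psi> has_real_derivative P R powr (1 / (p - 1))) (at R)"
    and P: "\<And>R. r1 < R \<Longrightarrow> R < r2 \<Longrightarrow> P R > 0"
      "\<And>R. P R = k * R powr (1 - real DIM('a)) + c * R / real DIM('a)"
  shows "exact_solution p {x. r1 < norm (x - y) \<and> norm (x - y) < r2} (\<lambda>z. \<Psi> (norm (fst z - y)) + c * snd z)"
proof -
  let ?X = "{x. r1 < norm (x - y) \<and> norm (x - y) < r2}"
  let ?n = "real DIM('a)"
  have n: "?n > 0" by simp
  define G where "G x = (P (norm (x - y)) powr (1 / (p - 1)) / norm (x - y)) *\<^sub>R (x - y)" for x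
  define F' where "F' x v = (k * norm (x - y) powr (- ?n) + c / ?n) *\<^sub>R v
      + (k * (- ?n * norm (x - y) powr (- ?n - 1)) * (v \<bullet> sgn (x - y))) *\<^sub>R (x - y)" for x v
  have nz: "norm (x - y) > 0" if "x \<in> ?X" for x using that r1 by auto
  have Dn: "((\<lambda>x. norm (x - y)) has_derivative (\<lambda>h. h \<bullet> sgn (x - y))) (at x)" if "x \<in> ?X" for x
    by (rule has_derivative_compose[OF _ has_derivative_norm])
       (use nz[OF that] in \<open>auto intro!: derivative_eq_intros\<close>)
  have D: "((\<lambda>x. \<Psi> (norm (x - y))) has_derivative (\<lambda>v. G x \<bullet> v)) (at x)" if "x \<in> ?X" for x
  proof -
    have "((\<lambda>x. \<Psi> (norm (x - y))) has_derivative
        (\<lambda>h. P (norm (x - y)) powr (1 / (p - 1)) * (h \<bullet> sgn (x - y)))) (at x)"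
      using has_derivative_compose[OF Dn[OF that] \<Psi>[unfolded has_field_derivative_def]] that by simp
    moreover have "P (norm (x - y)) powr (1 / (p - 1)) * (h \<bullet> sgn (x - y)) = G x \<bullet> h" for h
      by (simp add: G_def sgn_div_norm inner_commute divide_inverse)
    ultimately show ?thesis by simp
  qed
  have flux: "norm (G x) powr (p - 2) *\<^sub>R G x = (k * norm (x - y) powr (- ?n) + c / ?n) *\<^sub>R (x - y)"
    if x: "x \<in> ?X" for x
  proof -
    define R where "R = norm (x - y)"
    have R: "R > 0" "P R > 0" using nz[OF x] P(1)[of R] x by (auto simp: R_def)
    have nG: "norm (G x) = P R powr (1 / (p - 1))" using R by (simp add: G_def R_def[symmetric])
    have "norm (G x) powr (p - 2) * (P R powr (1 / (p - 1)) / R)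
        = P R powr ((p - 2) / (p - 1)) * P R powr (1 / (p - 1)) / R"
      unfolding nG by (simp add: powr_powr)
    also have "\<dots> = P R powr ((p - 2) / (p - 1) + 1 / (p - 1)) / R" unfolding powr_add ..
    also have "(p - 2) / (p - 1) + 1 / (p - 1) = 1" using p by (simp add: field_simps)
    also have "P R powr 1 / R = P R / R" using R by simp
    also have "P R / R = k * (R powr (1 - ?n) / R powr 1) + c / ?n"
      using R(1) by (subst P(2)) (simp add: field_simps)
    also have "R powr (1 - ?n) / R powr 1 = R powr (- ?n)" unfolding powr_diff[symmetric] by simp
    finally show ?thesis by (simp add: G_def R_def)
  qed
  have DF: "((\<lambda>x. (k * norm (x - y) powr (- ?n) + c / ?n) *\<^sub>R (x - y)) has_derivative F' x) (at x)"
    if x: "x \<in> ?X" for x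
  proof -
    have pw: "((\<lambda>r. r powr (- ?n)) has_real_derivative - ?n * norm (x - y) powr (- ?n - 1)) (at (norm (x - y)))"
      using nz[OF x] by (intro has_real_derivative_powr) simp
    have "((\<lambda>x. norm (x - y) powr (- ?n)) has_derivative
      (\<lambda>h. - ?n * norm (x - y) powr (- ?n - 1) * (h \<bullet> sgn (x - y)))) (at x)"
      using has_derivative_compose[OF Dn[OF x] pw[unfolded has_field_derivative_def]] by simp
    from has_derivative_add[OF has_derivative_mult_right[OF this, of k] has_derivative_const[of "c / ?n"]]
    have "((\<lambda>x. k * norm (x - y) powr (- ?n) + c / ?n) has_derivative
      (\<lambda>h. k * (- ?n * norm (x - y) powr (- ?n - 1)) * (h \<bullet> sgn (x - y)))) (at x)" by (simp add: mult.assoc)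
    moreover have "((\<lambda>x. x - y) has_derivative (\<lambda>h. h)) (at x)" by (auto intro!: derivative_eq_intros)
    ultimately show ?thesis using has_derivative_scaleR unfolding F'_def[abs_def] by blast
  qed
  have opX: "open ?X"
  proof -
    have "open {x. r1 < norm (x - y)}" "open {x. norm (x - y) < r2}"
      by (intro open_Collect_less continuous_intros)+
    then show ?thesis by (simp add: Collect_conj_eq open_Int)
  qed
  have cG: "continuous_on ?X G"
  proof -
    have "continuous_on ?X (\<lambda>x. P (norm (x - y)))"
      unfolding P(2) by (intro continuous_intros) (use r1 in auto)
    moreover have "\<And>x. x \<in> ?X \<Longrightarrow> P (norm (x - y)) \<noteq> 0" using P(1) by fastforce
    ultimately show ?thesis unfolding G_def
      by (intro continuous_intros) (use r1 in auto)
  qed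
  have cF': "continuous_on ?X (\<lambda>x. F' x v)" for v
    unfolding F'_def sgn_div_norm by (intro continuous_intros) (use r1 in auto)
  have trace: "(\<Sum>e\<in>Basis. F' x e \<bullet> e) = c" if x: "x \<in> ?X" for x
  proof -
    define R where "R = norm (x - y)"
    have R: "R > 0" using nz[OF x] by (simp add: R_def)
    define \<alpha> where "\<alpha> = k * R powr (- ?n) + c / ?n"
    define \<beta> where "\<beta> = k * (- ?n * R powr (- ?n - 1))"
    have "(\<Sum>e\<in>Basis. F' x e \<bullet> e) = (\<Sum>e\<in>(Basis::'a set). \<alpha> + \<beta> * ((sgn (x - y) \<bullet> e) * ((x - y) \<bullet> e)))"
      by (intro sum.cong) (auto simp: F'_def \<alpha>_def \<beta>_def R_def inner_add_left inner_diff_left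
          inner_commute[of _ "sgn (x - y)"])
    also have "\<dots> = ?n * \<alpha> + \<beta> * (sgn (x - y) \<bullet> (x - y))"
      by (simp add: sum.distrib sum_distrib_left[symmetric] euclidean_inner[of "sgn (x - y)" "x - y"])
    also have "sgn (x - y) \<bullet> (x - y) = R"
      using R by (simp add: sgn_div_norm R_def dot_square_norm power2_eq_square)
    also have "\<beta> * R = - (?n * k) * R powr (- ?n)"
      using R powr_add[of R "- ?n - 1" 1] by (simp add: \<beta>_def)
    finally show ?thesis using n by (simp add: \<alpha>_def algebra_simps)
  qed
  show ?thesis unfolding exact_solution_def
  proof (rule exI[of _ "\<lambda>x. \<Psi> (norm (x - y))"], rule exI[of _ c], rule exI[of _ G], rule exI[of _ F'],
      intro conjI ballI allI cG cF' D trace)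
    fix x assume x: "x \<in> ?X"
    show "((\<lambda>x. norm (G x) powr (p - 2) *\<^sub>R G x) has_derivative F' x) (at x)"
      by (rule has_derivative_transform_within_open[OF DF[OF x] opX x]) (simp only: flux)
  qed simp_all
qed

text \<open>\<open>P0\<close> is the flux of \<Psi>0, and its divergence at R0 is below c. Moving
  the centre by d towards the touching point turns the tangential part of the divergence into (n -
  1) P0(R0) / (R0 - d), so for small d the sum is still below some c' < c. An exact flux P1 of
  divergence c' with P1(R0 - d) = P0(R0) then has the larger derivative there.\<close>

lemma radial_touching_profile:
  fixes \<Psi>0 P0 :: "real \<Rightarrow> real"
  assumes p: "p > 1" and n: "n \<ge> (1 :: real)" and R0: "R0 > 0" and \<rho>: "\<rho> > 0"
    and \<Psi>0: "\<And>R. \<bar>R - R0\<bar> < \<rho> \<Longrightarrow> (\<Psi>0 has_real_derivative P0 R powr (1 / (p - 1))) (at R)"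
    and P0: "\<And>R. \<bar>R - R0\<bar> < \<rho> \<Longrightarrow> P0 R > 0"
    and P0': "(P0 has_real_derivative P0') (at R0)" and c: "P0' + (n - 1) * P0 R0 / R0 < c"
  obtains d k c' e \<Psi>1 P1 where "0 < d" "d < R0" "c' < c" "e > 0" "e < R0 - d" "e < \<rho>"
    "\<And>R. P1 R = k * R powr (1 - n) + c' * R / n"
    "\<And>R. \<bar>R - (R0 - d)\<bar> < e \<Longrightarrow> P1 R > 0"
    "\<And>R. \<bar>R - (R0 - d)\<bar> < e \<Longrightarrow> (\<Psi>1 has_real_derivative P1 R powr (1 / (p - 1))) (at R)"
    "\<And>R. \<bar>R - (R0 - d)\<bar> < e \<Longrightarrow> R \<noteq> R0 - d \<Longrightarrow> \<Psi>0 (R + d) - \<Psi>1 R < \<Psi>0 R0 - \<Psi>1 (R0 - d)"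
proof -
  have "((\<lambda>d. P0' + (n - 1) * P0 R0 / (R0 - d)) \<longlongrightarrow> P0' + (n - 1) * P0 R0 / (R0 - 0)) (at_right 0)"
    by (intro tendsto_intros) (use R0 in auto)
  then have "\<forall>\<^sub>F d in at_right 0. P0' + (n - 1) * P0 R0 / (R0 - d) < c"
    using c by (intro order_tendstoD) auto
  moreover have "\<forall>\<^sub>F d in at_right 0. d \<in> {0<..<R0}"
    by (rule eventually_at_right_real[OF R0])
  ultimately have "\<forall>\<^sub>F d in at_right 0. d \<in> {0<..<R0} \<and> P0' + (n - 1) * P0 R0 / (R0 - d) < c"
    by eventually_elim simp
  then obtain d where d: "0 < d" "d < R0" "P0' + (n - 1) * P0 R0 / (R0 - d) < c"
    using eventually_happens'[of "at_right (0::real)"] by (auto simp: trivial_limit_at_right_real)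
  obtain c' where c': "P0' + (n - 1) * P0 R0 / (R0 - d) < c'" "c' < c" using dense[OF d(3)] by blast
  define R1 where "R1 = R0 - d"
  have R1: "R1 > 0" using d by (simp add: R1_def)
  \<comment> \<open>The coefficient for which P1 R1 = P0 R0.\<close>
  define k where "k = (P0 R0 - c' * R1 / n) * R1 powr (n - 1)"
  define P1 where "P1 R = k * R powr (1 - n) + c' * R / n" for R
  have P1R1: "P1 R1 = P0 R0"
  proof -
    have "R1 powr (n - 1) * R1 powr (1 - n) = 1" using R1 by (simp add: powr_add[symmetric])
    then show ?thesis by (simp add: P1_def k_def mult.assoc)
  qed
  define P1' where "P1' = k * ((1 - n) * R1 powr (1 - n - 1)) + c' / n"
  have DP1: "(P1 has_real_derivative k * ((1 - n) * R powr (1 - n - 1)) + c' / n) (at R)" if "R > 0" for R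
  proof -
    have "((\<lambda>R. R powr (1 - n)) has_real_derivative (1 - n) * R powr (1 - n - 1)) (at R)"
      by (rule has_real_derivative_powr[OF that])
    from DERIV_add[OF DERIV_cmult[OF this, of k] DERIV_cmult[OF DERIV_ident, of "c' / n"]]
    show ?thesis by (simp add: P1_def[abs_def])
  qed
  have P1'eq: "P1' = c' - (n - 1) * P0 R0 / R1"
  proof -
    have "R1 powr (1 - n - 1) = R1 powr (1 - n) / R1" using R1 powr_diff[of R1 "1 - n" 1] by simp
    then have "P1' = (1 - n) * (k * R1 powr (1 - n)) / R1 + c' / n" by (simp add: P1'_def)
    also have "k * R1 powr (1 - n) = P0 R0 - c' * R1 / n" using P1R1 by (simp add: P1_def)
    also have "(1 - n) * (P0 R0 - c' * R1 / n) / R1 = (1 - n) * (P0 R0 / R1 - c' / n)"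
      using R1 by (simp add: diff_divide_distrib right_diff_distrib)
    also have "(1 - n) * (P0 R0 / R1 - c' / n) + c' / n = n * (c' / n) - (n - 1) * (P0 R0 / R1)"
    proof -
      have "(1 - n) * (X - q) + q = n * q - (n - 1) * X" for X q by (simp add: algebra_simps)
      then show ?thesis .
    qed
    also have "n * (c' / n) = c'" using n by simp
    finally show ?thesis by simp
  qed
  \<comment> \<open>The derivative of \<Psi>0 (R + d) - \<Psi>1 R has the sign of D, as the power 1
    / (p - 1) is increasing. D vanishes at R1 and decreases through it, which gives the strict
    maximum.\<close>
  define D where "D R = P0 (R + d) - P1 R" for R
  have "((\<lambda>R. P0 (R + d)) has_real_derivative P0') (at R1)"
    using DERIV_shift[of P0 P0' R1 d] P0' by (simp add: R1_def)
  then have "(D has_real_derivative P0' - P1') (at R1)"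
    unfolding D_def[abs_def] P1'_def by (rule DERIV_diff[OF _ DP1[OF R1]])
  moreover have "P0' - P1' < 0" using c' by (simp add: P1'eq R1_def)
  ultimately obtain dl dr where dl: "dl > 0" "\<And>h. 0 < h \<Longrightarrow> h < dl \<Longrightarrow> D R1 < D (R1 - h)"
    and dr: "dr > 0" "\<And>h. 0 < h \<Longrightarrow> h < dr \<Longrightarrow> D (R1 + h) < D R1"
    using DERIV_neg_dec_left[of D "P0' - P1'" R1] DERIV_neg_dec_right[of D "P0' - P1'" R1] by blast
  have DR1: "D R1 = 0" 
  proof -
    have "R1 + d = R0" by (simp add: R1_def)
    then show ?thesis by (simp add: D_def P1R1)
  qed
  have "isCont P1 R1" using DP1[OF R1] by (rule DERIV_isCont)
  then have "\<forall>\<^sub>F R in nhds R1. 0 < P1 R"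
    using P0[of R0] \<rho> unfolding isCont_def P1R1[symmetric]
    by (metis P1R1 abs_zero diff_self order_tendstoD(1) tendsto_at_iff_tendsto_nhds)
  then obtain e0 where e0: "e0 > 0" "\<And>R. \<bar>R - R1\<bar> < e0 \<Longrightarrow> 0 < P1 R"
    unfolding eventually_nhds_metric by (auto simp: dist_real_def)
  define m where "m = Min {e0, dl, dr, R1, \<rho>}"
  have m: "m > 0" "m \<le> e0" "m \<le> dl" "m \<le> dr" "m \<le> R1" "m \<le> \<rho>"
    using e0 dl dr R1 \<rho> by (auto simp: m_def)
  define e where "e = m / 2"
  have e: "e > 0" "e < e0" "e < dl" "e < dr" "e < R1" "e < \<rho>" using m by (auto simp: e_def)
  let ?I = "{R1 - e..R1 + e}"
  have I: "\<bar>R - R1\<bar> < e0" "R > 0" if "R \<in> ?I" for R using that e by auto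
  define s1 where "s1 R = P1 R powr (1 / (p - 1))" for R
  have cP1: "continuous_on ?I P1"
    using DP1 I(2) by (meson DERIV_isCont continuous_at_imp_continuous_on)
  have "continuous_on ?I s1" unfolding s1_def
    by (intro continuous_on_powr cP1 continuous_on_const) (use e0(2) I(1) in force)
  then obtain \<Psi>1 where \<Psi>1: "\<And>R. R \<in> ?I \<Longrightarrow> (\<Psi>1 has_vector_derivative s1 R) (at R within ?I)"
    by (rule antiderivative_continuous) blast
  have D\<Psi>1: "(\<Psi>1 has_real_derivative s1 R) (at R)" if "\<bar>R - R1\<bar> < e" for R
  proof -
    have "R \<in> interior ?I" using that by (auto simp: abs_less_iff)
    then have "at R within ?I = at R" by (rule at_within_interior)
    moreover have "R \<in> ?I" using that by (auto simp: abs_less_iff)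
    ultimately show ?thesis using \<Psi>1[of R]
      by (simp add: has_real_derivative_iff_has_vector_derivative)
  qed
  have D\<Psi>0: "((\<lambda>R. \<Psi>0 (R + d)) has_real_derivative P0 (R + d) powr (1 / (p - 1))) (at R)" if "\<bar>R - R1\<bar> < e" for R
  proof -
    have "\<bar>(R + d) - R0\<bar> < \<rho>" using that e by (simp add: R1_def)
    from \<Psi>0[OF this] show ?thesis by (simp add: DERIV_shift)
  qed
  define f where "f R = \<Psi>0 (R + d) - \<Psi>1 R" for R
  have Df: "(f has_real_derivative P0 (R + d) powr (1 / (p - 1)) - s1 R) (at R)" if "\<bar>R - R1\<bar> < e" for R
    unfolding f_def[abs_def] by (rule DERIV_diff[OF D\<Psi>0[OF that] D\<Psi>1[OF that]])
  have q: "1 / (p - 1) > 0" using p by simp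
  have strict: "f R < f R1" if R: "\<bar>R - R1\<bar> < e" "R \<noteq> R1" for R
  proof (cases "R < R1")
    case True
    show ?thesis
    proof (rule DERIV_pos_imp_increasing_open[OF True])
      fix x assume x: "R < x" "x < R1"
      then have xe: "\<bar>x - R1\<bar> < e" using R(1) by (simp add: abs_less_iff)
      have "D x > 0" using dl(2)[of "R1 - x"] x xe e DR1 by (simp add: abs_less_iff)
      then have "P1 x < P0 (x + d)" by (simp add: D_def)
      moreover have "P1 x > 0" using e0(2)[of x] xe e by simp
      ultimately have "s1 x < P0 (x + d) powr (1 / (p - 1))"
        unfolding s1_def using q by (intro powr_less_mono2) auto
      then show "\<exists>y. (f has_real_derivative y) (at x) \<and> y > 0" using Df[OF xe] by auto
    next
      have "isCont f x" if "x \<in> {R..R1}" for x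
        using that R True by (intro DERIV_isCont[OF Df]) (auto simp: abs_less_iff)
      then show "continuous_on {R..R1} f" by (simp add: continuous_at_imp_continuous_on)
    qed
  next
    case False
    then have lt: "R1 < R" using R by simp
    show ?thesis
    proof (rule DERIV_neg_imp_decreasing_open[OF lt])
      fix x assume x: "R1 < x" "x < R"
      then have xe: "\<bar>x - R1\<bar> < e" using R(1) by (simp add: abs_less_iff)
      have "D x < 0" using dr(2)[of "x - R1"] x xe e DR1 by (simp add: abs_less_iff)
      then have "P0 (x + d) < P1 x" by (simp add: D_def)
      moreover have "P0 (x + d) > 0" using P0[of "x + d"] xe e by (simp add: R1_def)
      ultimately have "P0 (x + d) powr (1 / (p - 1)) < s1 x"
        unfolding s1_def using q by (intro powr_less_mono2) auto
      then show "\<exists>y. (f has_real_derivative y) (at x) \<and> y < 0" using Df[OF xe] by auto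
    next
      have "isCont f x" if "x \<in> {R1..R}" for x
        using that R lt by (intro DERIV_isCont[OF Df]) (auto simp: abs_less_iff)
      then show "continuous_on {R1..R} f" by (simp add: continuous_at_imp_continuous_on)
    qed
  qed
  show ?thesis
  proof (rule that[of d c' e P1 k \<Psi>1])
    show "e < R0 - d" using e by (simp add: R1_def)
    show "P1 R > 0" if "\<bar>R - (R0 - d)\<bar> < e" for R using e0(2)[of R] that e by (simp add: R1_def)
    show "(\<Psi>1 has_real_derivative P1 R powr (1 / (p - 1))) (at R)" if "\<bar>R - (R0 - d)\<bar> < e" for R
      using D\<Psi>1[of R] that by (simp add: R1_def s1_def)
    show "\<Psi>0 (R + d) - \<Psi>1 R < \<Psi>0 R0 - \<Psi>1 (R0 - d)" if "\<bar>R - (R0 - d)\<bar> < e" "R \<noteq> R0 - d" for R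
      using strict[of R] that by (simp add: f_def R1_def)
  qed (use d c' e P1_def in auto)
qed

text \<open>The touching exact solution is radial about a centre \<open>y'\<close> on the segment from \<open>y\<close> to \<open>x0\<close>:
  since \<open>|x - y| \<le> |x - y'| + |y' - y|\<close> with equality only on the ray through \<open>x0\<close>, its level sets
  bend more strongly and only the radial direction remains to be compared.\<close>

lemma barrier_point_radial:
  fixes x0 y :: "'a::euclidean_space"
  assumes p: "p > 1" and R0: "R0 = norm (x0 - y)" "R0 > 0" and \<rho>: "\<rho> > 0"
    and \<Psi>0: "\<And>R. \<bar>R - R0\<bar> < \<rho> \<Longrightarrow> (\<Psi>0 has_real_derivative P0 R powr (1 / (p - 1))) (at R)"
    and P0: "\<And>R. \<bar>R - R0\<bar> < \<rho> \<Longrightarrow> P0 R > 0"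
    and P0': "(P0 has_real_derivative P0') (at R0)"
    and c: "P0' + (real DIM('a) - 1) * P0 R0 / R0 < c"
  shows "barrier_point p (\<lambda>z. \<Psi>0 (norm (fst z - y)) + c * snd z) (x0, t0)"
proof -
  have n: "real DIM('a) \<ge> 1" using DIM_positive[where 'a='a] by linarith
  obtain d k c' e \<Psi>1 P1 where d: "0 < d" "d < R0" "c' < c" "e > 0" "e < R0 - d" "e < \<rho>"
    and P1: "\<And>R. P1 R = k * R powr (1 - real DIM('a)) + c' * R / real DIM('a)"
    "\<And>R. \<bar>R - (R0 - d)\<bar> < e \<Longrightarrow> P1 R > 0"
    and \<Psi>1: "\<And>R. \<bar>R - (R0 - d)\<bar> < e \<Longrightarrow> (\<Psi>1 has_real_derivative P1 R powr (1 / (p - 1))) (at R)"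
    and strict: "\<And>R. \<bar>R - (R0 - d)\<bar> < e \<Longrightarrow> R \<noteq> R0 - d \<Longrightarrow> \<Psi>0 (R + d) - \<Psi>1 R < \<Psi>0 R0 - \<Psi>1 (R0 - d)"
    by (rule radial_touching_profile[OF p n R0(2) \<rho> \<Psi>0 P0 P0' c]) blast+
  define R1 where "R1 = R0 - d"
  define y' where "y' = y + (d / R0) *\<^sub>R (x0 - y)"
  have y'y: "y' - y = (d / R0) *\<^sub>R (x0 - y)" by (simp add: y'_def)
  have x0y': "x0 - y' = (R1 / R0) *\<^sub>R (x0 - y)"
  proof -
    have "x0 - y' = (1 - d / R0) *\<^sub>R (x0 - y)" by (simp add: y'_def algebra_simps)
    also have "1 - d / R0 = R1 / R0" using R0(2) by (simp add: R1_def field_simps)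
    finally show ?thesis .
  qed
  have R1: "R1 > 0" using d by (simp add: R1_def)
  have nx0: "norm (x0 - y') = R1" using x0y' R0 R1 by simp
  have ny': "norm (y' - y) = d" using y'y R0 d by simp
  let ?X = "{x. R1 - e < norm (x - y') \<and> norm (x - y') < R1 + e}"
  \<comment> \<open>This constant makes H agree with the given function at (x0, t0), where the
    distance to y' is R1.\<close>
  define K where "K = \<Psi>0 R0 - \<Psi>1 R1 + (c - c') * t0"
  define H where "H z = (\<Psi>1 (norm (fst z - y')) + c' * snd z) + K" for z :: "'a \<times> real"
  have X: "open ?X"
  proof -
    have "open {x. R1 - e < norm (x - y')}" "open {x. norm (x - y') < R1 + e}"
      by (intro open_Collect_less continuous_intros)+
    then show ?thesis by (simp add: Collect_conj_eq open_Int)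
  qed
  have H: "exact_solution p ?X H"
    unfolding H_def[abs_def]
  proof (rule exact_solution_add_const, rule exact_solution_radial[OF p])
    show "R1 - e \<ge> 0" using d by (simp add: R1_def)
    show "(\<Psi>1 has_real_derivative P1 R powr (1 / (p - 1))) (at R)" if "R1 - e < R" "R < R1 + e" for R
      using \<Psi>1[of R] that by (simp add: R1_def abs_less_iff)
    show "P1 R > 0" if "R1 - e < R" "R < R1 + e" for R
      using P1(2)[of R] that by (simp add: R1_def abs_less_iff)
    show "P1 R = k * R powr (1 - real DIM('a)) + c' * R / real DIM('a)" for R by (rule P1(1))
  qed
  have H0: "H (x0, t0) = \<Psi>0 (norm (x0 - y)) + c * t0"
    by (simp add: H_def K_def nx0 R0(1)[symmetric] algebra_simps)
  have mono: "\<Psi>0 a < \<Psi>0 b" if "a < b" "\<bar>a - R0\<bar> < \<rho>" "\<bar>b - R0\<bar> < \<rho>" for a b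
  proof (rule DERIV_pos_imp_increasing[OF that(1)])
    fix x assume "a \<le> x" "x \<le> b"
    then have x: "\<bar>x - R0\<bar> < \<rho>" using that by (simp add: abs_less_iff)
    then show "\<exists>y. (\<Psi>0 has_real_derivative y) (at x) \<and> y > 0" using \<Psi>0[OF x] P0[OF x] by auto
  qed
  have lt: "\<Psi>0 (norm (x - y)) + c * t < H (x, t)"
    if near: "norm (x - x0) < e" and t: "t \<le> t0" and ne: "(x, t) \<noteq> (x0, t0)" for x t
  proof -
    define R where "R = norm (x - y')"
    have Re: "\<bar>R - R1\<bar> < e"
    proof -
      have "\<bar>norm (x - y') - norm (x0 - y')\<bar> \<le> norm ((x - y') - (x0 - y'))" by (rule norm_triangle_ineq3)
      then show ?thesis using near by (simp add: R_def nx0)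
    qed
    have r1: "\<bar>norm (x - y) - R0\<bar> < \<rho>"
    proof -
      have "\<bar>norm (x - y) - norm (x0 - y)\<bar> \<le> norm ((x - y) - (x0 - y))" by (rule norm_triangle_ineq3)
      then show ?thesis using near d by (simp add: R0(1))
    qed
    have r2: "\<bar>R + d - R0\<bar> < \<rho>" using Re d by (simp add: R1_def)
    have tri: "norm (x - y) \<le> R + d"
      using norm_triangle_ineq[of "x - y'" "y' - y"] by (simp add: R_def ny')
    have le1: "\<Psi>0 (norm (x - y)) \<le> \<Psi>0 (R + d)" using mono[of "norm (x - y)" "R + d"] tri r1 r2 by fastforce
    have le2: "\<Psi>0 (R + d) - \<Psi>1 R \<le> \<Psi>0 R0 - \<Psi>1 R1"
      using strict[of R] Re by (cases "R = R1") (auto simp: R1_def)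
    have le3: "0 \<le> (c - c') * (t0 - t)" using d t by simp
    have Heq: "H (x, t) - (\<Psi>0 (norm (x - y)) + c * t) = (\<Psi>0 (R + d) - \<Psi>0 (norm (x - y)))
        + ((\<Psi>0 R0 - \<Psi>1 R1) - (\<Psi>0 (R + d) - \<Psi>1 R)) + (c - c') * (t0 - t)"
      by (simp add: H_def K_def R_def algebra_simps)
    \<comment> \<open>The first three cases each make one of the nonnegative summands in
      \<open>Heq\<close> positive. The last is equality in the triangle inequality, which puts x on
      the ray through x0 at the same distance, so x = x0.\<close>
    consider "t \<noteq> t0" | "R \<noteq> R1" | "norm (x - y) < R + d" | "t = t0" "R = R1" "norm (x - y) = R + d"
      using tri by linarith
    then show ?thesis
    proof cases
      case 1
      then have "0 < (c - c') * (t0 - t)" using d t by simp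
      then show ?thesis using Heq le1 le2 by linarith
    next
      case 2
      then have "\<Psi>0 (R + d) - \<Psi>1 R < \<Psi>0 R0 - \<Psi>1 R1" using strict[of R] Re by (simp add: R1_def)
      then show ?thesis using Heq le1 le3 by linarith
    next
      case 3
      then have "\<Psi>0 (norm (x - y)) < \<Psi>0 (R + d)" using mono[OF _ r1 r2] by blast
      then show ?thesis using Heq le2 le3 by linarith
    next
      case 4
      have "norm ((x - y') + (y' - y)) = norm (x - y') + norm (y' - y)"
        using 4 by (simp add: R_def ny')
      then have "norm (x - y') *\<^sub>R (y' - y) = norm (y' - y) *\<^sub>R (x - y')" by (simp only: norm_triangle_eq)
      then have "R1 *\<^sub>R (y' - y) = d *\<^sub>R (x - y')" using 4 by (simp add: R_def ny')
      also have "R1 *\<^sub>R (y' - y) = d *\<^sub>R (x0 - y')" by (simp add: y'y x0y' mult.commute)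
      finally have "x = x0" using d by simp
      then show ?thesis using ne 4 by simp
    qed
  qed
  have "\<Psi>0 (norm (fst z - y)) + c * snd z < H z"
    if z: "z \<in> ball (x0, t0) e" "snd z \<le> snd (x0, t0)" "z \<noteq> (x0, t0)" for z
  proof -
    have "norm (fst z - x0) < e"
      using z(1) dist_fst_le[of "(x0, t0)" z] by (simp add: dist_norm norm_minus_commute)
    then show ?thesis using lt[of "fst z" "snd z"] z by simp
  qed
  then show ?thesis unfolding barrier_point_def
    using X H H0 d by (intro exI[of _ ?X] exI[of _ H] exI[of _ e]) (auto simp: nx0)
qed

section \<open>Construction of a barrier at the tip of the cone\<close>

text \<open>\<open>m0\<close> is a global bound that survives the iteration, whereas
  \<open>m\<close> bounds w near the origin and is lowered in every step. Only t \<le> 0 is covered,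
  the range in which the cone is known to avoid \<Theta>.\<close>

definition past_barrier ::
    "real \<Rightarrow> ('a::euclidean_space \<times> real) set \<Rightarrow> real \<Rightarrow> real \<Rightarrow> real \<Rightarrow> real \<Rightarrow>
     ('a \<times> real \<Rightarrow> real) \<Rightarrow> bool" where
  "past_barrier p \<Theta> M \<rho> m0 m w \<longleftrightarrow>
     (\<forall>z\<in>\<Theta>. snd z \<le> 0 \<longrightarrow> 0 \<le> w z \<and> w z \<le> m0 \<and> barrier_point p w z \<and> (\<rho> \<le> norm z \<longrightarrow> M \<le> w z)) \<and>
     lower_semicontinuous_on (\<Theta> \<inter> {z. snd z \<le> 0}) (\<lambda>z. ereal (w z)) \<and>
     (\<exists>d>0. \<forall>z\<in>\<Theta>. snd z \<le> 0 \<longrightarrow> norm z < d \<longrightarrow> w z \<le> m)"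

text \<open>A function of t alone has zero flux, so any positive slope makes it a strict
  supersolution. T bounds |t| on \<Theta>, which keeps the values between M and M + T in the
  past.\<close>

lemma past_barrier_start:
  fixes \<Theta> :: "('a::euclidean_space \<times> real) set"
  assumes p: "p > 1" and M: "M \<ge> 0" and T: "\<And>z. z \<in> \<Theta> \<Longrightarrow> norm z \<le> T"
  shows "past_barrier p \<Theta> M \<rho> (M + T) (M + T) (\<lambda>z. M + T + snd z)"
proof -
  have low: "- T \<le> snd z" if "z \<in> \<Theta>" for z
    using T[OF that] norm_snd_le[of "snd z" "fst z"] by simp
  have bar: "barrier_point p (\<lambda>z. M + T + snd z) z" for z :: "'a \<times> real"
    using barrier_point_power_centre[OF p _ refl, of 0 1 "fst z" "M + T" "snd z"]
    by (simp add: add.commute)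
  have "continuous_on (\<Theta> \<inter> {z. snd z \<le> 0}) (\<lambda>z. M + T + snd z)" by (intro continuous_intros)
  then have "lower_semicontinuous_on (\<Theta> \<inter> {z. snd z \<le> 0}) (\<lambda>z. ereal (M + T + snd z))"
    by (rule lower_semicontinuous_on_continuous)
  moreover have "\<exists>d>0. \<forall>z\<in>\<Theta>. snd z \<le> 0 \<longrightarrow> norm z < d \<longrightarrow> M + T + snd z \<le> M + T"
    by (intro exI[of _ 1]) simp
  moreover have "0 \<le> M + T + snd z \<and> M + T + snd z \<le> M + T \<and> M \<le> M + T + snd z"
    if "z \<in> \<Theta>" "snd z \<le> 0" for z
    using low[OF that(1)] that(2) M by simp
  ultimately show ?thesis unfolding past_barrier_def using bar by blast
qed

text \<open>The radial flux \<open>R \<mapsto> b R\<^sup>-\<^sup>(\<^sup>n\<^sup>+\<^sup>p\<^sup>-\<^sup>1\<^sup>)\<close> has divergence \<open>- p b R\<^sup>-\<^sup>(\<^sup>n\<^sup>+\<^sup>p\<^sup>)\<close>, which at scale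
  \<open>s\<close> is of order \<open>s\<^sup>-\<^sup>p\<close> and for small \<open>s\<close> beats the time slope of order \<open>1 / s\<close>: this is where
  \<open>p > 1\<close> enters.\<close>

lemma barrier_point_annulus:
  fixes y x0 :: "'a::euclidean_space"
  assumes p: "p > 1" and K: "K = real DIM('a) / (p - 1)" and \<beta>: "\<beta> > 0" and s: "s > 0"
    and R0: "norm (x0 - y) = R0" "0 < R0" "R0 \<le> 5 * s"
    and small: "\<gamma> * s powr p < p * (\<beta> * K) powr (p - 1) * 5 powr (- (real DIM('a) + p))"
  shows "barrier_point p (\<lambda>z. \<beta> * (L - (norm (fst z - y) / s) powr (- K)) - \<gamma> * snd z) (x0, t0)"
proof -
  let ?n = "real DIM('a)"
  have n: "?n > 0" by simp
  have K0: "K > 0" using K p n by simp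
  \<comment> \<open>The slope of \<Psi> is \<beta> K s^K R^(-K-1). Its power p - 1 is the flux b
    R^(-\<mu>), because K (p - 1) is the dimension n and (K + 1) (p - 1) = \<mu>.\<close>
  define \<mu> where "\<mu> = ?n + p - 1"
  define b where "b = (\<beta> * K) powr (p - 1) * s powr ?n"
  have b: "b > 0" using \<beta> K0 s by (simp add: b_def)
  define P where "P R = b * R powr (- \<mu>)" for R
  define \<Psi> where "\<Psi> R = \<beta> * (L - (R / s) powr (- K))" for R
  have Kp: "K * (p - 1) = ?n" using p by (simp add: K)
  have D: "(\<Psi> has_real_derivative P R powr (1 / (p - 1))) (at R)" if R: "R > 0" for R
  proof -
    have "((\<lambda>R. s powr K * R powr (- K)) has_real_derivative s powr K * (- K * R powr (- K - 1))) (at R)"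
      by (rule DERIV_cmult[OF has_real_derivative_powr[OF R]])
    from DERIV_cmult[OF DERIV_diff[OF DERIV_const this], of \<beta> L]
    have 1: "((\<lambda>R. \<beta> * (L - s powr K * R powr (- K))) has_real_derivative
        \<beta> * K * s powr K * R powr (- K - 1)) (at R)" by (simp add: algebra_simps)
    have ev: "\<forall>\<^sub>F R in nhds R. \<Psi> R = \<beta> * (L - s powr K * R powr (- K))"
      using eventually_nhds_in_open[of "{0<..}" R] R
      by (auto elim!: eventually_mono simp: \<Psi>_def powr_divide powr_minus_divide s)
    have "P R powr (1 / (p - 1)) = (\<beta> * K) powr ((p - 1) * (1 / (p - 1))) * s powr (?n * (1 / (p - 1)))
        * R powr (- \<mu> * (1 / (p - 1)))"
      using \<beta> K0 s R by (simp add: P_def b_def powr_mult powr_powr)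
    also have "(p - 1) * (1 / (p - 1)) = 1" using p by simp
    also have "?n * (1 / (p - 1)) = K" by (simp add: K)
    also have "- \<mu> * (1 / (p - 1)) = - K - 1" using p by (simp add: \<mu>_def K field_simps)
    finally have 2: "P R powr (1 / (p - 1)) = \<beta> * K * s powr K * R powr (- K - 1)"
      using \<beta> K0 by simp
    show ?thesis unfolding 2 using DERIV_cong_ev[OF refl ev refl] 1 by blast
  qed
  have P': "(P has_real_derivative b * (- \<mu> * R0 powr (- \<mu> - 1))) (at R0)"
    unfolding P_def[abs_def] by (rule DERIV_cmult[OF has_real_derivative_powr[OF R0(2)]])
  have c: "b * (- \<mu> * R0 powr (- \<mu> - 1)) + (?n - 1) * P R0 / R0 < - \<gamma>"
  proof -
    have e: "R0 powr (- \<mu>) / R0 = R0 powr (- \<mu> - 1)"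
      using R0(2) powr_diff[of R0 "- \<mu>" 1] by simp
    have "(?n - 1) * P R0 / R0 = (?n - 1) * (b * (R0 powr (- \<mu>) / R0))" by (simp add: P_def)
    then have "b * (- \<mu> * R0 powr (- \<mu> - 1)) + (?n - 1) * P R0 / R0
       = - (p * (b * R0 powr (- \<mu> - 1)))"
      unfolding e by (simp add: \<mu>_def algebra_simps)
    moreover have "\<gamma> < p * (b * R0 powr (- \<mu> - 1))"
    proof -
      have pos: "s powr p > 0" using s by simp
      have "b * (5 * s) powr (- \<mu> - 1) * s powr p
          = (\<beta> * K) powr (p - 1) * 5 powr (- \<mu> - 1) * (s powr ?n * s powr (- \<mu> - 1) * s powr p)"
        using s by (simp add: b_def powr_mult)
      also have "s powr ?n * s powr (- \<mu> - 1) * s powr p = s powr (?n + (- \<mu> - 1) + p)"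
        unfolding powr_add ..
      also have "?n + (- \<mu> - 1) + p = 0" by (simp add: \<mu>_def)
      also have "- \<mu> - 1 = - (?n + p)" by (simp add: \<mu>_def)
      finally have e2: "b * (5 * s) powr (- \<mu> - 1) * s powr p = (\<beta> * K) powr (p - 1) * 5 powr (- (?n + p))"
        using s by (simp add: \<mu>_def)
      have "\<gamma> * s powr p < p * (b * (5 * s) powr (- \<mu> - 1) * s powr p)"
        using small unfolding e2 by (simp add: mult.assoc)
      then have "\<gamma> * s powr p < (p * (b * (5 * s) powr (- \<mu> - 1))) * s powr p" by (simp add: mult.assoc)
      then have "\<gamma> < p * (b * (5 * s) powr (- \<mu> - 1))" using pos by (simp only: mult_less_cancel_right_pos)
      also have "\<dots> \<le> p * (b * R0 powr (- \<mu> - 1))"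
      proof -
        have "- \<mu> - 1 \<le> 0" using p n by (simp add: \<mu>_def)
        then have "(5 * s) powr (- \<mu> - 1) \<le> R0 powr (- \<mu> - 1)"
          using R0(2,3) by (rule powr_mono2')
        then show ?thesis using p b by (intro mult_left_mono) auto
      qed
      finally show ?thesis .
    qed
    ultimately show ?thesis by linarith
  qed
  have pos: "R > 0" if "\<bar>R - R0\<bar> < R0" for R using that by (simp add: abs_less_iff)
  have Dr: "(\<Psi> has_real_derivative P R powr (1 / (p - 1))) (at R)" if "\<bar>R - R0\<bar> < R0" for R
    by (rule D[OF pos[OF that]])
  have Pr: "P R > 0" if "\<bar>R - R0\<bar> < R0" for R using pos[OF that] b by (simp add: P_def)
  have "barrier_point p (\<lambda>z. \<Psi> (norm (fst z - y)) + (- \<gamma>) * snd z) (x0, t0)"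
    by (rule barrier_point_radial[OF p R0(1)[symmetric] R0(2) R0(2) Dr Pr P' c])
  then show ?thesis by (simp add: \<Psi>_def)
qed

text \<open>Off the origin the radial flux is (A q)^(p-1) R with divergence n (A q)^(p-1), and the
  radial lemma applies; the origin itself is left to the centred version.\<close>

lemma barrier_point_power:
  fixes x0 :: "'a::euclidean_space"
  assumes p: "p > 1" and A: "A > 0" and q: "q = p / (p - 1)"
    and c: "real DIM('a) * (A * q) powr (p - 1) < c"
  shows "barrier_point p (\<lambda>z. k + A * norm (fst z) powr q + c * snd z) (x0, t0)"
proof (cases "x0 = 0")
  case True
  then show ?thesis using barrier_point_power_centre[OF p less_imp_le[OF A] q c, of 0 k t0]
    by (simp add: add.commute add.left_commute)
next
  case False
  define R0 where "R0 = norm (x0 - 0)"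
  have R0: "R0 > 0" using False by (simp add: R0_def)
  have q0: "q > 0" "q - 1 = 1 / (p - 1)" using p by (auto simp: q field_simps)
  define P where "P R = (A * q) powr (p - 1) * R" for R
  define \<Psi> where "\<Psi> R = k + A * R powr q" for R
  have D: "(\<Psi> has_real_derivative P R powr (1 / (p - 1))) (at R)" if "\<bar>R - R0\<bar> < R0" for R
  proof -
    have R: "R > 0" using that by (simp add: abs_less_iff)
    have "(\<Psi> has_real_derivative A * (q * R powr (q - 1))) (at R)"
      unfolding \<Psi>_def[abs_def]
      using DERIV_add[OF DERIV_const DERIV_cmult[OF has_real_derivative_powr[OF R, of q], of A], of k] by simp
    also have "A * (q * R powr (q - 1)) = P R powr (1 / (p - 1))"
      using A q0(1) R p by (simp add: P_def powr_mult powr_powr q0(2))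
    finally show ?thesis .
  qed
  have P: "P R > 0" if "\<bar>R - R0\<bar> < R0" for R
    using that A q0 by (simp add: P_def abs_less_iff)
  have P': "(P has_real_derivative (A * q) powr (p - 1)) (at R0)"
    unfolding P_def[abs_def] using DERIV_cmult[OF DERIV_ident, of "(A * q) powr (p - 1)" R0] by simp
  have "(A * q) powr (p - 1) + (real DIM('a) - 1) * P R0 / R0 < c"
  proof -
    have "(real DIM('a) - 1) * P R0 / R0 = (real DIM('a) - 1) * (A * q) powr (p - 1)"
      using R0 by (simp add: P_def)
    then show ?thesis using c by (simp add: left_diff_distrib)
  qed
  from barrier_point_radial[OF p R0_def R0 R0 D P P' this]
  show ?thesis by (simp add: \<Psi>_def)
qed

text \<open>With y = s v, the new function \<phi> is tuned by its constants. \<open>L\<close> makes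
  it nonnegative for |x - y| \<ge> \<sigma> s, which \<open>ext\<close> ensures on the part of
  \<Theta> concerned; \<open>\<beta>\<close> makes its radial part equal to m at |x - y| = 2 s,
  hence at least m where |x| > 3 s; \<open>\<gamma>\<close> makes its time part at least m for t
  \<le> - \<tau>/2. At the tip |x - y| = s, and the value is m (L - 1) / (L - 2^(-K)) < m. The
  factor q lies midway between this ratio and 1, so the bound q m persists in a
  neighbourhood.\<close>

lemma past_barrier_step:
  fixes \<Theta> :: "('a::euclidean_space \<times> real) set"
  assumes p: "p > 1" and K: "K = real DIM('a) / (p - 1)" and v: "norm (v :: 'a) = 1"
    and \<sigma>: "0 < \<sigma>" "\<sigma> < 1" and \<kappa>: "0 < \<kappa>" "\<kappa> \<le> 1" and r: "r > 0" and \<rho>: "\<rho> > 0"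
    and ext: "\<And>s x t. 0 < s \<Longrightarrow> s < r \<Longrightarrow> - (\<kappa> * s) \<le> t \<Longrightarrow> t \<le> 0 \<Longrightarrow> norm (x - s *\<^sub>R v) \<le> \<sigma> * s \<Longrightarrow>
      (x, t) \<notin> \<Theta>"
    and q: "q = (1 + (\<sigma> powr (- K) - 1) / (\<sigma> powr (- K) - 2 powr (- K))) / 2"
    and m: "m > 0" and w: "past_barrier p \<Theta> M \<rho> m0 m w"
  shows "\<exists>w'. past_barrier p \<Theta> M \<rho> m0 (q * m) w'"
proof -
  let ?n = "real DIM('a)"
  define L where "L = \<sigma> powr (- K)"
  have K0: "K > 0" using K p by simp
  have L1: "L > 1"
    using powr_less_mono2_neg[of "- K" \<sigma> 1] \<sigma> K0 by (simp add: L_def)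
  have two: "2 powr (- K) < (1::real)"
    using powr_less_mono2_neg[of "- K" 1 2] K0 by simp
  have two0: "2 powr (- K) > (0::real)" by simp
  define \<beta> where "\<beta> = m / (L - 2 powr (- K))"
  have \<beta>: "\<beta> > 0" using m L1 two by (simp add: \<beta>_def)
  obtain d where d: "d > 0" "\<And>z. z \<in> \<Theta> \<Longrightarrow> snd z \<le> 0 \<Longrightarrow> norm z < d \<Longrightarrow> w z \<le> m"
    using w unfolding past_barrier_def by blast
  \<comment> \<open>The smallness condition of \<open>barrier_point_annulus\<close> solved for
    s^(p-1): with the slope \<gamma> = 2 m / (\<kappa> s) its left side is (2 m / \<kappa>)
    s^(p-1).\<close>
  define c0 where "c0 = p * (\<beta> * K) powr (p - 1) * 5 powr (- (?n + p)) * \<kappa> / (2 * m)"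
  have c0: "c0 > 0" using p \<beta> K0 \<kappa> m by (simp add: c0_def)
  have "((\<lambda>s::real. s powr (p - 1)) \<longlongrightarrow> 0 powr (p - 1)) (at_right 0)"
    by (rule tendsto_powr'[OF tendsto_ident_at tendsto_const]) (use p in \<open>auto simp: eventually_at_filter\<close>)
  then have "\<forall>\<^sub>F s in at_right 0. (s::real) powr (p - 1) < c0"
    using c0 p by (intro order_tendstoD) auto
  moreover have "\<forall>\<^sub>F s in at_right 0. (s::real) \<in> {0<..<min (min (d / 5) (\<rho> / 5)) r}"
    by (rule eventually_at_right_real) (use d \<rho> r in auto)
  ultimately have "\<forall>\<^sub>F s in at_right 0. (s::real) powr (p - 1) < c0 \<and> s \<in> {0<..<min (min (d / 5) (\<rho> / 5)) r}"
    by eventually_elim simp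
  from eventually_happens'[OF trivial_limit_at_right_real this]
  obtain s where "s powr (p - 1) < c0 \<and> s \<in> {0<..<min (min (d / 5) (\<rho> / 5)) r}" by blast
  then have s: "s powr (p - 1) < c0" "0 < s" "5 * s < d" "5 * s < \<rho>" "s < r" by auto
  define \<tau> where "\<tau> = \<kappa> * s"
  have \<tau>: "\<tau> > 0" "\<tau> \<le> s" using \<kappa> s by (auto simp: \<tau>_def)
  define \<gamma> where "\<gamma> = 2 * m / \<tau>"
  have \<gamma>: "\<gamma> > 0" using m \<tau> by (simp add: \<gamma>_def)
  have small: "\<gamma> * s powr p < p * (\<beta> * K) powr (p - 1) * 5 powr (- (?n + p))"
  proof -
    have "s powr p = s powr (p - 1) * s" using s powr_add[of s "p - 1" 1] by simp
    then have "\<gamma> * s powr p = (2 * m / \<kappa>) * s powr (p - 1)" using s by (simp add: \<gamma>_def \<tau>_def)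
    also have "\<dots> < (2 * m / \<kappa>) * c0" using s(1) m \<kappa> by (intro mult_strict_left_mono) auto
    also have "\<dots> = p * (\<beta> * K) powr (p - 1) * 5 powr (- (?n + p))"
      using m \<kappa> by (simp add: c0_def)
    finally show ?thesis .
  qed
  define y where "y = s *\<^sub>R v"
  have ny: "norm y = s" using v s by (simp add: y_def)
  define \<phi> where "\<phi> z = \<beta> * (L - (norm (fst z - y) / s) powr (- K)) - \<gamma> * snd z" for z :: "'a \<times> real"
  \<comment> \<open>Wider than the set |x| \<le> 3 s, t \<ge> - \<tau>/2 where \<phi> can undercut
    w. So w' = w near the edge of \<open>reg\<close> in the past, which saves semicontinuity there;
    and norms below 5 s < d keep w \<le> m on it.\<close>
  define reg where "reg = {z :: 'a \<times> real. norm (fst z) < 4 * s \<and> - \<tau> < snd z}"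
  have oreg: "open reg"
  proof -
    have "open {z :: 'a \<times> real. norm (fst z) < 4 * s}" "open {z :: 'a \<times> real. - \<tau> < snd z}"
      by (intro open_Collect_less continuous_intros)+
    then show ?thesis by (simp add: reg_def Collect_conj_eq open_Int)
  qed
  have reg_norm: "norm z < 5 * s" if "z \<in> reg" "snd z \<le> 0" for z
  proof -
    have "norm z \<le> norm (fst z) + norm (snd z)" using norm_Pair_le[of "fst z" "snd z"] by simp
    then show ?thesis using that \<tau> by (simp add: reg_def)
  qed
  have reg_w: "w z \<le> m" if "z \<in> reg" "snd z \<le> 0" "z \<in> \<Theta>" for z
    using d(2)[of z] reg_norm[OF that(1,2)] s that by simp
  have far: "norm (fst z - y) > \<sigma> * s" if "z \<in> reg" "snd z \<le> 0" "z \<in> \<Theta>" for z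
    using ext[OF s(2,5), of "snd z" "fst z"] that by (force simp: reg_def \<tau>_def y_def)
  have \<phi>lin: "\<beta> * (L - (norm (fst z - y) / s) powr (- K)) \<le> \<phi> z" if "snd z \<le> 0" for z
    using that \<gamma> by (simp add: \<phi>_def mult_nonneg_nonpos)
  have rad0: "0 \<le> \<beta> * (L - (norm (fst z - y) / s) powr (- K))"
    if "z \<in> reg" "snd z \<le> 0" "z \<in> \<Theta>" for z
  proof -
    have "\<sigma> \<le> norm (fst z - y) / s" using far[OF that] s by (simp add: pos_le_divide_eq)
    then have "(norm (fst z - y) / s) powr (- K) \<le> L"
      unfolding L_def using \<sigma> K0 by (intro powr_mono2') auto
    then show ?thesis using \<beta> by simp
  qed
  have \<phi>0: "0 \<le> \<phi> z" if "z \<in> reg" "snd z \<le> 0" "z \<in> \<Theta>" for z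
    using rad0[OF that] \<phi>lin[OF that(2)] by linarith
  have outer: "w z \<le> \<phi> z" if z: "z \<in> reg" "snd z \<le> 0" "z \<in> \<Theta>"
    and out: "3 * s < norm (fst z) \<or> snd z < - (\<tau> / 2)" for z
  proof -
    have "m \<le> \<phi> z" using out
    proof
      assume "3 * s < norm (fst z)"
      then have "2 * s \<le> norm (fst z - y)"
        using norm_triangle_ineq2[of "fst z" y] ny by linarith
      then have "2 \<le> norm (fst z - y) / s" using s by (simp add: pos_le_divide_eq)
      then have "(norm (fst z - y) / s) powr (- K) \<le> 2 powr (- K)"
        using K0 by (intro powr_mono2') auto
      then have "\<beta> * (L - 2 powr (- K)) \<le> \<beta> * (L - (norm (fst z - y) / s) powr (- K))"
        using \<beta> by (intro mult_left_mono) auto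
      moreover have "\<beta> * (L - 2 powr (- K)) = m" using L1 two by (simp add: \<beta>_def)
      ultimately show ?thesis using \<phi>lin[OF z(2)] by linarith
    next
      assume "snd z < - (\<tau> / 2)"
      then have "\<gamma> * (\<tau> / 2) \<le> \<gamma> * (- snd z)" using \<gamma> by (intro mult_left_mono) auto
      moreover have "\<gamma> * (\<tau> / 2) = m" using \<tau> by (simp add: \<gamma>_def)
      ultimately show ?thesis using rad0[OF z] by (simp add: \<phi>_def)
    qed
    then show ?thesis using reg_w[OF z] by linarith
  qed
  define w' where "w' z = (if z \<in> reg then min (w z) (\<phi> z) else w z)" for z
  have w'w: "w' z \<le> w z" for z by (simp add: w'_def)
  have far0: "norm (fst z - y) > 0" if "z \<in> reg" "snd z \<le> 0" "z \<in> \<Theta>" for z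
    using far[OF that] \<sigma> s by (meson less_trans mult_pos_pos)
  have bar: "barrier_point p w' z" if z: "z \<in> \<Theta>" "snd z \<le> 0" for z
  proof (cases "z \<in> reg \<and> \<phi> z < w z")
    case True
    then obtain e where e: "e > 0" "ball z e \<subseteq> reg" using oreg openE by blast
    have "norm (fst z - y) \<le> 5 * s"
      using norm_triangle_ineq4[of "fst z" y] True ny by (simp add: reg_def)
    then have "barrier_point p \<phi> (fst z, snd z)"
      unfolding \<phi>_def[abs_def]
      by (intro barrier_point_annulus[OF p K \<beta> s(2) refl _ _ small] far0) (use True z in auto)
    then have "barrier_point p \<phi> z" by simp
    then show ?thesis
      by (rule barrier_point_le[where e=e]) (use e True in \<open>auto simp: w'_def\<close>)
  next
    case False
    have "barrier_point p w z" using w z unfolding past_barrier_def by blast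
    then show ?thesis
      by (rule barrier_point_le[where e=1]) (use False w'w in \<open>auto simp: w'_def\<close>)
  qed
  let ?P = "\<Theta> \<inter> {z. snd z \<le> 0}"
  have wlsc: "lower_semicontinuous_on ?P (\<lambda>z. ereal (w z))" using w unfolding past_barrier_def by blast
  have lsc: "lower_semicontinuous_on ?P (\<lambda>z. ereal (w' z))"
  proof (rule lower_semicontinuous_onI)
    fix z c assume z: "z \<in> ?P" and c: "c < ereal (w' z)"
    then have "c < ereal (w z)" using w'w[of z] by (meson ereal_less_eq(3) less_le_trans)
    then obtain U where U: "open U" "z \<in> U" "\<And>y. y \<in> U \<Longrightarrow> y \<in> ?P \<Longrightarrow> c < ereal (w y)"
      using lower_semicontinuous_onD[OF wlsc z] by blast
    show "\<exists>U. open U \<and> z \<in> U \<and> (\<forall>y\<in>U. y \<in> ?P \<longrightarrow> c < ereal (w' y))"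
    proof (cases "z \<in> reg")
      case True
      let ?Y = "{x :: 'a \<times> real. 0 < norm (fst x - y)}"
      have "continuous_on ?Y \<phi>" unfolding \<phi>_def
        by (intro continuous_intros) (use s in auto)
      from lower_semicontinuous_on_continuous[OF this]
      have l: "lower_semicontinuous_on ?Y (\<lambda>z. ereal (\<phi> z))" .
      have "z \<in> ?Y" using far0 True z by auto
      moreover have "c < ereal (\<phi> z)"
      proof -
        have "w' z \<le> \<phi> z" using True by (simp add: w'_def)
        then show ?thesis using c by (meson ereal_less_eq(3) less_le_trans)
      qed
      ultimately obtain U2 where U2: "open U2" "z \<in> U2" "\<And>x. x \<in> U2 \<Longrightarrow> x \<in> ?Y \<Longrightarrow> c < ereal (\<phi> x)"
        using lower_semicontinuous_onD[OF l] by blast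
      have "c < ereal (w' x)" if "x \<in> U \<inter> U2 \<inter> reg" "x \<in> ?P" for x
        using U(3)[of x] U2(3)[of x] far0[of x] that by (auto simp: w'_def min_def)
      then show ?thesis using U U2 oreg True by (intro exI[of _ "U \<inter> U2 \<inter> reg"]) auto
    next
      case False
      let ?O = "{x :: 'a \<times> real. 3 * s < norm (fst x)} \<union> {x. snd x < - (\<tau> / 2)}"
      have "open ?O" by (intro open_Un open_Collect_less continuous_intros)
      moreover have "z \<in> ?O" using False s \<tau> by (auto simp: reg_def)
      moreover have "c < ereal (w' x)" if "x \<in> U \<inter> ?O" "x \<in> ?P" for x
      proof -
        have "w' x = w x" using outer[of x] that by (auto simp: w'_def)
        then show ?thesis using U(3) that by simp
      qed
      ultimately show ?thesis using U by (intro exI[of _ "U \<inter> ?O"]) auto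
    qed
  qed
  have near: "\<exists>d>0. \<forall>z\<in>\<Theta>. snd z \<le> 0 \<longrightarrow> norm z < d \<longrightarrow> w' z \<le> q * m"
  proof -
    have q0: "\<beta> * (L - 1) < q * m"
    proof -
      define X where "X = (L - 1) / (L - 2 powr (- K))"
      have e: "q = (1 + X) / 2" by (simp add: q L_def X_def)
      have "X < 1" using L1 two by (simp add: X_def)
      then have "X < q" unfolding e by simp
      then have "X * m < q * m" using m by simp
      moreover have "\<beta> * (L - 1) = X * m" by (simp add: \<beta>_def X_def)
      ultimately show ?thesis by simp
    qed
    have "continuous_on {z :: 'a \<times> real. 0 < norm (fst z - y)} \<phi>" unfolding \<phi>_def
      by (intro continuous_intros) (use s in auto)
    moreover have "open {z :: 'a \<times> real. 0 < norm (fst z - y)}" by (intro open_Collect_less continuous_intros)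
    moreover have "0 \<in> {z :: 'a \<times> real. 0 < norm (fst z - y)}" using ny s by auto
    ultimately have "isCont \<phi> 0" using continuous_on_eq_continuous_at by blast
    then have "(\<phi> \<longlongrightarrow> \<phi> 0) (nhds 0)" unfolding isCont_def by (simp add: tendsto_at_iff_tendsto_nhds)
    moreover have "\<phi> 0 = \<beta> * (L - 1)" using ny s by (simp add: \<phi>_def)
    ultimately have "\<forall>\<^sub>F z in nhds 0. \<phi> z < q * m" using q0 by (intro order_tendstoD(2)[of \<phi>]) auto
    moreover have "\<forall>\<^sub>F z in nhds 0. z \<in> reg" by (rule eventually_nhds_in_open[OF oreg]) (use s \<tau> in \<open>simp add: reg_def\<close>)
    ultimately have "\<forall>\<^sub>F z in nhds 0. w' z \<le> q * m" by eventually_elim (simp add: w'_def)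
    then obtain e where "e > 0" "\<And>z. dist z 0 < e \<Longrightarrow> w' z \<le> q * m" unfolding eventually_nhds_metric by blast
    then show ?thesis by (intro exI[of _ e]) auto
  qed
  have "0 \<le> w' z \<and> w' z \<le> m0 \<and> (\<rho> \<le> norm z \<longrightarrow> M \<le> w' z)" if z: "z \<in> \<Theta>" "snd z \<le> 0" for z
  proof -
    have wz: "0 \<le> w z" "w z \<le> m0" "\<rho> \<le> norm z \<longrightarrow> M \<le> w z" using w z unfolding past_barrier_def by blast+
    have "0 \<le> w' z" using wz(1) \<phi>0[of z] z by (simp add: w'_def)
    moreover have "w' z = w z" if "\<rho> \<le> norm z"
      using reg_norm[of z] that z s by (auto simp: w'_def)
    ultimately show ?thesis using wz w'w[of z] by auto
  qed
  then have "past_barrier p \<Theta> M \<rho> m0 (q * m) w'"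
    unfolding past_barrier_def using bar lsc near by blast
  then show ?thesis by blast
qed

text \<open>For t \<le> 0 the step is iterated until the bound at the tip is at most \<epsilon> / 2.
  For t > 0 the power solution \<open>W\<close> takes over; as it dominates the iterate on t = 0,
  the jump is upwards and harms neither semicontinuity nor touching in the past.\<close>

lemma barrier_exists:
  fixes \<Theta> :: "('a::euclidean_space \<times> real) set"
  assumes p: "p > 1" and \<Theta>: "bounded \<Theta>"
    and v: "norm (v :: 'a) = 1" and \<theta>: "\<theta> > 1" and r: "r > 0"
    and cone: "{(x, t). norm (x, t) < \<theta> * (x \<bullet> v) \<and> t \<le> 0 \<and> norm x < r} \<subseteq> UNIV - \<Theta>"
    and M: "M \<ge> 0" and \<rho>: "\<rho> > 0" and \<epsilon>: "\<epsilon> > 0"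
  obtains w where "lower_semicontinuous_on \<Theta> (\<lambda>z. ereal (w z))" "\<And>z. z \<in> \<Theta> \<Longrightarrow> barrier_point p w z"
    "\<And>z. z \<in> \<Theta> \<Longrightarrow> 0 \<le> w z" "\<And>z. z \<in> \<Theta> \<Longrightarrow> \<rho> \<le> norm z \<Longrightarrow> M \<le> w z"
    "\<forall>\<^sub>F z in at 0 within \<Theta>. w z < \<epsilon>"
proof -
  \<comment> \<open>Half of (\<theta> - 1) / (2 + \<theta>), the value at which 1 + 2 \<sigma> =
    \<theta> (1 - \<sigma>). The left side bounds |(x, t)| / s and 1 - \<sigma> bounds x \<bullet> v
    / s from below, when both the ball radius and the time span are \<sigma> s.\<close>
  define \<sigma> where "\<sigma> = (\<theta> - 1) / (2 * (2 + \<theta>))"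
  have \<sigma>: "0 < \<sigma>" "\<sigma> < 1" using \<theta> by (auto simp: \<sigma>_def field_simps)
  have \<sigma>\<theta>: "1 + 2 * \<sigma> < \<theta> * (1 - \<sigma>)"
  proof -
    have "2 * (2 + \<theta>) \<noteq> 0" using \<theta> by simp
    then have "\<sigma> * (2 * (2 + \<theta>)) = \<theta> - 1"
      using nonzero_eq_divide_eq[of "2 * (2 + \<theta>)" \<sigma> "\<theta> - 1"] \<sigma>_def by blast
    then show ?thesis using \<theta> by (simp add: algebra_simps)
  qed
  \<comment> \<open>Points of the ball satisfy |x| \<le> s + \<sigma> s \<le> 2 s, hence the
    restriction to s < r / 2.\<close>
  have ext: "(x, t) \<notin> \<Theta>" if s: "0 < s" "s < r / 2" and t: "- (\<sigma> * s) \<le> t" "t \<le> 0"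
    and x: "norm (x - s *\<^sub>R v) \<le> \<sigma> * s" for s x t
  proof -
    have nx: "norm x \<le> s + \<sigma> * s"
      using norm_triangle_ineq[of "x - s *\<^sub>R v" "s *\<^sub>R v"] x v s by simp
    have "norm (x, t) \<le> norm x + norm t" by (rule norm_Pair_le)
    also have "\<dots> \<le> (1 + 2 * \<sigma>) * s" using nx t by (simp add: algebra_simps)
    also have "\<dots> < \<theta> * (1 - \<sigma>) * s" using \<sigma>\<theta> s by simp
    also have "\<dots> \<le> \<theta> * (x \<bullet> v)"
    proof -
      have a: "x \<bullet> v = s + (x - s *\<^sub>R v) \<bullet> v" using v by (simp add: inner_diff_left dot_square_norm)
      have "\<bar>(x - s *\<^sub>R v) \<bullet> v\<bar> \<le> \<sigma> * s"
        using Cauchy_Schwarz_ineq2[of "x - s *\<^sub>R v" v] x v by simp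
      then have "(1 - \<sigma>) * s \<le> x \<bullet> v" unfolding a abs_le_iff left_diff_distrib by linarith
      then show ?thesis using \<theta> by (simp add: mult.assoc)
    qed
    finally have "norm (x, t) < \<theta> * (x \<bullet> v)" .
    moreover have "norm x < r"
    proof -
      have "\<sigma> * s \<le> s" using \<sigma> s by simp
      then show ?thesis using nx s by linarith
    qed
    ultimately show ?thesis using cone t by blast
  qed
  define K where "K = real DIM('a) / (p - 1)"
  define q where "q = (1 + (\<sigma> powr (- K) - 1) / (\<sigma> powr (- K) - 2 powr (- K))) / 2"
  have q: "0 < q" "q < 1"
  proof -
    have K0: "K > 0" using p by (simp add: K_def)
    have "\<sigma> powr (- K) > 1" using powr_less_mono2_neg[of "- K" \<sigma> 1] \<sigma> K0 by simp
    moreover have "2 powr (- K) < (1::real)" using powr_less_mono2_neg[of "- K" 1 2] K0 by simp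
    ultimately have "0 < (\<sigma> powr (- K) - 1) / (\<sigma> powr (- K) - 2 powr (- K))"
       "(\<sigma> powr (- K) - 1) / (\<sigma> powr (- K) - 2 powr (- K)) < 1" by simp_all
    then show "0 < q" "q < 1" by (simp_all add: q_def)
  qed
  obtain T where T: "T > 0" "\<And>z. z \<in> \<Theta> \<Longrightarrow> norm z \<le> T" using \<Theta> unfolding bounded_pos by blast
  define m0 where "m0 = M + T"
  have m0: "m0 > 0" using M T by (simp add: m0_def)
  have iter: "\<exists>w. past_barrier p \<Theta> M \<rho> m0 (q ^ N * m0) w" for N
  proof (induction N)
    case 0
    show ?case using past_barrier_start[OF p M T(2), where \<rho>=\<rho>] by (auto simp: m0_def)
  next
    case (Suc N)
    then obtain w where "past_barrier p \<Theta> M \<rho> m0 (q ^ N * m0) w" by blast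
    from past_barrier_step[OF p K_def v \<sigma> \<sigma>(1) less_imp_le[OF \<sigma>(2)] half_gt_zero[OF r] \<rho> ext q_def _ this]
    show ?case using q m0 by (simp add: mult.assoc)
  qed
  \<comment> \<open>\<open>W\<close> takes the value \<epsilon>' at the origin, so half of
    \<epsilon> leaves room for W < \<epsilon> nearby.\<close>
  define \<epsilon>' where "\<epsilon>' = \<epsilon> / 2"
  obtain N where "q ^ N < \<epsilon>' / m0" using real_arch_pow_inv[of "\<epsilon>' / m0" q] q \<epsilon> m0 by (auto simp: \<epsilon>'_def)
  then have N: "q ^ N * m0 \<le> \<epsilon>'" using m0 by (simp add: pos_less_divide_eq)
  obtain u where u: "past_barrier p \<Theta> M \<rho> m0 (q ^ N * m0) u" using iter by blast
  obtain d where d: "d > 0" "\<And>z. z \<in> \<Theta> \<Longrightarrow> snd z \<le> 0 \<Longrightarrow> norm z < d \<Longrightarrow> u z \<le> \<epsilon>'"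
    using u N unfolding past_barrier_def by (meson order_trans)
  have uz: "0 \<le> u z" "u z \<le> m0" "barrier_point p u z" "\<rho> \<le> norm z \<Longrightarrow> M \<le> u z"
    if "z \<in> \<Theta>" "snd z \<le> 0" for z
    using u that unfolding past_barrier_def by blast+
  have ulsc: "lower_semicontinuous_on (\<Theta> \<inter> {z. snd z \<le> 0}) (\<lambda>z. ereal (u z))"
    using u unfolding past_barrier_def by blast
  define p' where "p' = p / (p - 1)"
  have p': "p' > 0" using p by (simp add: p'_def)
  \<comment> \<open>The first entry gives W \<ge> m0 \<ge> u on t = 0 at distance at least d from
    the origin; the second gives W \<ge> M where |x| \<ge> \<rho>/2 and t > 0.\<close>
  define A where "A = max (m0 / d powr p') (M / (\<rho> / 2) powr p') + 1"
  have A: "A > 0" "m0 \<le> A * d powr p'" "M \<le> A * (\<rho> / 2) powr p'"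
  proof -
    have "m0 / d powr p' \<ge> 0" using m0 by simp
    then show "A > 0" by (simp add: A_def max_def)
    have "m0 / d powr p' \<le> A" by (simp add: A_def)
    then show "m0 \<le> A * d powr p'" using d by (simp add: pos_divide_le_eq)
    have "M / (\<rho> / 2) powr p' \<le> A" by (simp add: A_def)
    then show "M \<le> A * (\<rho> / 2) powr p'" using \<rho> by (simp add: pos_divide_le_eq)
  qed
  \<comment> \<open>The first entry makes W a strict supersolution; the second gives W \<ge> M for t
    \<ge> \<rho>/2. A point of norm at least \<rho> with t > 0 has |x| \<ge> \<rho>/2 or t \<ge>
    \<rho>/2.\<close>
  define B where "B = max (real DIM('a) * (A * p') powr (p - 1)) (2 * M / \<rho>) + 1"
  have B: "real DIM('a) * (A * p') powr (p - 1) < B" "2 * M / \<rho> \<le> B" by (simp_all add: B_def)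
  have B0: "B > 0" using B(1) by (meson less_le_trans mult_nonneg_nonneg not_le of_nat_0_le_iff powr_ge_zero order_le_less_trans)
  define W where "W z = \<epsilon>' + A * norm (fst z) powr p' + B * snd z" for z :: "'a \<times> real"
  have cW: "continuous_on UNIV W" unfolding W_def
    by (intro continuous_intros continuous_on_powr') (use p' in auto)
  define w where "w z = (if snd z \<le> 0 then u z else W z)" for z
  have Wbar: "barrier_point p W z" for z
    using barrier_point_power[OF p A(1) p'_def B(1), of \<epsilon>' "fst z" "snd z"] by (simp add: W_def[abs_def])
  have W0: "\<epsilon>' \<le> W z" if "snd z \<ge> 0" for z using that A B0 by (simp add: W_def)
  have uW: "u z \<le> W z" if z: "z \<in> \<Theta>" "snd z = 0" for z
  proof (cases "norm z < d")
    case True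
    then show ?thesis using d(2)[OF z(1)] W0[of z] z(2) by simp
  next
    case False
    have "norm z = norm (fst z)" using z(2) by (cases z) (simp add: norm_Pair)
    then have "d powr p' \<le> norm (fst z) powr p'" using False d p' by (intro powr_mono2) auto
    then have "A * d powr p' \<le> A * norm (fst z) powr p'" using A(1) by simp
    then show ?thesis using uz(2)[of z] z A(2) \<epsilon> by (simp add: W_def \<epsilon>'_def)
  qed
  show ?thesis
  proof (rule that[of w])
    show "lower_semicontinuous_on \<Theta> (\<lambda>z. ereal (w z))"
    proof (rule lower_semicontinuous_onI)
      fix z c assume z: "z \<in> \<Theta>" and c: "c < ereal (w z)"
      have past: "\<exists>U. open U \<and> z \<in> U \<and> (\<forall>y\<in>U. y \<in> \<Theta> \<longrightarrow> snd y \<le> 0 \<longrightarrow> c < ereal (u y))"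
      proof (cases "snd z \<le> 0")
        case True
        then have "z \<in> \<Theta> \<inter> {z. snd z \<le> 0}" "c < ereal (u z)" using z c by (auto simp: w_def)
        from lower_semicontinuous_onD[OF ulsc this] show ?thesis by (metis IntI mem_Collect_eq)
      next
        case False
        have "open {y :: 'a \<times> real. 0 < snd y}" by (intro open_Collect_less continuous_intros)
        then show ?thesis using False by (intro exI[of _ "{y. 0 < snd y}"]) auto
      qed
      have future: "\<exists>U. open U \<and> z \<in> U \<and> (\<forall>y\<in>U. snd y > 0 \<longrightarrow> c < ereal (W y))"
      proof (cases "snd z < 0")
        case True
        have "open {y :: 'a \<times> real. snd y < 0}" by (intro open_Collect_less continuous_intros)
        then show ?thesis using True by (intro exI[of _ "{y. snd y < 0}"]) auto
      next
        case False
        have "w z \<le> W z"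
        proof (cases "snd z = 0")
          case True then show ?thesis using uW[OF z] by (simp add: w_def)
        next
          case False with \<open>\<not> snd z < 0\<close> show ?thesis by (simp add: w_def)
        qed
        then have "c < ereal (W z)" using c by (meson ereal_less_eq(3) less_le_trans)
        from lower_semicontinuous_onD[OF lower_semicontinuous_on_continuous[OF cW] UNIV_I this]
        show ?thesis by (metis UNIV_I)
      qed
      obtain U1 U2 where "open U1" "z \<in> U1" "\<forall>y\<in>U1. y \<in> \<Theta> \<longrightarrow> snd y \<le> 0 \<longrightarrow> c < ereal (u y)"
         "open U2" "z \<in> U2" "\<forall>y\<in>U2. snd y > 0 \<longrightarrow> c < ereal (W y)" using past future by blast
      then show "\<exists>U. open U \<and> z \<in> U \<and> (\<forall>y\<in>U. y \<in> \<Theta> \<longrightarrow> c < ereal (w y))"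
        by (intro exI[of _ "U1 \<inter> U2"]) (auto simp: w_def)
    qed
    show "barrier_point p w z" if z: "z \<in> \<Theta>" for z
    proof (cases "snd z \<le> 0")
      case True
      show ?thesis
        by (rule barrier_point_le[OF uz(3)[OF z True], where e=1]) (use True in \<open>auto simp: w_def\<close>)
    next
      case False
      have pos: "snd y > 0" if "y \<in> ball z (snd z)" for y
        using that dist_snd_le[of z y] False by (simp add: dist_real_def abs_less_iff)
      have "w y \<le> W y" if "y \<in> ball z (snd z)" for y using pos[OF that] by (simp add: w_def)
      then show ?thesis
        by (intro barrier_point_le[OF Wbar, where e="snd z"]) (use False in \<open>simp_all add: w_def\<close>)
    qed
    show "0 \<le> w z" if "z \<in> \<Theta>" for z
      using uz(1)[OF that] W0[of z] \<epsilon> by (auto simp: w_def \<epsilon>'_def)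
    show "M \<le> w z" if z: "z \<in> \<Theta>" "\<rho> \<le> norm z" for z
    proof (cases "snd z \<le> 0")
      case True then show ?thesis using uz(4)[OF z(1) True z(2)] by (simp add: w_def)
    next
      case False
      have "norm z \<le> norm (fst z) + norm (snd z)" using norm_Pair_le[of "fst z" "snd z"] by simp
      then consider "\<rho> / 2 \<le> norm (fst z)" | "\<rho> / 2 \<le> snd z" using z(2) False by fastforce
      then have "M \<le> W z"
      proof cases
        case 1
        then have "(\<rho> / 2) powr p' \<le> norm (fst z) powr p'" using \<rho> p' by (intro powr_mono2) auto
        then have "A * (\<rho> / 2) powr p' \<le> A * norm (fst z) powr p'" using A(1) by simp
        moreover have "0 \<le> B * snd z" using B0 False by simp
        ultimately show ?thesis using A(3) \<epsilon> by (simp add: W_def \<epsilon>'_def)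
      next
        case 2
        have "M = (2 * M / \<rho>) * (\<rho> / 2)" using \<rho> by simp
        also have "\<dots> \<le> B * snd z" using B(2) B0 2 \<rho> by (intro mult_mono) auto
        finally show ?thesis using A(1) \<epsilon> by (simp add: W_def \<epsilon>'_def add_increasing)
      qed
      then show ?thesis using False by (simp add: w_def)
    qed
    have "(W \<longlongrightarrow> W 0) (at 0 within \<Theta>)"
      using cW continuous_on_subset[OF cW subset_UNIV] by (metis UNIV_I continuous_on_def tendsto_within_subset subset_UNIV)
    then have "\<forall>\<^sub>F z in at 0 within \<Theta>. W z < \<epsilon>"
      using p' \<epsilon> by (intro order_tendstoD(2)[of W "W 0"]) (auto simp: W_def \<epsilon>'_def)
    moreover have "\<forall>\<^sub>F z in at 0 within \<Theta>. z \<in> \<Theta> \<and> norm z < d"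
      using d(1) by (auto simp: eventually_at)
    ultimately show "\<forall>\<^sub>F z in at 0 within \<Theta>. w z < \<epsilon>"
    proof eventually_elim
      case (elim z)
      then show ?case using d(2)[of z] \<epsilon> by (auto simp: w_def \<epsilon>'_def)
    qed
  qed
qed

section \<open>Regularity of the tip\<close>

lemma barrier_point_add_const:
  assumes "barrier_point p w z0"
  shows "barrier_point p (\<lambda>z. w z + k) z0"
proof -
  obtain X H e where H: "open X" "fst z0 \<in> X" "exact_solution p X H" "H z0 = w z0" "0 < e"
     "\<forall>z\<in>ball z0 e. snd z \<le> snd z0 \<longrightarrow> z \<noteq> z0 \<longrightarrow> w z < H z"
    using assms unfolding barrier_point_def by blast
  then show ?thesis unfolding barrier_point_def
    by (intro exI[of _ X] exI[of _ "\<lambda>z. H z + k"] exI[of _ e]) (auto intro: exact_solution_add_const)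
qed

lemma lower_semicontinuous_on_add_const:
  fixes w :: "'a::topological_space \<Rightarrow> real"
  assumes "lower_semicontinuous_on S (\<lambda>z. ereal (w z))"
  shows "lower_semicontinuous_on S (\<lambda>z. ereal (w z + k))"
  using lower_semicontinuous_on_add[OF assms _ lower_semicontinuous_on_continuous[OF continuous_on_const[of S k]]]
  by simp

lemma eventually_norm_ge_within:
  assumes "\<rho> < norm (\<xi> :: 'a::real_normed_vector)"
  shows "\<forall>\<^sub>F z in at \<xi> within S. \<rho> \<le> norm z"
proof -
  have "((\<lambda>z. norm z) \<longlongrightarrow> norm \<xi>) (at \<xi> within S)" by (intro tendsto_intros)
  from order_tendstoD(1)[OF this assms] show ?thesis by (rule eventually_mono) simp
qed

theorem proposition5p3:
  fixes p :: real and \<Theta> :: "((real^'n) \<times> real) set"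
  assumes "1 < p"
    and "open \<Theta>" and "bounded \<Theta>"
    and "(0, 0) \<in> frontier \<Theta>"
    and "\<exists>(\<theta>::real) (r::real) (v::real^'n). \<theta> > 1 \<and> r > 0 \<and> norm v = 1 \<and>
           {(x, t). norm (x, t) < \<theta> * (x \<bullet> v) \<and> t \<le> 0 \<and> norm x < r} \<subseteq> UNIV - \<Theta>"
  shows "regular_point p \<Theta> (0, 0)"
  unfolding regular_point_def
proof (intro conjI allI impI)
  show "(0, 0) \<in> frontier \<Theta>" by fact
  fix f :: "(real^'n) \<times> real \<Rightarrow> real" assume f: "continuous_on (frontier \<Theta>) f"
  note p = assms(1) and \<Theta> = assms(2,3)
  obtain \<theta> r and v :: "real^'n" where \<theta>: "\<theta> > 1" "r > 0" "norm v = 1"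
    "{(x, t). norm (x, t) < \<theta> * (x \<bullet> v) \<and> t \<le> 0 \<and> norm x < r} \<subseteq> UNIV - \<Theta>"
    using assms(5) by blast
  have zero: "(0, 0) = (0 :: (real^'n) \<times> real)" by (simp add: zero_prod_def)
  define f0 where "f0 = f 0"
  have z\<Theta>: "0 \<in> frontier \<Theta>" using assms(4) by (simp add: zero)
  have "compact (frontier \<Theta>)" using \<Theta>(2) by (simp add: compact_frontier_bounded)
  then have "compact (f ` frontier \<Theta>)" by (rule compact_continuous_image[OF f])
  then have "bounded (f ` frontier \<Theta>)" by (rule compact_imp_bounded)
  then obtain F where "F > 0 \<and> (\<forall>y\<in>f ` frontier \<Theta>. norm y \<le> F)"
    unfolding bounded_pos by (rule exE)
  then have F: "F > 0" "\<And>\<xi>. \<xi> \<in> frontier \<Theta> \<Longrightarrow> \<bar>f \<xi>\<bar> \<le> F" by simp_all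
  have main: "\<forall>\<^sub>F z in at 0 within \<Theta>. ereal (f0 - 2 * \<epsilon>) \<le> upper_Perron p \<Theta> f z \<and>
      upper_Perron p \<Theta> f z \<le> ereal (f0 + 2 * \<epsilon>)" if \<epsilon>: "\<epsilon> > 0" for \<epsilon>
  proof -
    have "\<exists>d>0. \<forall>\<xi>\<in>frontier \<Theta>. dist \<xi> 0 < d \<longrightarrow> dist (f \<xi>) (f 0) < \<epsilon>"
      using f z\<Theta> \<epsilon> unfolding continuous_on_iff by blast
    then obtain d where d: "d > 0" "\<And>\<xi>. \<xi> \<in> frontier \<Theta> \<Longrightarrow> norm \<xi> < d \<Longrightarrow> \<bar>f \<xi> - f0\<bar> < \<epsilon>"
      by (auto simp: dist_real_def f0_def)
    \<comment> \<open>The height 2 F bounds |f \<xi> - f0| on the whole boundary. It is needed only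
      for |\<xi>| \<ge> d, and points of \<Theta> close to such \<xi> have norm at least d /
      2.\<close>
    have M: "2 * F \<ge> 0" and \<rho>: "d / 2 > 0" using F d by auto
    obtain w where lsc: "lower_semicontinuous_on \<Theta> (\<lambda>z. ereal (w z))"
      and bar: "\<And>z. z \<in> \<Theta> \<Longrightarrow> barrier_point p w z"
      and w0: "\<And>z. z \<in> \<Theta> \<Longrightarrow> 0 \<le> w z" and wM: "\<And>z. z \<in> \<Theta> \<Longrightarrow> d / 2 \<le> norm z \<Longrightarrow> 2 * F \<le> w z"
      and near: "\<forall>\<^sub>F z in at 0 within \<Theta>. w z < \<epsilon>"
      by (rule barrier_exists[OF p \<Theta>(2) \<theta>(3,1,2,4) M \<rho> \<epsilon>]) blast
    have inside: "\<forall>\<^sub>F z in at \<xi> within \<Theta>. z \<in> \<Theta>" for \<xi> by (simp add: eventually_at_filter)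
    have bd: "\<forall>\<^sub>F z in at \<xi> within \<Theta>. \<bar>f \<xi> - f0\<bar> \<le> \<epsilon> + w z" if \<xi>: "\<xi> \<in> frontier \<Theta>" for \<xi>
    proof (cases "norm \<xi> < d")
      case True
      then have *: "\<bar>f \<xi> - f0\<bar> < \<epsilon>" using d(2) \<xi> by blast
      from inside[of \<xi>] show ?thesis
      proof eventually_elim
        case (elim z)
        then show ?case using * w0[of z] by simp
      qed
    next
      case False
      then have "d / 2 < norm \<xi>" using d(1) by simp
      from eventually_norm_ge_within[OF this, of \<Theta>] inside[of \<xi>] show ?thesis
      proof eventually_elim
        case (elim z)
        have "\<bar>f \<xi> - f0\<bar> \<le> 2 * F" using F(2)[OF \<xi>] F(2)[OF z\<Theta>] by (simp add: f0_def)
        then show ?case using wM[of z] elim \<epsilon> by simp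
      qed
    qed
    \<comment> \<open>The barrier serves twice: f0 + \<epsilon> + w is itself a member of the upper
      class, and every member of that class lies above f0 - \<epsilon> - w. Near the tip both are
      within 2 \<epsilon> of f0.\<close>
    have "(\<lambda>z. ereal (w z + (f0 + \<epsilon>))) \<in> upper_class p \<Theta> f"
      unfolding upper_class_def
    proof (intro CollectI conjI ballI)
      show "p_superparabolic p \<Theta> (\<lambda>z. ereal (w z + (f0 + \<epsilon>)))"
        by (intro barrier_p_superparabolic[OF p] lower_semicontinuous_on_add_const lsc
              barrier_point_add_const bar)
      show "\<exists>m. \<forall>z\<in>\<Theta>. ereal m \<le> ereal (w z + (f0 + \<epsilon>))"
        using w0 by (intro exI[of _ "f0 + \<epsilon>"]) simp
      fix \<xi> assume "\<xi> \<in> frontier \<Theta>"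
      from bd[OF this] have "\<forall>\<^sub>F z in at \<xi> within \<Theta>. ereal (f \<xi>) \<le> ereal (w z + (f0 + \<epsilon>))"
        by (rule eventually_mono) (simp add: abs_le_iff)
      then show "ereal (f \<xi>) \<le> Liminf (at \<xi> within \<Theta>) (\<lambda>z. ereal (w z + (f0 + \<epsilon>)))"
        by (rule Liminf_bounded)
    qed
    then have upper: "upper_Perron p \<Theta> f z \<le> ereal (w z + (f0 + \<epsilon>))" for z
      unfolding upper_Perron_def by (rule INF_lower)
    have lower: "ereal (- (w z + (\<epsilon> - f0))) \<le> upper_Perron p \<Theta> f z" if z: "z \<in> \<Theta>" for z
      unfolding upper_Perron_def
    proof (rule INF_greatest)
      fix u assume "u \<in> upper_class p \<Theta> f"
      then have u: "p_superparabolic p \<Theta> u"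
        and ub: "\<And>\<xi>. \<xi> \<in> frontier \<Theta> \<Longrightarrow> ereal (f \<xi>) \<le> Liminf (at \<xi> within \<Theta>) u"
        by (auto simp: upper_class_def)
      show "ereal (- (w z + (\<epsilon> - f0))) \<le> u z"
      proof (rule superparabolic_barrier_comparison[OF p \<Theta> u _ _ _ z, where w="\<lambda>z. w z + (\<epsilon> - f0)"])
        show "lower_semicontinuous_on \<Theta> (\<lambda>z. ereal (w z + (\<epsilon> - f0)))"
          by (rule lower_semicontinuous_on_add_const[OF lsc])
        show "barrier_point p (\<lambda>z. w z + (\<epsilon> - f0)) y" if "y \<in> \<Theta>" for y
          by (rule barrier_point_add_const[OF bar[OF that]])
        fix \<xi> \<delta> assume \<xi>: "\<xi> \<in> frontier \<Theta>" and \<delta>: "(\<delta>::real) > 0"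
        have "\<forall>\<^sub>F z in at \<xi> within \<Theta>. ereal (f \<xi> - \<delta>) < u z"
          using ub[OF \<xi>] \<delta> unfolding le_Liminf_iff by simp
        with bd[OF \<xi>] show "\<forall>\<^sub>F z in at \<xi> within \<Theta>. ereal (- \<delta>) < u z + ereal (w z + (\<epsilon> - f0))"
        proof eventually_elim
          case (elim z)
          then show ?case by (cases "u z") (auto simp: abs_le_iff)
        qed
      qed
    qed
    from near inside[of 0] show ?thesis
    proof eventually_elim
      case (elim z)
      have "ereal (f0 - 2 * \<epsilon>) \<le> ereal (- (w z + (\<epsilon> - f0)))" using elim(1) by simp
      also note lower[OF elim(2)]
      finally have 1: "ereal (f0 - 2 * \<epsilon>) \<le> upper_Perron p \<Theta> f z" .
      note upper[of z]
      also have "ereal (w z + (f0 + \<epsilon>)) \<le> ereal (f0 + 2 * \<epsilon>)" using elim(1) by simp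
      finally show ?case using 1 by simp
    qed
  qed
  have "(upper_Perron p \<Theta> f \<longlongrightarrow> ereal f0) (at 0 within \<Theta>)"
  proof (rule order_tendstoI)
    fix a assume "a < ereal f0"
    then obtain b where b: "a < ereal b" "b < f0" using ereal_dense2 by (metis less_ereal.simps(1))
    have "(f0 - b) / 2 > 0" using b by simp
    from main[OF this] show "\<forall>\<^sub>F z in at 0 within \<Theta>. a < upper_Perron p \<Theta> f z"
    proof eventually_elim
      case (elim z)
      have "f0 - 2 * ((f0 - b) / 2) = b" by (simp add: field_simps)
      then have "ereal b \<le> upper_Perron p \<Theta> f z" using elim by metis
      then show ?case using b(1) by (rule less_le_trans[rotated])
    qed
  next
    fix a assume "ereal f0 < a"
    then obtain b where b: "ereal b < a" "f0 < b" using ereal_dense2 by (metis less_ereal.simps(1))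
    have "(b - f0) / 2 > 0" using b by simp
    from main[OF this] show "\<forall>\<^sub>F z in at 0 within \<Theta>. upper_Perron p \<Theta> f z < a"
    proof eventually_elim
      case (elim z)
      have "f0 + 2 * ((b - f0) / 2) = b" by (simp add: field_simps)
      then have "upper_Perron p \<Theta> f z \<le> ereal b" using elim by metis
      then show ?case using b(1) by (rule le_less_trans)
    qed
  qed
  then show "(upper_Perron p \<Theta> f \<longlongrightarrow> ereal (f (0, 0))) (at (0, 0) within \<Theta>)"
    by (simp only: zero f0_def)
qed

end
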